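(* Let $G$ be an ADB-AC graph with a planar annular embedding having $x\ge 3$ annuli $A_1,\dots,A_x$. (1) If for every $k$ with $2\le k\le x$ the edges in the interior of $A_k$ are attached to faces in the $4$-cycle class of the outer annulus $O(G_{k-1})$ of the $(k-1)$-annular restriction $G_{k-1}$, then $G$ is Hamiltonian. (2) If for every $k$ with $2\le k\le x$ the edges in the interior of $A_k$ are attached to faces not in the $4$-cycle class of $O(G_{k-1})$, then $G$ is Hamiltonian.
   Context: A Barnette graph is a finite $3$-regular, $3$-connected, planar, bipartite graph. A Barnette graph $G$ is an $x$-ADB graph if it has a plane embedding (a planar annular embedding) with pairwise vertex-disjoint cycles $C_0,C_1,\dots,C_x$ of $G$, each $C_{k-1}$ lying in the bounded region of $C_k$, such that $C_0$ bounds a face, $C_x$ bounds the unbounded face, every vertex lies on some $C_k$, and every edge is either an edge of some $C_k$ or joins a vertex of $C_{k-1}$ to a vertex of $C_k$ for some $1\le k\le x$. The closed region between $C_{k-1}$ and $C_k$ is the $k$-th annulus $A_k$; edges joining $C_{k-1}$ to $C_k$ lie in the interior of $A_k$; the faces of $G$ inside $A_k$ are the faces of $A_k$; $A_x$ is the outer annulus. Suppressing degree-$2$ vertices means replacing each maximal path whose internal vertices have degree $2$ by a single edge (a cycle all of whose vertices have degree $2$ becomes a vertex-less closed curve). An $x$-ADB graph with $x>2$ is annular connected (ADB-AC) if for every $k$, deleting the edges in the interior of $A_k$ and suppressing degree-$2$ vertices yields either two Barnette graphs or a Barnette graph and a vertex-less closed curve. For $1\le k<x$, the $k$-annular restriction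 $G_k$ is obtained from the subgraph consisting of $C_0,\dots,C_k$ and the edges in the interiors of $A_1,\dots,A_k$ by suppressing degree-$2$ vertices; its outer annulus $O(G_k)$ is its $k$-th annulus. The faces of an outer annulus are cyclically arranged, consecutive ones sharing an edge in the interior of the annulus; they split into two alternating classes of pairwise non-adjacent faces; the class consisting only of $4$-cycles is called the $4$-cycle class. Each edge in the interior of $A_k$ ($k\ge 2$) has its endpoint on $C_{k-1}$ lying on an edge of the outer boundary of $G_{k-1}$, belonging to a unique face of $O(G_{k-1})$; the edge is said to be attached to that face. *)

theory Defs
  imports "HOL-Analysis.Analysis"
begin

section \<open>Graphs\<close>

record 'a graph =
  verts :: "'a set"
  edges :: "'a set set"

definition simple_graph :: "'a graph \<Rightarrow> bool" where
  "simple_graph G \<longleftrightarrow> (\<forall>e\<in>edges G. e \<subseteq> verts G \<and> card e = 2)"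

definition degree :: "'a graph \<Rightarrow> 'a \<Rightarrow> nat" where
  "degree G v = card {e \<in> edges G. v \<in> e}"

definition graph_connected :: "'a graph \<Rightarrow> bool" where
  "graph_connected G \<longleftrightarrow> verts G \<noteq> {} \<and>
     (\<forall>u\<in>verts G. \<forall>v\<in>verts G. (\<lambda>a b. {a, b} \<in> edges G)\<^sup>*\<^sup>* u v)"

definition delete_verts :: "'a graph \<Rightarrow> 'a set \<Rightarrow> 'a graph" where
  "delete_verts G S = \<lparr>verts = verts G - S, edges = {e \<in> edges G. e \<inter> S = {}}\<rparr>"

definition vertex_connected :: "nat \<Rightarrow> 'a graph \<Rightarrow> bool" where
  "vertex_connected n G \<longleftrightarrow> card (verts G) > n \<and>
     (\<forall>S. S \<subseteq> verts G \<and> card S < n \<longrightarrow> graph_connected (delete_verts G S))"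

definition bipartite :: "'a graph \<Rightarrow> bool" where
  "bipartite G \<longleftrightarrow> (\<exists>A B. A \<union> B = verts G \<and> A \<inter> B = {} \<and>
     (\<forall>e\<in>edges G. \<exists>a\<in>A. \<exists>b\<in>B. e = {a, b}))"

definition path_edges :: "'a list \<Rightarrow> 'a set set" where
  "path_edges vs = {{vs ! i, vs ! Suc i} | i. Suc i < length vs}"

definition cycle_edges :: "'a list \<Rightarrow> 'a set set" where
  "cycle_edges c = {{c ! i, c ! (Suc i mod length c)} | i. i < length c}"

definition is_cycle :: "'a graph \<Rightarrow> 'a list \<Rightarrow> bool" where
  "is_cycle G c \<longleftrightarrow> distinct c \<and> length c \<ge> 3 \<and> cycle_edges c \<subseteq> edges G"

definition hamiltonian :: "'a graph \<Rightarrow> bool" where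
  "hamiltonian G \<longleftrightarrow> (\<exists>c. is_cycle G c \<and> set c = verts G)"


section \<open>Plane embeddings\<close>

text \<open>The vertex \<open>v\<close> is drawn as the point \<open>p v\<close> and the edge \<open>e\<close> as the arc \<open>\<gamma> e\<close>.\<close>

definition plane_embedding ::
    "'a graph \<Rightarrow> ('a \<Rightarrow> complex) \<Rightarrow> ('a set \<Rightarrow> real \<Rightarrow> complex) \<Rightarrow> bool" where
  "plane_embedding G p \<gamma> \<longleftrightarrow>
     inj_on p (verts G) \<and>
     (\<forall>e\<in>edges G. arc (\<gamma> e) \<and> {pathstart (\<gamma> e), pathfinish (\<gamma> e)} = p ` e \<and>
        path_image (\<gamma> e) \<inter> p ` verts G = p ` e) \<and>
     (\<forall>e\<in>edges G. \<forall>f\<in>edges G. e \<noteq> f \<longrightarrow>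
        path_image (\<gamma> e) \<inter> path_image (\<gamma> f) = p ` (e \<inter> f))"

definition planar :: "'a graph \<Rightarrow> bool" where
  "planar G \<longleftrightarrow> (\<exists>p \<gamma>. plane_embedding G p \<gamma>)"

definition curve :: "('a set \<Rightarrow> real \<Rightarrow> complex) \<Rightarrow> 'a set set \<Rightarrow> complex set" where
  "curve \<gamma> S = (\<Union>e\<in>S. path_image (\<gamma> e))"

definition faces ::
    "('a \<Rightarrow> complex) \<Rightarrow> ('a set \<Rightarrow> real \<Rightarrow> complex) \<Rightarrow> 'a graph \<Rightarrow> complex set set" where
  "faces p \<gamma> H = components (- (p ` verts H \<union> curve \<gamma> (edges H)))"

definition barnette :: "'a graph \<Rightarrow> bool" where
  "barnette G \<longleftrightarrow> simple_graph G \<and> finite (verts G) \<and> (\<forall>v\<in>verts G. degree G v = 3) \<and>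
     vertex_connected 3 G \<and> planar G \<and> bipartite G"


section \<open>Suppressing vertices of degree two\<close>

definition suppressible_path :: "'a graph \<Rightarrow> 'a list \<Rightarrow> bool" where
  "suppressible_path H vs \<longleftrightarrow> distinct vs \<and> length vs \<ge> 2 \<and> set vs \<subseteq> verts H \<and>
     path_edges vs \<subseteq> edges H \<and>
     degree H (hd vs) \<noteq> 2 \<and> degree H (last vs) \<noteq> 2 \<and>
     (\<forall>v\<in>set (butlast (tl vs)). degree H v = 2)"

text \<open>
  The result is a simple graph: parallel edges created by the suppression are merged and loops
  are dropped. When all vertices of \<open>H\<close> have degree 2 or 3, as in every use below, a merged edge
  or a dropped loop leaves its endpoints with degree less than 3. Hence \<open>suppress H\<close> is a Barnette
  graph only if no edge was merged and no loop was dropped.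
  A component of \<open>H\<close> that is a cycle of degree-2 vertices leaves no vertex and no edge behind;
  this case is recognised on \<open>H\<close> itself by \<open>closed_curve\<close>.
\<close>

definition suppress :: "'a graph \<Rightarrow> 'a graph" where
  "suppress H = \<lparr>verts = {v \<in> verts H. degree H v \<noteq> 2},
                 edges = {{hd vs, last vs} | vs. suppressible_path H vs}\<rparr>"

definition closed_curve :: "'a graph \<Rightarrow> bool" where
  "closed_curve H \<longleftrightarrow> (\<exists>c. is_cycle H c \<and> verts H = set c \<and> edges H = cycle_edges c)"


section \<open>Annular embeddings\<close>

definition annulus_edges :: "'a graph \<Rightarrow> (nat \<Rightarrow> 'a list) \<Rightarrow> nat \<Rightarrow> 'a set set" where
  "annulus_edges G C k =
     {e \<in> edges G. \<exists>u\<in>set (C (k - 1)). \<exists>v\<in>set (C k). e = {u, v}}"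

definition annular_embedding ::
    "'a graph \<Rightarrow> ('a \<Rightarrow> complex) \<Rightarrow> ('a set \<Rightarrow> real \<Rightarrow> complex) \<Rightarrow> (nat \<Rightarrow> 'a list) \<Rightarrow> nat \<Rightarrow> bool"
  where
  "annular_embedding G p \<gamma> C x \<longleftrightarrow>
     plane_embedding G p \<gamma> \<and>
     (\<forall>k\<le>x. is_cycle G (C k)) \<and>
     (\<forall>j\<le>x. \<forall>k\<le>x. j \<noteq> k \<longrightarrow> set (C j) \<inter> set (C k) = {}) \<and>
     (\<forall>k\<in>{1..x}. curve \<gamma> (cycle_edges (C (k - 1))) \<subseteq> inside (curve \<gamma> (cycle_edges (C k)))) \<and>
     (\<exists>F\<in>faces p \<gamma> G. frontier F = curve \<gamma> (cycle_edges (C 0))) \<and>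
     (\<exists>F\<in>faces p \<gamma> G. \<not> bounded F \<and> frontier F = curve \<gamma> (cycle_edges (C x))) \<and>
     verts G = (\<Union>k\<in>{0..x}. set (C k)) \<and>
     (\<forall>e\<in>edges G. (\<exists>k\<le>x. e \<in> cycle_edges (C k)) \<or> (\<exists>k\<in>{1..x}. e \<in> annulus_edges G C k))"

text \<open>
  The subgraph formed by the cycles \<open>C i, \<dots>, C j\<close> and the edges between consecutive ones.
  Deleting the edges in the interior of the \<open>k\<close>-th annulus leaves exactly the disjoint union of
  \<open>annular_part G C 0 (k - 1)\<close> and \<open>annular_part G C k x\<close>.
\<close>

definition annular_part :: "'a graph \<Rightarrow> (nat \<Rightarrow> 'a list) \<Rightarrow> nat \<Rightarrow> nat \<Rightarrow> 'a graph" where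
  "annular_part G C i j =
     \<lparr>verts = (\<Union>k\<in>{i..j}. set (C k)),
      edges = (\<Union>k\<in>{i..j}. cycle_edges (C k)) \<union> (\<Union>k\<in>{i<..j}. annulus_edges G C k)\<rparr>"

definition adb_ac ::
    "'a graph \<Rightarrow> ('a \<Rightarrow> complex) \<Rightarrow> ('a set \<Rightarrow> real \<Rightarrow> complex) \<Rightarrow> (nat \<Rightarrow> 'a list) \<Rightarrow> nat \<Rightarrow> bool"
  where
  "adb_ac G p \<gamma> C x \<longleftrightarrow>
     barnette G \<and> annular_embedding G p \<gamma> C x \<and> x > 2 \<and>
     (\<forall>k\<in>{1..x}.
        let I = annular_part G C 0 (k - 1); J = annular_part G C k x in
          barnette (suppress I) \<and> barnette (suppress J) \<or>
          barnette (suppress I) \<and> closed_curve J \<or>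
          closed_curve I \<and> barnette (suppress J))"

definition annular_restriction :: "'a graph \<Rightarrow> (nat \<Rightarrow> 'a list) \<Rightarrow> nat \<Rightarrow> 'a graph" where
  "annular_restriction G C k = suppress (annular_part G C 0 k)"


section \<open>The outer annulus of an annular restriction\<close>

definition annulus ::
    "('a set \<Rightarrow> real \<Rightarrow> complex) \<Rightarrow> (nat \<Rightarrow> 'a list) \<Rightarrow> nat \<Rightarrow> complex set" where
  "annulus \<gamma> C k =
     (curve \<gamma> (cycle_edges (C k)) \<union> inside (curve \<gamma> (cycle_edges (C k))))
     - inside (curve \<gamma> (cycle_edges (C (k - 1))))"

text \<open>
  Suppressing vertices does not change the set of points covered by a drawing, so the faces of
  \<open>annular_restriction G C k\<close> are those of \<open>annular_part G C 0 k\<close>.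
\<close>

definition outer_faces ::
    "'a graph \<Rightarrow> ('a \<Rightarrow> complex) \<Rightarrow> ('a set \<Rightarrow> real \<Rightarrow> complex) \<Rightarrow> (nat \<Rightarrow> 'a list) \<Rightarrow> nat
      \<Rightarrow> complex set set" where
  "outer_faces G p \<gamma> C k = {F \<in> faces p \<gamma> (annular_part G C 0 k). F \<subseteq> annulus \<gamma> C k}"

definition adjacent_outer_faces ::
    "'a graph \<Rightarrow> ('a set \<Rightarrow> real \<Rightarrow> complex) \<Rightarrow> (nat \<Rightarrow> 'a list) \<Rightarrow> nat
      \<Rightarrow> complex set \<Rightarrow> complex set \<Rightarrow> bool" where
  "adjacent_outer_faces G \<gamma> C k F F' \<longleftrightarrow> F \<noteq> F' \<and>
     (\<exists>e\<in>annulus_edges G C k. path_image (\<gamma> e) \<subseteq> frontier F \<inter> frontier F')"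

definition alternating_class ::
    "'a graph \<Rightarrow> ('a \<Rightarrow> complex) \<Rightarrow> ('a set \<Rightarrow> real \<Rightarrow> complex) \<Rightarrow> (nat \<Rightarrow> 'a list) \<Rightarrow> nat
      \<Rightarrow> complex set set \<Rightarrow> bool" where
  "alternating_class G p \<gamma> C k Q \<longleftrightarrow>
     Q \<subseteq> outer_faces G p \<gamma> C k \<and>
     (\<forall>F\<in>Q. \<forall>F'\<in>Q. \<not> adjacent_outer_faces G \<gamma> C k F F') \<and>
     (\<forall>F\<in>outer_faces G p \<gamma> C k - Q. \<forall>F'\<in>outer_faces G p \<gamma> C k - Q.
        \<not> adjacent_outer_faces G \<gamma> C k F F')"

text \<open>
  The boundary cycle is taken before suppression, and its length is that of the cycle it becomes
  in \<open>annular_restriction G C k\<close>.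
\<close>

definition bounded_by_4_cycle ::
    "'a graph \<Rightarrow> ('a set \<Rightarrow> real \<Rightarrow> complex) \<Rightarrow> (nat \<Rightarrow> 'a list) \<Rightarrow> nat \<Rightarrow> complex set \<Rightarrow> bool"
  where
  "bounded_by_4_cycle G \<gamma> C k F \<longleftrightarrow>
     (\<exists>c. is_cycle (annular_part G C 0 k) c \<and> frontier F = curve \<gamma> (cycle_edges c) \<and>
        card (set c \<inter> verts (annular_restriction G C k)) = 4)"

text \<open>
  For \<open>k = 1\<close> both alternating classes consist of 4-cycles only, and either one may then serve
  as the 4-cycle class.
\<close>

definition four_cycle_class ::
    "'a graph \<Rightarrow> ('a \<Rightarrow> complex) \<Rightarrow> ('a set \<Rightarrow> real \<Rightarrow> complex) \<Rightarrow> (nat \<Rightarrow> 'a list) \<Rightarrow> nat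
      \<Rightarrow> complex set set \<Rightarrow> bool" where
  "four_cycle_class G p \<gamma> C k Q \<longleftrightarrow>
     alternating_class G p \<gamma> C k Q \<and> (\<forall>F\<in>Q. bounded_by_4_cycle G \<gamma> C k F)"

text \<open>
  \<open>attached G p \<gamma> C k e F\<close>: the edge \<open>e\<close> of the \<open>k\<close>-th annulus is attached to the face \<open>F\<close> of the
  outer annulus of the \<open>(k - 1)\<close>-annular restriction. The path \<open>vs\<close> becomes a single edge of that
  restriction, lying on its outer boundary.
\<close>

definition attached ::
    "'a graph \<Rightarrow> ('a \<Rightarrow> complex) \<Rightarrow> ('a set \<Rightarrow> real \<Rightarrow> complex) \<Rightarrow> (nat \<Rightarrow> 'a list) \<Rightarrow> nat
      \<Rightarrow> 'a set \<Rightarrow> complex set \<Rightarrow> bool" where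
  "attached G p \<gamma> C k e F \<longleftrightarrow>
     e \<in> annulus_edges G C k \<and> F \<in> outer_faces G p \<gamma> C (k - 1) \<and>
     (\<exists>u \<in> e \<inter> set (C (k - 1)). \<exists>vs.
        suppressible_path (annular_part G C 0 (k - 1)) vs \<and>
        path_edges vs \<subseteq> cycle_edges (C (k - 1)) \<and>
        u \<in> set vs \<and> curve \<gamma> (path_edges vs) \<subseteq> frontier F)"

end

theory Submission
  imports Defs
begin

text \<open>
  A Hamiltonian cycle is grown outwards, one annulus at a time. Every vertex of \<open>C j\<close> has exactly
  one edge off \<open>C j\<close>, a spoke leading inwards or outwards. Suppose a cycle runs through all vertices
  of \<open>C 0, \<dots>, C (j - 1)\<close> and uses every edge of \<open>C (j - 1)\<close> between two outward vertices. If \<open>C j\<close> is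
  cut into paths such that the spokes at the two ends of each path lead to adjacent vertices of
  \<open>C (j - 1)\<close>, then the edges joining these vertices can be replaced by detours through the paths.
  For \<open>j < x\<close> a face of the 4-cycle class supplies such adjacent vertices. In (1) the paths are the
  arcs of \<open>C j\<close> on the boundaries of these faces; in (2) such an arc is a single edge, and the rest of
  \<open>C j\<close> is one path. For \<open>j = x\<close> bipartiteness of \<open>G\<close> and of the restriction makes the number of
  outward vertices between consecutive inward vertices of \<open>C (x - 1)\<close> even, so that they can be
  paired along edges, and the outer ends of paired spokes are adjacent on \<open>C x\<close>.

  The topological input is that two spokes cut the annulus between the Jordan curves \<open>C (j - 1)\<close> and
  \<open>C j\<close> into two regions, and that every other spoke stays in one of them.
\<close>


section \<open>Paths and cycles as lists\<close>

text \<open>The hypotheses speak of components and frontiers in the plane, while the cycle is built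
  on lists. The bridge is that, between consecutive inward vertices \<open>w\<close> and
  \<open>w'\<close> of \<open>C j\<close> with inner neighbours \<open>v\<close> and
  \<open>v'\<close>, the face of the outer annulus is an explicit Jordan region, bounded by two
  spokes, an arc of \<open>C j\<close> and a path of \<open>C (j - 1)\<close>. The four spoke ends
  and all vertices of the inner path keep degree 3 in the restriction, so a boundary of length 4
  leaves the inner path without interior vertices: \<open>v\<close> and \<open>v'\<close> are
  adjacent. An interior vertex of the arc is outward and on the frontier of no other face of the
  outer annulus, so the attachment of its spoke decides whether this face is in the 4-cycle class.
  Hence the arcs of one of the two classes are single edges. That the classes alternate along
  \<open>C j\<close> rests on consecutive faces being distinct; a third inward vertex tells them
  apart, and 3-connectivity supplies it. The paths cut from \<open>C j\<close> end in inward
  vertices, so no edge between two outward vertices is cut, and the next annulus finds the cycle in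
  the form it needs.\<close>

lemma path_edges_Nil [simp]: "path_edges [] = {}"
  and path_edges_single [simp]: "path_edges [a] = {}"
  by (auto simp: path_edges_def)

lemma path_edges_Cons [simp]: "path_edges (a # b # r) = insert {a, b} (path_edges (b # r))"
proof (intro equalityI subsetI)
  fix e assume "e \<in> path_edges (a # b # r)"
  then obtain i where i: "Suc i < length (a # b # r)" "e = {(a # b # r) ! i, (a # b # r) ! Suc i}"
    unfolding path_edges_def by blast
  then show "e \<in> insert {a, b} (path_edges (b # r))"
    by (cases i) (auto simp: path_edges_def)
next
  fix e assume "e \<in> insert {a, b} (path_edges (b # r))"
  then consider "e = {a, b}" | i where "Suc i < length (b # r)" "e = {(b # r) ! i, (b # r) ! Suc i}"
    unfolding path_edges_def by blast
  then show "e \<in> path_edges (a # b # r)"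
  proof cases
    case 1
    then show ?thesis unfolding path_edges_def by (intro CollectI exI[of _ 0]) auto
  next
    case 2
    then show ?thesis unfolding path_edges_def by (intro CollectI exI[of _ "Suc i"]) auto
  qed
qed

lemma path_edges_append:
  "path_edges (xs @ a # ys) = path_edges (xs @ [a]) \<union> path_edges (a # ys)"
proof (induction xs)
  case (Cons x xs)
  then show ?case by (cases xs) auto
qed simp

lemma path_edges_rev [simp]: "path_edges (rev xs) = path_edges xs"
proof (induction xs rule: induct_list012)
  case (3 a b r)
  have "path_edges (rev (a # b # r)) = path_edges (rev r @ [b]) \<union> path_edges [b, a]"
    using path_edges_append[of "rev r" b "[a]"] by simp
  with 3 show ?case by (auto simp: insert_commute)
qed auto

lemma path_edges_subset: "e \<in> path_edges vs \<Longrightarrow> e \<subseteq> set vs"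
  by (auto simp: path_edges_def)

lemma Union_path_edges:
  assumes "length vs \<ge> 2"
  shows "\<Union> (path_edges vs) = set vs"
proof (intro equalityI subsetI)
  fix v assume "v \<in> set vs"
  then obtain i where i: "i < length vs" "v = vs ! i" by (auto simp: in_set_conv_nth)
  show "v \<in> \<Union> (path_edges vs)"
  proof (cases "Suc i < length vs")
    case True
    then show ?thesis using i unfolding path_edges_def by blast
  next
    case False
    then obtain k where "i = Suc k" using i assms by (cases i) auto
    then show ?thesis using i unfolding path_edges_def by blast
  qed
qed (use path_edges_subset in blast)

text \<open>Repeating the first vertex at the end replaces index arithmetic modulo the length by a
  plain path, so facts about \<open>path_edges\<close> carry over to cycles.\<close>

lemma cycle_edges_Cons: "cycle_edges (a # xs) = path_edges (a # xs @ [a])"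
proof -
  have "(a # xs @ [a]) ! i = (a # xs) ! i" if "i < length (a # xs)" for i
    using that nth_append[of "a # xs" "[a]" i] by simp
  moreover have "(a # xs @ [a]) ! Suc i = (a # xs) ! (Suc i mod length (a # xs))"
    if "i < length (a # xs)" for i
    using that nth_append[of "a # xs" "[a]" "Suc i"] by (cases "i = length xs") auto
  ultimately have eq: "{(a # xs) ! i, (a # xs) ! (Suc i mod length (a # xs))}
      = {(a # xs @ [a]) ! i, (a # xs @ [a]) ! Suc i}" if "i < length (a # xs)" for i
    using that by simp
  have "cycle_edges (a # xs)
      = (\<lambda>i. {(a # xs) ! i, (a # xs) ! (Suc i mod length (a # xs))}) ` {i. i < length (a # xs)}"
    unfolding cycle_edges_def by blast
  also have "\<dots> = (\<lambda>i. {(a # xs @ [a]) ! i, (a # xs @ [a]) ! Suc i}) ` {i. i < length (a # xs)}"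
    by (rule image_cong[OF refl]) (use eq in blast)
  also have "\<dots> = path_edges (a # xs @ [a])"
    unfolding path_edges_def by auto
  finally show ?thesis .
qed

lemma cycle_edges_Cons_Cons:
  "cycle_edges (a # xs @ b # ys) = path_edges (a # xs @ [b]) \<union> path_edges (b # ys @ [a])"
  using path_edges_append[of "a # xs" b "ys @ [a]"] by (simp add: cycle_edges_Cons)

lemma cycle_edges_rotate: "cycle_edges (xs @ ys) = cycle_edges (ys @ xs)"
proof (cases "xs = [] \<or> ys = []")
  case False
  then obtain a xs' b ys' where "xs = a # xs'" "ys = b # ys'"
    by (meson list.exhaust)
  then show ?thesis
    using cycle_edges_Cons_Cons[of a xs' b ys'] cycle_edges_Cons_Cons[of b ys' a xs'] by auto
qed auto

lemma cycle_edges_subset: "e \<in> cycle_edges c \<Longrightarrow> e \<subseteq> set c"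
  using path_edges_subset[of e "c @ [hd c]"]
  by (cases c) (auto simp: cycle_edges_Cons cycle_edges_def[of "[]"])

lemma is_cycle_rotate: "is_cycle G (xs @ ys) \<longleftrightarrow> is_cycle G (ys @ xs)"
  using cycle_edges_rotate[of xs ys] by (auto simp: is_cycle_def)

lemma cycle_edge_rotate:
  assumes "e \<in> cycle_edges c"
  obtains xs ys where "c = xs @ ys" "e = {hd (ys @ xs), last (ys @ xs)}"
proof -
  obtain i where i: "i < length c" "e = {c ! i, c ! (Suc i mod length c)}"
    using assms by (auto simp: cycle_edges_def)
  \<comment> \<open>The cut is made after index \<open>i\<close>: in \<open>ys @ xs\<close>,
    \<open>c ! i\<close> is the last entry and its successor the first.\<close>
  define xs where "xs = take (Suc i) c"
  define ys where "ys = drop (Suc i) c"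
  have "last xs = c ! i" "xs \<noteq> []"
    using i(1) by (auto simp: xs_def take_Suc_conv_app_nth)
  moreover have "hd (ys @ xs) = c ! (Suc i mod length c)"
  proof (cases "Suc i < length c")
    case True
    then show ?thesis by (simp add: ys_def hd_drop_conv_nth hd_append)
  next
    case False
    then have "Suc i = length c" using i(1) by simp
    then show ?thesis using i(1) by (cases c) (simp_all add: ys_def xs_def)
  qed
  ultimately have "c = xs @ ys" "e = {hd (ys @ xs), last (ys @ xs)}"
    using i(2) by (auto simp: xs_def ys_def insert_commute)
  then show ?thesis by (rule that)
qed

text \<open>A rotation turns the given edge into the closing edge of the list; if its ends then come
  in the wrong order, the list is reversed.\<close>

lemma cycle_edge_split:
  assumes "is_cycle G c" "{a, b} \<in> cycle_edges c" "a \<noteq> b"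
  obtains r where "is_cycle G (a # r @ [b])" "set (a # r @ [b]) = set c"
    "cycle_edges (a # r @ [b]) = cycle_edges c"
proof -
  obtain xs ys where xy: "c = xs @ ys" "{a, b} = {hd (ys @ xs), last (ys @ xs)}"
    using cycle_edge_rotate[OF assms(2)] by blast
  define d where "d = ys @ xs"
  have d: "is_cycle G d" "set d = set c" "cycle_edges d = cycle_edges c"
    using assms(1) xy(1) is_cycle_rotate[of G xs ys] cycle_edges_rotate[of xs ys] by (auto simp: d_def)
  have len: "length d \<ge> 3" using d(1) by (simp add: is_cycle_def)
  then obtain u d' where d': "d = u # d'" by (cases d) auto
  then have "d' \<noteq> []" using len by auto
  then obtain r v where r: "d = u # r @ [v]" using d' by (metis append_butlast_last_id)
  have uv: "{a, b} = {u, v}" using xy(2) r by (simp add: d_def[symmetric])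
  have rv: "cycle_edges (v # rev r @ [u]) = cycle_edges d"
    using path_edges_rev[of "u # r @ [v] @ [u]"]
    by (simp add: r cycle_edges_Cons insert_commute path_edges_append[of "u # r" v "[u]", simplified]
        path_edges_append[of "v # rev r" u "[v]", simplified])
  consider "a = u" "b = v" | "a = v" "b = u" using uv assms(3) by (metis doubleton_eq_iff)
  then show ?thesis
  proof cases
    case 1
    then show ?thesis using that[of r] d r by simp
  next
    case 2
    then show ?thesis using that[of "rev r"] d rv r by (auto simp: is_cycle_def)
  qed
qed

text \<open>The cycle is opened at the edge and written from \<open>b\<close> to \<open>a\<close>.
  With \<open>S\<close> appended after \<open>a\<close>, the closing edge leads from the last vertex
  of \<open>S\<close> back to \<open>b\<close>.\<close>

lemma cycle_detour:
  assumes "is_cycle G H" "{a, b} \<in> cycle_edges H" "a \<noteq> b"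
    and "S \<noteq> []" "distinct S" "set S \<inter> set H = {}" "path_edges S \<subseteq> edges G"
    and "{a, hd S} \<in> edges G" "{last S, b} \<in> edges G"
  obtains H' where "is_cycle G H'" "set H' = set H \<union> set S"
    "cycle_edges H - {{a, b}} \<union> path_edges S \<subseteq> cycle_edges H'"
proof -
  obtain r where r: "is_cycle G (b # r @ [a])" "set (b # r @ [a]) = set H"
    "cycle_edges (b # r @ [a]) = cycle_edges H"
    by (rule cycle_edge_split[OF assms(1), of b a]) (use assms(2,3) in \<open>simp_all add: insert_commute\<close>)
  obtain s t where S: "S = s # t" using assms(4) by (cases S) auto
  have Sb: "S @ [b] = butlast S @ last S # [b]" using assms(4) by simp
  have "path_edges (S @ [b]) = path_edges S \<union> {{last S, b}}"
    using path_edges_append[of "butlast S" "last S" "[b]"] assms(4) by (subst Sb) simp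
  then have e: "cycle_edges (b # r @ a # S) = path_edges (b # r @ [a]) \<union> {{a, hd S}} \<union> path_edges S \<union> {{last S, b}}"
    unfolding cycle_edges_Cons_Cons by (simp add: S insert_commute Un_ac)
  have e0: "cycle_edges H = path_edges (b # r @ [a]) \<union> {{a, b}}"
    unfolding r(3)[symmetric] cycle_edges_Cons
    using path_edges_append[of "b # r" a "[b]"] by simp
  have "is_cycle G (b # r @ a # S)"
    unfolding is_cycle_def
  proof (intro conjI)
    have "cycle_edges H \<subseteq> edges G" using assms(1) by (simp add: is_cycle_def)
    then show "cycle_edges (b # r @ a # S) \<subseteq> edges G"
      using assms(7,8,9) unfolding e e0 by blast
    have "distinct (b # r @ [a])" using r(1) by (simp add: is_cycle_def)
    moreover have "set S \<inter> set (b # r @ [a]) = {}" unfolding r(2) by (rule assms(6))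
    ultimately show "distinct (b # r @ a # S)"
      using assms(5) by auto
    show "length (b # r @ a # S) \<ge> 3"
      using r(1) by (simp add: is_cycle_def)
  qed
  moreover have "set (b # r @ a # S) = set H \<union> set S" using r(2) by auto
  moreover have "cycle_edges H - {{a, b}} \<union> path_edges S \<subseteq> cycle_edges (b # r @ a # S)"
    unfolding e e0 by blast
  ultimately show ?thesis by (rule that)
qed


section \<open>Plane graphs\<close>

locale plane_graph =
  fixes G :: "'a graph" and p :: "'a \<Rightarrow> complex" and \<gamma> :: "'a set \<Rightarrow> real \<Rightarrow> complex"
  assumes embedding: "plane_embedding G p \<gamma>" and simple: "simple_graph G"
begin

lemma edge_subset: "e \<in> edges G \<Longrightarrow> e \<subseteq> verts G"
  and edge_card: "e \<in> edges G \<Longrightarrow> card e = 2"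
  using simple by (simp_all add: simple_graph_def)

lemma path_verts:
  assumes "path_edges vs \<subseteq> edges G" "length vs \<ge> 2"
  shows "set vs \<subseteq> verts G"
proof
  fix v assume "v \<in> set vs"
  then obtain e where "e \<in> path_edges vs" "v \<in> e"
    using Union_path_edges[OF assms(2)] by auto
  then show "v \<in> verts G" using assms(1) edge_subset[of e] by auto
qed

lemma edge_arc: "e \<in> edges G \<Longrightarrow> arc (\<gamma> e)"
  and edge_ends: "e \<in> edges G \<Longrightarrow> {pathstart (\<gamma> e), pathfinish (\<gamma> e)} = p ` e"
  and edge_vertices: "e \<in> edges G \<Longrightarrow> path_image (\<gamma> e) \<inter> p ` verts G = p ` e"
  and edge_Int: "e \<in> edges G \<Longrightarrow> f \<in> edges G \<Longrightarrow> e \<noteq> f \<Longrightarrow>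
        path_image (\<gamma> e) \<inter> path_image (\<gamma> f) = p ` (e \<inter> f)"
  and inj_p: "inj_on p (verts G)"
  using embedding by (simp_all add: plane_embedding_def)

lemma curve_Un: "curve \<gamma> (S \<union> T) = curve \<gamma> S \<union> curve \<gamma> T"
  by (auto simp: curve_def)

lemma curve_insert: "curve \<gamma> (insert e T) = path_image (\<gamma> e) \<union> curve \<gamma> T"
  by (auto simp: curve_def)

lemma curve_mono: "S \<subseteq> T \<Longrightarrow> curve \<gamma> S \<subseteq> curve \<gamma> T"
  by (auto simp: curve_def)

lemma curve_vertex_iff:
  assumes "S \<subseteq> edges G" "v \<in> verts G"
  shows "p v \<in> curve \<gamma> S \<longleftrightarrow> v \<in> \<Union> S"
proof
  assume "p v \<in> curve \<gamma> S"
  then obtain e where e: "e \<in> S" "p v \<in> path_image (\<gamma> e)" by (auto simp: curve_def)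
  then have "p v \<in> p ` e" using edge_vertices[of e] assms by auto
  then have "v \<in> e" using inj_p edge_subset[of e] e(1) assms by (auto dest: inj_onD)
  then show "v \<in> \<Union> S" using e by blast
next
  assume "v \<in> \<Union> S"
  then obtain e where e: "e \<in> S" "v \<in> e" by blast
  then have "p v \<in> path_image (\<gamma> e)" using edge_vertices[of e] assms by blast
  then show "p v \<in> curve \<gamma> S" using e by (auto simp: curve_def)
qed

lemma curve_Int:
  assumes "S \<subseteq> edges G" "T \<subseteq> edges G" "S \<inter> T = {}"
  shows "curve \<gamma> S \<inter> curve \<gamma> T = p ` (\<Union> S \<inter> \<Union> T)"
proof
  show "curve \<gamma> S \<inter> curve \<gamma> T \<subseteq> p ` (\<Union> S \<inter> \<Union> T)"
  proof
    fix z assume "z \<in> curve \<gamma> S \<inter> curve \<gamma> T"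
    then obtain e f where ef: "e \<in> S" "f \<in> T" "z \<in> path_image (\<gamma> e)" "z \<in> path_image (\<gamma> f)"
      by (auto simp: curve_def)
    then have "z \<in> p ` (e \<inter> f)" using edge_Int[of e f] assms by blast
    then show "z \<in> p ` (\<Union> S \<inter> \<Union> T)" using ef by blast
  qed
  show "p ` (\<Union> S \<inter> \<Union> T) \<subseteq> curve \<gamma> S \<inter> curve \<gamma> T"
  proof
    fix z assume "z \<in> p ` (\<Union> S \<inter> \<Union> T)"
    then obtain v where v: "z = p v" "v \<in> \<Union> S" "v \<in> \<Union> T" by blast
    have "v \<in> verts G" using v(2) assms(1) edge_subset by blast
    then show "z \<in> curve \<gamma> S \<inter> curve \<gamma> T" using v curve_vertex_iff assms by blast
  qed
qed

lemma compact_curve: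
  assumes "finite S" "S \<subseteq> edges G"
  shows "compact (curve \<gamma> S)"
  unfolding curve_def
  using assms by (intro compact_UN) (auto intro!: compact_arc_image edge_arc)

lemma edge_path:
  assumes "{u, v} \<in> edges G"
  obtains g where "arc g" "pathstart g = p u" "pathfinish g = p v" "path_image g = path_image (\<gamma> {u, v})"
proof -
  have "{pathstart (\<gamma> {u, v}), pathfinish (\<gamma> {u, v})} = {p u, p v}"
    using edge_ends[OF assms] by simp
  then consider "pathstart (\<gamma> {u, v}) = p u" "pathfinish (\<gamma> {u, v}) = p v"
    | "pathstart (\<gamma> {u, v}) = p v" "pathfinish (\<gamma> {u, v}) = p u"
    by (auto simp: doubleton_eq_iff)
  then show ?thesis
  proof cases
    case 1
    then show ?thesis using that edge_arc[OF assms] by blast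
  next
    case 2
    then show ?thesis
      using that[of "reversepath (\<gamma> {u, v})"] edge_arc[OF assms] by (simp add: arc_reversepath)
  qed
qed

lemma path_arc:
  assumes "distinct vs" "length vs \<ge> 2" "path_edges vs \<subseteq> edges G"
  shows "\<exists>g. arc g \<and> pathstart g = p (hd vs) \<and> pathfinish g = p (last vs) \<and>
             path_image g = curve \<gamma> (path_edges vs)"
  using assms
proof (induction vs rule: induct_list012)
  case (3 u v r)
  have uv: "{u, v} \<in> edges G" using "3.prems" by auto
  obtain g where g: "arc g" "pathstart g = p u" "pathfinish g = p v" "path_image g = path_image (\<gamma> {u, v})"
    using edge_path[OF uv] by blast
  show ?case
  proof (cases r)
    case Nil
    then show ?thesis using g by (auto simp: curve_def)
  next
    case (Cons w r')
    have sub: "path_edges (v # r) \<subseteq> edges G" using "3.prems" by auto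
    have "\<exists>g. arc g \<and> pathstart g = p (hd (v # r)) \<and> pathfinish g = p (last (v # r)) \<and>
             path_image g = curve \<gamma> (path_edges (v # r))"
      by (rule "3.IH"(2)) (use "3.prems" Cons sub in auto)
    then obtain h where h: "arc h" "pathstart h = p v" "pathfinish h = p (last (v # r))"
             "path_image h = curve \<gamma> (path_edges (v # r))" by auto
    have "{u, v} \<notin> path_edges (v # r)" using path_edges_subset[of "{u, v}" "v # r"] "3.prems"(1) by auto
    then have "curve \<gamma> {{u, v}} \<inter> curve \<gamma> (path_edges (v # r)) = p ` ({u, v} \<inter> \<Union> (path_edges (v # r)))"
      using curve_Int[of "{{u, v}}" "path_edges (v # r)"] uv sub by auto
    also have "\<dots> \<subseteq> {p v}" using path_edges_subset[of _ "v # r"] "3.prems"(1) by auto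
    finally have "path_image g \<inter> path_image h \<subseteq> {pathstart h}"
      using g h by (auto simp: curve_def)
    then have "arc (g +++ h)" using g h by (intro arc_join) auto
    moreover have "path_image (g +++ h) = curve \<gamma> (path_edges (u # v # r))"
      using g h by (simp add: path_image_join curve_insert)
    ultimately show ?thesis
      using g h by (intro exI[of _ "g +++ h"]) auto
  qed
qed auto

abbreviation path_curve :: "'a list \<Rightarrow> complex set" where
  "path_curve vs \<equiv> curve \<gamma> (path_edges vs)"

abbreviation region :: "'a list \<Rightarrow> 'a list \<Rightarrow> complex set" where
  "region X Y \<equiv> inside (path_curve X \<union> path_curve Y)"

lemma path_curve_connected:
  assumes "distinct (u # x @ [v])" "path_edges (u # x @ [v]) \<subseteq> edges G"
  shows "connected (path_curve (u # x @ [v]) - {p u, p v})" "path_curve (u # x @ [v]) - {p u, p v} \<noteq> {}"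
    "p u \<in> path_curve (u # x @ [v])" "p v \<in> path_curve (u # x @ [v])"
proof -
  obtain g where g: "arc g" "pathstart g = p u" "pathfinish g = p v" "path_image g = path_curve (u # x @ [v])"
    using path_arc[of "u # x @ [v]"] assms by auto
  then show "connected (path_curve (u # x @ [v]) - {p u, p v})" "path_curve (u # x @ [v]) - {p u, p v} \<noteq> {}"
    using connected_simple_path_endless[of g] nonempty_simple_path_endless[of g] arc_imp_simple_path[of g]
    by auto
  show "p u \<in> path_curve (u # x @ [v])" "p v \<in> path_curve (u # x @ [v])"
    using pathstart_in_path_image[of g] pathfinish_in_path_image[of g] g by auto
qed

text \<open>Since the interiors are disjoint, a common edge could only be \<open>{u, v}\<close>. A
  path with an interior vertex does not contain that edge, and one of the two paths has such a
  vertex.\<close>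

lemma path_edges_disjoint:
  assumes "distinct (u # v # x @ y)" "x \<noteq> [] \<or> y \<noteq> []"
    and "path_edges (u # x @ [v]) \<subseteq> edges G" "path_edges (u # y @ [v]) \<subseteq> edges G"
  shows "path_edges (u # x @ [v]) \<inter> path_edges (u # y @ [v]) = {}"
proof (rule ccontr)
  assume "\<not> ?thesis"
  then obtain e where e: "e \<in> path_edges (u # x @ [v])" "e \<in> path_edges (u # y @ [v])" by blast
  then have "e \<subseteq> {u, v}"
    using path_edges_subset[OF e(1)] path_edges_subset[OF e(2)] assms(1) by auto
  moreover have "card e = 2" using e assms edge_card by blast
  ultimately have euv: "e = {u, v}"
    by (metis card_2_iff card_subset_eq finite.emptyI finite.insertI assms(1) distinct.simps(2) list.set_intros(1))
  have no: False if zz: "z \<noteq> []" "e \<in> path_edges (u # z @ [v])" "distinct (u # v # z)" for z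
  proof -
    obtain c z' where z: "z = c # z'" using zz(1) by (cases z) auto
    then have "{u, v} \<noteq> {u, c}" using zz(3) by (auto simp: doubleton_eq_iff)
    then have "{u, v} \<in> path_edges (c # z' @ [v])" using zz(2) euv z by simp
    then show False using path_edges_subset[of "{u, v}" "c # z' @ [v]"] zz z by auto
  qed
  show False using assms no[of x] no[of y] e by auto
qed

lemma path_curves_Int:
  assumes "distinct (u # v # x @ y)" "x \<noteq> [] \<or> y \<noteq> []"
    and "path_edges (u # x @ [v]) \<subseteq> edges G" "path_edges (u # y @ [v]) \<subseteq> edges G"
  shows "path_curve (u # x @ [v]) \<inter> path_curve (u # y @ [v]) = {p u, p v}"
  using curve_Int[OF assms(3,4) path_edges_disjoint[OF assms]] assms(1)
    Union_path_edges[of "u # x @ [v]"] Union_path_edges[of "u # y @ [v]"] by auto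

lemma path_curve_Jordan:
  assumes "distinct (u # v # x @ y)" "x \<noteq> [] \<or> y \<noteq> []"
    and "path_edges (u # x @ [v]) \<subseteq> edges G" "path_edges (u # y @ [v]) \<subseteq> edges G"
  obtains c where "simple_path c" "pathfinish c = pathstart c"
    "path_image c = path_curve (u # x @ [v]) \<union> path_curve (u # y @ [v])"
proof -
  obtain g where g: "arc g" "pathstart g = p u" "pathfinish g = p v" "path_image g = path_curve (u # x @ [v])"
    using path_arc[of "u # x @ [v]"] assms by auto
  obtain h where h: "arc h" "pathstart h = p u" "pathfinish h = p v" "path_image h = path_curve (u # y @ [v])"
    using path_arc[of "u # y @ [v]"] assms by auto
  have "simple_path (g +++ reversepath h)"
    using g h path_curves_Int[OF assms] by (intro simple_path_join_loop) (auto simp: arc_reversepath)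
  then show ?thesis
    using that[of "g +++ reversepath h"] g h by (auto simp: path_image_join)
qed

lemma region_Jordan:
  assumes "distinct (u # v # x @ y)" "x \<noteq> [] \<or> y \<noteq> []"
    and "path_edges (u # x @ [v]) \<subseteq> edges G" "path_edges (u # y @ [v]) \<subseteq> edges G"
  shows "region (u # x @ [v]) (u # y @ [v]) \<noteq> {}" "open (region (u # x @ [v]) (u # y @ [v]))"
    "connected (region (u # x @ [v]) (u # y @ [v]))"
    "frontier (region (u # x @ [v]) (u # y @ [v])) = path_curve (u # x @ [v]) \<union> path_curve (u # y @ [v])"
proof -
  obtain c where "simple_path c" "pathfinish c = pathstart c"
    "path_image c = path_curve (u # x @ [v]) \<union> path_curve (u # y @ [v])"
    using path_curve_Jordan[OF assms] by blast
  then show "region (u # x @ [v]) (u # y @ [v]) \<noteq> {}" "open (region (u # x @ [v]) (u # y @ [v]))"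
    "connected (region (u # x @ [v]) (u # y @ [v]))"
    "frontier (region (u # x @ [v]) (u # y @ [v])) = path_curve (u # x @ [v]) \<union> path_curve (u # y @ [v])"
    using Jordan_inside_outside[of c] by auto
qed

text \<open>The graph form of \<open>split_inside_simple_closed_curve\<close>: three internally
  disjoint paths from \<open>u\<close> to \<open>v\<close>, the third of which enters the inside of
  the cycle formed by the others. At most one of the paths may be a single edge, since otherwise two
  of the curves would coincide.\<close>

lemma region_theta:
  assumes "distinct (u # v # x @ y @ z)" "x \<noteq> [] \<or> y \<noteq> []" "x \<noteq> [] \<or> z \<noteq> []" "y \<noteq> [] \<or> z \<noteq> []"
    and "path_edges (u # x @ [v]) \<subseteq> edges G" "path_edges (u # y @ [v]) \<subseteq> edges G"
      "path_edges (u # z @ [v]) \<subseteq> edges G"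
    and "path_curve (u # z @ [v]) \<inter> region (u # x @ [v]) (u # y @ [v]) \<noteq> {}"
  shows "region (u # x @ [v]) (u # z @ [v]) \<inter> region (u # y @ [v]) (u # z @ [v]) = {}"
    "region (u # x @ [v]) (u # z @ [v]) \<union> region (u # y @ [v]) (u # z @ [v]) \<union>
       (path_curve (u # z @ [v]) - {p u, p v}) = region (u # x @ [v]) (u # y @ [v])"
proof -
  have "set (u # x @ [v]) \<subseteq> verts G"
    by (rule path_verts) (use assms(5) in simp_all)
  then have puv: "p u \<noteq> p v" using inj_onD[OF inj_p, of u v] assms(1) by auto
  obtain f where f: "arc f" "pathstart f = p u" "pathfinish f = p v" "path_image f = path_curve (u # x @ [v])"
    using path_arc[of "u # x @ [v]"] assms by auto
  obtain g where g: "arc g" "pathstart g = p u" "pathfinish g = p v" "path_image g = path_curve (u # y @ [v])"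
    using path_arc[of "u # y @ [v]"] assms by auto
  obtain h where h: "arc h" "pathstart h = p u" "pathfinish h = p v" "path_image h = path_curve (u # z @ [v])"
    using path_arc[of "u # z @ [v]"] assms by auto
  have I1: "path_image f \<inter> path_image g = {p u, p v}"
    unfolding f(4) g(4) by (rule path_curves_Int) (use assms(1,2,5,6) in auto)
  have I2: "path_image f \<inter> path_image h = {p u, p v}"
    unfolding f(4) h(4) by (rule path_curves_Int) (use assms(1,3,5,7) in auto)
  have I3: "path_image g \<inter> path_image h = {p u, p v}"
    unfolding g(4) h(4) by (rule path_curves_Int) (use assms(1,4,6,7) in auto)
  have "path_image h \<inter> inside (path_image f \<union> path_image g) \<noteq> {}"
    using assms(8) f g h by simp
  then have "inside (path_image f \<union> path_image h) \<inter> inside (path_image g \<union> path_image h) = {} \<and>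
    inside (path_image f \<union> path_image h) \<union> inside (path_image g \<union> path_image h) \<union>
      (path_image h - {p u, p v}) = inside (path_image f \<union> path_image g)"
    by (rule split_inside_simple_closed_curve[OF arc_imp_simple_path[OF f(1)] f(2,3)
        arc_imp_simple_path[OF g(1)] g(2,3) arc_imp_simple_path[OF h(1)] h(2,3) puv I1 I2 I3]) blast+
  then show "region (u # x @ [v]) (u # z @ [v]) \<inter> region (u # y @ [v]) (u # z @ [v]) = {}"
    "region (u # x @ [v]) (u # z @ [v]) \<union> region (u # y @ [v]) (u # z @ [v]) \<union>
       (path_curve (u # z @ [v]) - {p u, p v}) = region (u # x @ [v]) (u # y @ [v])"
    using f g h by simp_all
qed

end


section \<open>Cutting an annulus along two spokes\<close>

text \<open>A connected set properly containing \<open>R\<close> would meet the frontier of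
  \<open>R\<close>, hence \<open>K\<close>.\<close>

lemma component_if_frontier:
  fixes R :: "complex set"
  assumes "connected R" "R \<noteq> {}" "R \<inter> K = {}" "frontier R \<subseteq> K"
  shows "R \<in> components (- K)"
  unfolding in_components_maximal
proof (intro conjI allI impI)
  show "R \<noteq> {}" "R \<subseteq> - K" "connected R" using assms by blast+
  fix D assume D: "D \<noteq> {} \<and> R \<subseteq> D \<and> D \<subseteq> - K \<and> connected D"
  show "D = R"
  proof (rule ccontr)
    assume "D \<noteq> R"
    then have "D - R \<noteq> {}" using D by blast
    moreover have "D \<inter> R \<noteq> {}" using D assms(2) by blast
    ultimately have "D \<inter> frontier R \<noteq> {}" using D connected_Int_frontier by blast
    then show False using D assms(4) by blast
  qed
qed

text \<open>A point \<open>z\<close> of \<open>inside K\<close> that is not inside the curve would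
  lie in the closed exterior of the curve. That set is connected and avoids \<open>K\<close>, so it
  would be part of the component of \<open>- K\<close> at \<open>z\<close>, which is bounded, while
  the exterior is not.\<close>

lemma inside_mono_Jordan:
  fixes K :: "complex set"
  assumes "simple_path c" "pathfinish c = pathstart c" "K \<subseteq> inside (path_image c)"
  shows "inside K \<subseteq> inside (path_image c)"
proof
  fix z assume z: "z \<in> inside K"
  show "z \<in> inside (path_image c)"
  proof (rule ccontr)
    assume n: "z \<notin> inside (path_image c)"
    note J = Jordan_inside_outside[OF assms(1,2)]
    define T where "T = closure (outside (path_image c))"
    have T: "T = outside (path_image c) \<union> path_image c"
      using J unfolding T_def closure_Un_frontier by simp
    have "z \<in> T" using n J unfolding T by blast
    moreover have "connected T" unfolding T_def using J by (intro connected_imp_connected_closure) simp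
    moreover have "T \<subseteq> - K"
    proof -
      have "path_image c \<inter> inside (path_image c) = {}" using inside_no_overlap[of "path_image c"] by blast
      moreover have "inside (path_image c) \<inter> outside (path_image c) = {}" using J by simp
      ultimately show ?thesis using assms(3) unfolding T by blast
    qed
    ultimately have "T \<subseteq> connected_component_set (- K) z" by (intro connected_component_maximal)
    moreover have "bounded (connected_component_set (- K) z)" using z by (simp add: inside_def)
    ultimately have "bounded T" using bounded_subset by blast
    then have "bounded (outside (path_image c))" unfolding T by simp
    then show False using J by simp
  qed
qed

context plane_graph
begin

lemma cycle_Jordan:
  assumes "is_cycle G d"
  obtains c where "simple_path c" "pathfinish c = pathstart c" "path_image c = curve \<gamma> (cycle_edges d)"
proof -
  have d: "distinct d" "length d \<ge> 3" "cycle_edges d \<subseteq> edges G"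
    using assms by (simp_all add: is_cycle_def)
  then obtain u d' where d': "d = u # d'" by (cases d) auto
  then obtain v ys where v: "d = u # v # ys" using d(2) by (cases d') auto
  then have ys: "ys \<noteq> []" using d(2) by auto
  \<comment> \<open>The cycle is seen as two paths from \<open>u\<close> to \<open>v\<close>: its
    first edge, and the rest read backwards.\<close>
  have e: "cycle_edges d = path_edges (u # [] @ [v]) \<union> path_edges (u # rev ys @ [v])"
    using cycle_edges_Cons_Cons[of u "[]" v ys] path_edges_rev[of "v # ys @ [u]"] v by simp
  show ?thesis
  proof (rule path_curve_Jordan[of u v "[]" "rev ys"])
    show "distinct (u # v # [] @ rev ys)" using d v by simp
    show "[] \<noteq> [] \<or> rev ys \<noteq> []" using ys by simp
    show "path_edges (u # [] @ [v]) \<subseteq> edges G" "path_edges (u # rev ys @ [v]) \<subseteq> edges G"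
      using d(3) e by blast+
    fix c assume "simple_path c" "pathfinish c = pathstart c"
      "path_image c = path_curve (u # [] @ [v]) \<union> path_curve (u # rev ys @ [v])"
    then show thesis using that e curve_Un by metis
  qed
qed

text \<open>Connectedness arguments are applied to the arc without its ends; the closure claim
  transfers their outcome to the ends as limit points.\<close>

lemma edge_interior:
  assumes "e \<in> edges G"
  shows "connected (path_image (\<gamma> e) - p ` e)" "path_image (\<gamma> e) - p ` e \<noteq> {}"
    "path_image (\<gamma> e) \<subseteq> closure (path_image (\<gamma> e) - p ` e)" "p ` e \<subseteq> path_image (\<gamma> e)"
proof -
  have s: "simple_path (\<gamma> e)" using edge_arc[OF assms] by (rule arc_imp_simple_path)
  have eq: "path_image (\<gamma> e) - p ` e = path_image (\<gamma> e) - {pathstart (\<gamma> e), pathfinish (\<gamma> e)}"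
    using edge_ends[OF assms] by simp
  show "connected (path_image (\<gamma> e) - p ` e)" "path_image (\<gamma> e) - p ` e \<noteq> {}"
    unfolding eq using s by (rule connected_simple_path_endless nonempty_simple_path_endless)+
  have "path_image (\<gamma> e) - p ` e = \<gamma> e ` {0<..<1}"
    unfolding eq using s by (rule simple_path_endless)
  moreover have "\<gamma> e ` closure {0<..<1} \<subseteq> closure (\<gamma> e ` {0<..<1})"
    using simple_path_imp_path[OF s] unfolding path_def
    by (intro image_closure_subset closure_subset closed_closure) simp
  ultimately show "path_image (\<gamma> e) \<subseteq> closure (path_image (\<gamma> e) - p ` e)"
    by (simp add: path_image_def)
  show "p ` e \<subseteq> path_image (\<gamma> e)" using edge_vertices[OF assms] by blast
qed

text \<open>The outer cycle is cut at \<open>w\<close> and \<open>w'\<close>, the inner one at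
  \<open>v\<close> and \<open>v'\<close>, and two spokes join these points. Both paths of a cycle
  run from the unprimed to the primed vertex, so one of them is read against the cyclic order; this
  is the form in which \<open>region_theta\<close> applies.\<close>

definition ring_paths :: "'a \<Rightarrow> 'a list \<Rightarrow> 'a \<Rightarrow> 'a list \<Rightarrow> 'a \<Rightarrow> 'a list \<Rightarrow> 'a \<Rightarrow> 'a list \<Rightarrow> bool" where
  "ring_paths w a w' a' v b v' b' \<longleftrightarrow>
     distinct (w # w' # a @ a' @ v # v' # b @ b') \<and> (a \<noteq> [] \<or> a' \<noteq> []) \<and> (b \<noteq> [] \<or> b' \<noteq> []) \<and>
     path_edges (w # a @ [w']) \<subseteq> edges G \<and> path_edges (w # a' @ [w']) \<subseteq> edges G \<and>
     path_edges (v # b @ [v']) \<subseteq> edges G \<and> path_edges (v # b' @ [v']) \<subseteq> edges G \<and>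
     {w, v} \<in> edges G \<and> {w', v'} \<in> edges G \<and>
     path_curve (v # b @ [v']) \<union> path_curve (v # b' @ [v'])
       \<subseteq> region (w # a @ [w']) (w # a' @ [w'])"

text \<open>Expresses that \<open>b\<close> is the inner path facing \<open>a\<close>, and
  \<open>b'\<close> the one facing \<open>a'\<close>. The outer disc is exhausted by the two
  regions, the inner disc and the curves between them. The points \<open>p w\<close> and
  \<open>p w'\<close> are taken out of the spokes because they lie on the outer curve; the inner
  ends are covered by \<open>D\<close> anyway.\<close>

definition ring_split :: "'a \<Rightarrow> 'a list \<Rightarrow> 'a \<Rightarrow> 'a list \<Rightarrow> 'a \<Rightarrow> 'a list \<Rightarrow> 'a \<Rightarrow> 'a list \<Rightarrow> bool" where
  "ring_split w a w' a' v b v' b' \<longleftrightarrow>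
     (let A = w # a @ [w']; A' = w # a' @ [w']; B = v # b @ [v']; B' = v # b' @ [v'];
          R = region A (w # B @ [w']); R' = region A' (w # B' @ [w']); D = path_curve B \<union> path_curve B'
      in R \<inter> R' = {} \<and> R \<inter> inside D = {} \<and> R' \<inter> inside D = {} \<and> R \<inter> D = {} \<and> R' \<inter> D = {} \<and>
         region A A' = R \<union> R' \<union> inside D \<union> D \<union>
           (path_image (\<gamma> {w, v}) - {p w}) \<union> (path_image (\<gamma> {w', v'}) - {p w'}))"

lemma ring_paths_swap_outer: "ring_paths w a w' a' v b v' b' \<Longrightarrow> ring_paths w a' w' a v b v' b'"
  by (auto simp: ring_paths_def Un_commute)

lemma ring_paths_swap_inner: "ring_paths w a w' a' v b v' b' \<Longrightarrow> ring_paths w a w' a' v b' v' b"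
  by (auto simp: ring_paths_def Un_commute)

lemma ring_split_swap: "ring_split w a w' a' v b v' b' \<Longrightarrow> ring_split w a' w' a v b' v' b"
  unfolding ring_split_def Let_def by (simp add: Un_ac Int_commute)

lemma ring_path_edges:
  "path_edges (w # (v # b @ [v']) @ [w']) = insert {w, v} (insert {w', v'} (path_edges (v # b @ [v'])))"
  using path_edges_append[of "w # v # b" v' "[w']"] by (auto simp: insert_commute)

lemma path_curve_chord:
  "path_curve (w # (v # b @ [v']) @ [w'])
     = path_image (\<gamma> {w, v}) \<union> path_curve (v # b @ [v']) \<union> path_image (\<gamma> {w', v'})"
  unfolding ring_path_edges by (auto simp: curve_insert)

text \<open>Two cuts by \<open>region_theta\<close>: the chord from \<open>w\<close> through
  \<open>b\<close> to \<open>w'\<close> halves the outer disc, then the path through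
  \<open>b'\<close> separates the half at \<open>a'\<close> into \<open>R'\<close> and the inner
  disc. For the second cut the branch vertices are \<open>v\<close> and \<open>v'\<close>, and the
  arc through \<open>a'\<close> is extended by the two spokes.\<close>

lemma ring_split_core:
  assumes ring: "ring_paths w a w' a' v b v' b'"
    and sub: "path_curve (v # b' @ [v']) - {p v, p v'} \<subseteq> region (w # a' @ [w']) (w # (v # b @ [v']) @ [w'])"
  shows "ring_split w a w' a' v b v' b'"
proof -
  define A A' B B' where "A = path_curve (w # a @ [w'])" and "A' = path_curve (w # a' @ [w'])"
    and "B = path_curve (v # b @ [v'])" and "B' = path_curve (v # b' @ [v'])"
  define S S' where "S = path_image (\<gamma> {w, v})" and "S' = path_image (\<gamma> {w', v'})"
  note defs = A_def[symmetric] A'_def[symmetric] B_def[symmetric] B'_def[symmetric]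
    S_def[symmetric] S'_def[symmetric]
  have dist: "distinct (w # w' # a @ a' @ v # v' # b @ b')" and ne: "a \<noteq> [] \<or> a' \<noteq> []" "b \<noteq> [] \<or> b' \<noteq> []"
    and ed: "path_edges (w # a @ [w']) \<subseteq> edges G" "path_edges (w # a' @ [w']) \<subseteq> edges G"
     "path_edges (v # b @ [v']) \<subseteq> edges G" "path_edges (v # b' @ [v']) \<subseteq> edges G"
     "{w, v} \<in> edges G" "{w', v'} \<in> edges G"
    and BB: "B \<union> B' \<subseteq> inside (A \<union> A')"
    using ring unfolding ring_paths_def defs by blast+
  have P: "path_curve (w # (v # b @ [v']) @ [w']) = S \<union> B \<union> S'"
    unfolding path_curve_chord defs by (rule refl)
  have Q: "path_curve (v # (w # a' @ [w']) @ [v']) = S \<union> A' \<union> S'"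
    unfolding path_curve_chord insert_commute[of v w "{}"] insert_commute[of v' w' "{}"] defs by (rule refl)
  have Pe: "path_edges (w # (v # b @ [v']) @ [w']) \<subseteq> edges G"
    unfolding ring_path_edges using ed by blast
  have Qe: "path_edges (v # (w # a' @ [w']) @ [v']) \<subseteq> edges G"
    unfolding ring_path_edges insert_commute[of v w "{}"] insert_commute[of v' w' "{}"] using ed by blast
  have ends: "p v \<in> B" "p v' \<in> B" "p v \<in> B'" "p v' \<in> B'"
    using path_curve_connected(3,4)[of v b v'] path_curve_connected(3,4)[of v b' v'] dist ed
    unfolding defs by auto
  have d1: "distinct (w # w' # a @ a' @ v # b @ [v'])"
    using dist by auto
  have d2: "distinct (v # v' # b @ (w # a' @ [w']) @ b')"
    using dist by auto
  have meet: "(S \<union> B \<union> S') \<inter> inside (A \<union> A') \<noteq> {}" using ends BB by blast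
  have 1: "inside (A \<union> (S \<union> B \<union> S')) \<inter> inside (A' \<union> (S \<union> B \<union> S')) = {}"
    "inside (A \<union> (S \<union> B \<union> S')) \<union> inside (A' \<union> (S \<union> B \<union> S')) \<union> (S \<union> B \<union> S' - {p w, p w'}) = inside (A \<union> A')"
    using region_theta[of w w' a a' "v # b @ [v']", unfolded P defs, OF d1 ne(1) _ _ ed(1,2) Pe meet]
    by simp_all
  have "B' - {p v, p v'} \<noteq> {}"
    using path_curve_connected(2)[of v b' v'] dist ed unfolding defs by auto
  then have meet2: "B' \<inter> inside (B \<union> (S \<union> A' \<union> S')) \<noteq> {}"
    using sub unfolding P defs by (auto simp: Un_ac)
  have eqs: "B \<union> (S \<union> A' \<union> S') = A' \<union> (S \<union> B \<union> S')" "(S \<union> A' \<union> S') \<union> B' = A' \<union> (S \<union> B' \<union> S')"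
    by blast+
  have 2: "inside (B \<union> B') \<inter> inside (A' \<union> (S \<union> B' \<union> S')) = {}"
    "inside (B \<union> B') \<union> inside (A' \<union> (S \<union> B' \<union> S')) \<union> (B' - {p v, p v'}) = inside (A' \<union> (S \<union> B \<union> S'))"
    using region_theta[of v v' b "w # a' @ [w']" b', unfolded Q defs, OF d2 _ ne(2) _ ed(3) Qe ed(4) meet2]
    unfolding eqs by simp_all
  have nov: "inside (A \<union> (S \<union> B \<union> S')) \<inter> B = {}" "inside (A' \<union> (S \<union> B \<union> S')) \<inter> B = {}"
    "inside (A' \<union> (S \<union> B' \<union> S')) \<inter> B' = {}"
    using inside_no_overlap[of "A \<union> (S \<union> B \<union> S')"] inside_no_overlap[of "A' \<union> (S \<union> B \<union> S')"]
      inside_no_overlap[of "A' \<union> (S \<union> B' \<union> S')"] by blast+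
  have vv: "w \<in> verts G" "w' \<in> verts G" using ed(5,6) edge_subset by blast+
  have Ub: "\<Union> (path_edges (v # b @ [v'])) = set (v # b @ [v'])"
    by (rule Union_path_edges) simp
  have "p w \<notin> B" "p w' \<notin> B"
    unfolding B_def curve_vertex_iff[OF ed(3) vv(1)] curve_vertex_iff[OF ed(3) vv(2)] Ub
    using dist by auto
  moreover have "p w \<notin> S'" "p w' \<notin> S"
    using curve_vertex_iff[of "{{w', v'}}", OF _ vv(1)] curve_vertex_iff[of "{{w, v}}", OF _ vv(2)] ed dist
    unfolding S_def S'_def by (auto simp: curve_def)
  ultimately have Peq: "S \<union> B \<union> S' - {p w, p w'} = B \<union> (S - {p w}) \<union> (S' - {p w'})"
    by blast
  have dis: "inside (A \<union> (S \<union> B \<union> S')) \<inter> inside (A' \<union> (S \<union> B' \<union> S')) = {}"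
    "inside (A \<union> (S \<union> B \<union> S')) \<inter> inside (B \<union> B') = {}"
    "inside (A' \<union> (S \<union> B' \<union> S')) \<inter> inside (B \<union> B') = {}"
    using 1(1) 2 by blast+
  have dis2: "inside (A \<union> (S \<union> B \<union> S')) \<inter> (B \<union> B') = {}"
    using 1(1) 2(2) nov ends by blast
  have dis3: "inside (A' \<union> (S \<union> B' \<union> S')) \<inter> (B \<union> B') = {}"
    using 2(2) nov by blast
  have un: "inside (A \<union> A') = inside (A \<union> (S \<union> B \<union> S')) \<union> inside (A' \<union> (S \<union> B' \<union> S')) \<union> inside (B \<union> B')
      \<union> (B \<union> B') \<union> (S - {p w}) \<union> (S' - {p w'})"
    unfolding 1(2)[symmetric] 2(2)[symmetric] Peq using ends by blast
  have P': "path_curve (w # (v # b' @ [v']) @ [w']) = S \<union> B' \<union> S'"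
    unfolding path_curve_chord defs by (rule refl)
  show ?thesis
    unfolding ring_split_def Let_def P P' defs
    using dis dis2 dis3 un by (intro conjI)
qed

text \<open>Which of the two inner paths faces \<open>a\<close> depends on the side of the chord through \<open>b\<close> on which
  the path through \<open>b'\<close> lies.\<close>

lemma ring_split:
  assumes ring: "ring_paths w a w' a' v b v' b'"
  shows "ring_split w a w' a' v b v' b' \<or> ring_split w a w' a' v b' v' b"
proof -
  define A A' B B' where "A = path_curve (w # a @ [w'])" and "A' = path_curve (w # a' @ [w'])"
    and "B = path_curve (v # b @ [v'])" and "B' = path_curve (v # b' @ [v'])"
  define S S' where "S = path_image (\<gamma> {w, v})" and "S' = path_image (\<gamma> {w', v'})"
  note defs = A_def[symmetric] A'_def[symmetric] B_def[symmetric] B'_def[symmetric]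
    S_def[symmetric] S'_def[symmetric]
  have dist: "distinct (w # w' # a @ a' @ v # v' # b @ b')" and ne: "a \<noteq> [] \<or> a' \<noteq> []" "b \<noteq> [] \<or> b' \<noteq> []"
    and ed: "path_edges (w # a @ [w']) \<subseteq> edges G" "path_edges (w # a' @ [w']) \<subseteq> edges G"
     "path_edges (v # b @ [v']) \<subseteq> edges G" "path_edges (v # b' @ [v']) \<subseteq> edges G"
     "{w, v} \<in> edges G" "{w', v'} \<in> edges G"
    and BB: "B \<union> B' \<subseteq> inside (A \<union> A')"
    using ring unfolding ring_paths_def defs by blast+
  have P: "path_curve (w # (v # b @ [v']) @ [w']) = S \<union> B \<union> S'"
    unfolding path_curve_chord defs by (rule refl)
  have Pe: "path_edges (w # (v # b @ [v']) @ [w']) \<subseteq> edges G"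
    unfolding ring_path_edges using ed by blast
  have ends: "p v \<in> B" "p v' \<in> B" "p v \<in> B'" "p v' \<in> B'"
    using path_curve_connected(3,4)[of v b v'] path_curve_connected(3,4)[of v b' v'] dist ed
    unfolding defs by auto
  have d1: "distinct (w # w' # a @ a' @ v # b @ [v'])"
    using dist by auto
  have meet: "(S \<union> B \<union> S') \<inter> inside (A \<union> A') \<noteq> {}" using ends BB by blast
  have 1: "inside (A \<union> (S \<union> B \<union> S')) \<inter> inside (A' \<union> (S \<union> B \<union> S')) = {}"
    "inside (A \<union> (S \<union> B \<union> S')) \<union> inside (A' \<union> (S \<union> B \<union> S')) \<union> (S \<union> B \<union> S' - {p w, p w'}) = inside (A \<union> A')"
    using region_theta[of w w' a a' "v # b @ [v']", unfolded P defs, OF d1 ne(1) _ _ ed(1,2) Pe meet]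
    by simp_all
  have da: "distinct (w # w' # a @ v # b @ [v'])" and da': "distinct (w # w' # a' @ v # b @ [v'])"
    using d1 by auto
  have op: "open (inside (A \<union> (S \<union> B \<union> S')))" "open (inside (A' \<union> (S \<union> B \<union> S')))"
    using region_Jordan(2)[of w w' a "v # b @ [v']", unfolded P defs, OF da _ ed(1) Pe]
      region_Jordan(2)[of w w' a' "v # b @ [v']", unfolded P defs, OF da' _ ed(2) Pe] by simp_all
  have con: "connected (B' - {p v, p v'})"
    using path_curve_connected(1)[of v b' v'] dist ed unfolding defs by auto
  have "B \<inter> B' = {p v, p v'}"
    using path_curves_Int[of v v' b b'] dist ne ed unfolding defs by auto
  moreover have "S \<inter> B' \<subseteq> {p v}" "S' \<inter> B' \<subseteq> {p v'}"
  proof -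
    have "{w, v} \<notin> path_edges (v # b' @ [v'])" "{w', v'} \<notin> path_edges (v # b' @ [v'])"
      using path_edges_subset[of "{w, v}" "v # b' @ [v']"] path_edges_subset[of "{w', v'}" "v # b' @ [v']"] dist
      by auto
    then have "S \<inter> B' = p ` ({w, v} \<inter> set (v # b' @ [v']))" "S' \<inter> B' = p ` ({w', v'} \<inter> set (v # b' @ [v']))"
      using curve_Int[of "{{w, v}}" "path_edges (v # b' @ [v'])"] curve_Int[of "{{w', v'}}" "path_edges (v # b' @ [v'])"]
        ed(4-6) Union_path_edges[of "v # b' @ [v']"]
      unfolding S_def S'_def B'_def by (simp_all add: curve_def)
    then show "S \<inter> B' \<subseteq> {p v}" "S' \<inter> B' \<subseteq> {p v'}" using dist by auto
  qed
  \<comment> \<open>The path through \<open>b'\<close> meets the chord only in its ends; without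
    them it is connected, so it stays in one half.\<close>
  ultimately have sub: "B' - {p v, p v'} \<subseteq> inside (A \<union> (S \<union> B \<union> S')) \<union> inside (A' \<union> (S \<union> B \<union> S'))"
    using 1(2) BB by blast
  then consider "B' - {p v, p v'} \<subseteq> inside (A' \<union> (S \<union> B \<union> S'))" | "B' - {p v, p v'} \<subseteq> inside (A \<union> (S \<union> B \<union> S'))"
    using connectedD[OF con op] 1(1) by blast
  then show ?thesis
  proof cases
    case 1
    then show ?thesis using ring_split_core[OF ring] unfolding P defs by blast
  next
    case 2
    \<comment> \<open>Exchanging the outer arcs reduces this to the first case; exchanging both
      sides afterwards restores \<open>a\<close> and leaves \<open>b'\<close> facing it.\<close>
    then have "ring_split w a' w' a v b v' b'"
      using ring_split_core[OF ring_paths_swap_outer[OF ring]] unfolding P defs by blast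
    then show ?thesis using ring_split_swap by blast
  qed
qed

end


section \<open>The two regions of a ring, and where a further spoke or a face can lie\<close>

context plane_graph
begin

lemma edge_interior_disjoint:
  assumes "e \<in> edges G" "T \<subseteq> edges G" "e \<notin> T"
  shows "(path_image (\<gamma> e) - p ` e) \<inter> curve \<gamma> T = {}"
proof -
  have "curve \<gamma> {e} \<inter> curve \<gamma> T = p ` (\<Union> {e} \<inter> \<Union> T)"
    by (rule curve_Int) (use assms in auto)
  then have "path_image (\<gamma> e) \<inter> curve \<gamma> T \<subseteq> p ` e"
    by (auto simp: curve_def)
  then show ?thesis by blast
qed

lemma vertex_path_curve_iff:
  assumes "path_edges vs \<subseteq> edges G" "length vs \<ge> 2" "y \<in> verts G"
  shows "p y \<in> path_curve vs \<longleftrightarrow> y \<in> set vs"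
  using curve_vertex_iff[OF assms(1,3)] Union_path_edges[OF assms(2)] by simp

end

locale ring = plane_graph +
  fixes w :: 'a and a :: "'a list" and w' :: 'a and a' :: "'a list"
    and v :: 'a and b :: "'a list" and v' :: 'a and b' :: "'a list"
  assumes paths: "ring_paths w a w' a' v b v' b'"
    and split: "ring_split w a w' a' v b v' b'"
begin

abbreviation "A \<equiv> path_curve (w # a @ [w'])"
abbreviation "A' \<equiv> path_curve (w # a' @ [w'])"
abbreviation "B \<equiv> path_curve (v # b @ [v'])"
abbreviation "B' \<equiv> path_curve (v # b' @ [v'])"
abbreviation "S \<equiv> path_image (\<gamma> {w, v})"
abbreviation "S' \<equiv> path_image (\<gamma> {w', v'})"
abbreviation "R \<equiv> inside (A \<union> (S \<union> B \<union> S'))"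
abbreviation "R' \<equiv> inside (A' \<union> (S \<union> B' \<union> S'))"

text \<open>The two sides are interchangeable, so each fact about \<open>R\<close> is also one about
  \<open>R'\<close>; the interpretations named \<open>sw\<close> draw on this.\<close>

lemma swap: "ring G p \<gamma> w a' w' a v b' v' b"
proof
  show "ring_paths w a' w' a v b' v' b"
    using paths ring_paths_swap_outer ring_paths_swap_inner by blast
  show "ring_split w a' w' a v b' v' b"
    using split by (rule ring_split_swap)
qed

lemma dist: "distinct (w # w' # a @ a' @ v # v' # b @ b')"
  and ne: "a \<noteq> [] \<or> a' \<noteq> []" "b \<noteq> [] \<or> b' \<noteq> []"
  and ed: "path_edges (w # a @ [w']) \<subseteq> edges G" "path_edges (w # a' @ [w']) \<subseteq> edges G"
    "path_edges (v # b @ [v']) \<subseteq> edges G" "path_edges (v # b' @ [v']) \<subseteq> edges G"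
    "{w, v} \<in> edges G" "{w', v'} \<in> edges G"
  and inner: "B \<union> B' \<subseteq> inside (A \<union> A')"
  using paths unfolding ring_paths_def by blast+

lemma disjoint_regions: "R \<inter> R' = {}" "R \<inter> inside (B \<union> B') = {}" "R' \<inter> inside (B \<union> B') = {}"
    "R \<inter> (B \<union> B') = {}" "R' \<inter> (B \<union> B') = {}"
  and union: "inside (A \<union> A') = R \<union> R' \<union> inside (B \<union> B') \<union> (B \<union> B') \<union> (S - {p w}) \<union> (S' - {p w'})"
  using split unfolding ring_split_def Let_def path_curve_chord by blast+

lemma no_overlap: "inside (A \<union> A') \<inter> (A \<union> A') = {}"
  by (rule inside_no_overlap)

lemma chord_edges: "path_edges (w # (v # b @ [v']) @ [w']) \<subseteq> edges G"
  unfolding ring_path_edges using ed by blast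

lemma region: "R \<noteq> {}" "open R" "connected R" "frontier R = A \<union> (S \<union> B \<union> S')"
proof -
  have d: "distinct (w # w' # a @ (v # b @ [v']))" using dist by auto
  have "a \<noteq> [] \<or> v # b @ [v'] \<noteq> []" by simp
  from region_Jordan[OF d this ed(1) chord_edges]
  show "R \<noteq> {}" "open R" "connected R" "frontier R = A \<union> (S \<union> B \<union> S')"
    unfolding path_curve_chord by blast+
qed

lemma frontier_core: "frontier (inside (B \<union> B')) = B \<union> B'"
proof -
  have d: "distinct (v # v' # b @ b')" using dist by auto
  show ?thesis using region_Jordan(4)[OF d ne(2) ed(3,4)] .
qed

lemma closure_core: "closure (inside (B \<union> B')) \<subseteq> inside (A \<union> A')"
  unfolding closure_Un_frontier frontier_core using union by blast

lemma open_outer: "open (inside (A \<union> A'))"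
  and frontier_outer: "frontier (inside (A \<union> A')) = A \<union> A'"
proof -
  have d: "distinct (w # w' # a @ a')" using dist by auto
  show "open (inside (A \<union> A'))" "frontier (inside (A \<union> A')) = A \<union> A'"
    using region_Jordan(2,4)[OF d ne(1) ed(1,2)] .
qed

lemma vert: "set (w # w' # a @ a' @ v # v' # b @ b') \<subseteq> verts G"
  using path_verts[OF ed(1)] path_verts[OF ed(2)] path_verts[OF ed(3)] path_verts[OF ed(4)] by auto

lemma vertex_frontier_iff:
  assumes "y \<in> verts G"
  shows "p y \<in> frontier R \<longleftrightarrow> y \<in> set (w # w' # a @ v # v' # b)"
proof -
  have "p y \<in> path_curve (w # (v # b @ [v']) @ [w']) \<longleftrightarrow> y \<in> set (w # (v # b @ [v']) @ [w'])"
    by (rule vertex_path_curve_iff[OF chord_edges _ assms]) simp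
  moreover have "p y \<in> A \<longleftrightarrow> y \<in> set (w # a @ [w'])"
    by (rule vertex_path_curve_iff[OF ed(1) _ assms]) simp
  ultimately show ?thesis
    unfolding region(4) path_curve_chord by auto
qed

text \<open>Without its ends the arc avoids both cycles and both given spokes, so connectedness
  confines it to one of \<open>R\<close>, \<open>R'\<close> and the inner disc. The inner disc is
  excluded because its closure does not reach the outer cycle. The ends are limit points of the arc,
  hence on the frontier of its region, and this tells on which paths they lie.\<close>

lemma spoke:
  assumes e: "{u, z} \<in> edges G" and u: "u \<in> set a \<union> set a'" and z: "z \<in> set b \<union> set b'"
  shows "path_image (\<gamma> {u, z}) - p ` {u, z} \<subseteq> R \<and> u \<in> set a \<and> z \<in> set b \<or>
         path_image (\<gamma> {u, z}) - p ` {u, z} \<subseteq> R' \<and> u \<in> set a' \<and> z \<in> set b'"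
proof -
  interpret sw: ring G p \<gamma> w a' w' a v b' v' b by (rule swap)
  define X where "X = path_image (\<gamma> {u, z}) - p ` {u, z}"
  have X: "connected X" "X \<noteq> {}" "path_image (\<gamma> {u, z}) \<subseteq> closure X" "p u \<in> path_image (\<gamma> {u, z})" "p z \<in> path_image (\<gamma> {u, z})"
    using edge_interior[OF e] unfolding X_def by auto
  have uz: "u \<in> verts G" "z \<in> verts G" using edge_subset[OF e] by auto
  have u': "u \<notin> set (v # v' # b @ b')" "u \<notin> {w, w'}" and z': "z \<notin> set (w # w' # a @ a')" "z \<notin> {v, v'}"
    using u z dist by auto
  have dj: "X \<inter> curve \<gamma> T = {}" if "T \<subseteq> edges G" "{u, z} \<notin> T" for T
    using edge_interior_disjoint[OF e that] unfolding X_def .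
  have notin: "{u, z} \<notin> path_edges vs" if "u \<notin> set vs \<or> z \<notin> set vs" for vs
    using path_edges_subset[of "{u, z}" vs] that by auto
  have XA: "X \<inter> A = {}" "X \<inter> A' = {}" "X \<inter> B = {}" "X \<inter> B' = {}"
    by (rule dj[OF ed(1)] dj[OF ed(2)] dj[OF ed(3)] dj[OF ed(4)], rule notin, use u' z' in simp)+
  have "{u, z} \<noteq> {w, v}" "{u, z} \<noteq> {w', v'}" using u' z' by (auto simp: doubleton_eq_iff)
  then have XS: "X \<inter> S = {}" "X \<inter> S' = {}"
    using dj[of "{{w, v}}"] dj[of "{{w', v'}}"] ed by (auto simp: curve_def)
  have pu: "p u \<in> A \<union> A'"
  proof -
    have "p u \<in> A \<longleftrightarrow> u \<in> set (w # a @ [w'])" "p u \<in> A' \<longleftrightarrow> u \<in> set (w # a' @ [w'])"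
      by (rule vertex_path_curve_iff[OF _ _ uz(1)]; use ed in simp)+
    then show ?thesis using u by auto
  qed
  have pz: "p z \<in> B \<union> B'"
  proof -
    have "p z \<in> B \<longleftrightarrow> z \<in> set (v # b @ [v'])" "p z \<in> B' \<longleftrightarrow> z \<in> set (v # b' @ [v'])"
      by (rule vertex_path_curve_iff[OF _ _ uz(2)]; use ed in simp)+
    then show ?thesis using z by auto
  qed
  have pu_out: "p u \<notin> inside (A \<union> A')" using pu no_overlap by blast
  \<comment> \<open>The end at \<open>z\<close> is inside the outer curve, so the arc has points
    there, and it cannot leave without crossing that curve.\<close>
  have XI: "X \<subseteq> inside (A \<union> A')"
  proof (rule ccontr)
    assume "\<not> ?thesis"
    moreover have "X \<inter> inside (A \<union> A') \<noteq> {}"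
    proof -
      have "p z \<in> inside (A \<union> A')" using pz inner by blast
      moreover have "p z \<in> closure X" using X by blast
      ultimately show ?thesis using open_Int_closure_eq_empty[OF open_outer, of X] by blast
    qed
    ultimately have "X \<inter> frontier (inside (A \<union> A')) \<noteq> {}"
      using connected_Int_frontier[OF X(1), of "inside (A \<union> A')"] by blast
    then show False unfolding frontier_outer using XA by blast
  qed
  have XU: "X \<subseteq> R \<union> (R' \<union> inside (B \<union> B'))" using XI XA XS union by blast
  have "open (inside (B \<union> B'))"
    using region_Jordan(2)[of v v' b b'] dist ne ed by auto
  then have op: "open (R' \<union> inside (B \<union> B'))" "open R'" "open (inside (B \<union> B'))"
    using sw.region(2) by auto
  have "X \<subseteq> R \<or> X \<subseteq> R' \<union> inside (B \<union> B')"
    using connectedD[OF X(1) region(2) op(1)] XU disjoint_regions by blast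
  moreover have "X \<subseteq> R' \<or> X \<subseteq> inside (B \<union> B')" if "X \<subseteq> R' \<union> inside (B \<union> B')"
    using connectedD[OF X(1) op(2,3)] that disjoint_regions by blast
  moreover have "\<not> X \<subseteq> inside (B \<union> B')"
  proof
    assume "X \<subseteq> inside (B \<union> B')"
    then have "p u \<in> closure (inside (B \<union> B'))" using closure_mono X by blast
    then show False using closure_core pu_out by blast
  qed
  moreover have "u \<in> set a \<and> z \<in> set b" if XR: "X \<subseteq> R"
  proof -
    have "p u \<in> closure R" "p z \<in> closure R" using closure_mono[OF XR] X by blast+
    moreover have "p u \<notin> R" using pu_out union by blast
    moreover have "p z \<notin> R" using pz disjoint_regions by blast
    ultimately have "p u \<in> frontier R" "p z \<in> frontier R" unfolding closure_Un_frontier by blast+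
    then show ?thesis using vertex_frontier_iff uz u' z' by auto
  qed
  moreover have "u \<in> set a' \<and> z \<in> set b'" if XR: "X \<subseteq> R'"
  proof -
    have "p u \<in> closure R'" "p z \<in> closure R'" using closure_mono[OF XR] X by blast+
    moreover have "p u \<notin> R'" using pu_out union by blast
    moreover have "p z \<notin> R'" using pz disjoint_regions by blast
    ultimately have "p u \<in> frontier R'" "p z \<in> frontier R'" unfolding closure_Un_frontier by blast+
    then show ?thesis using sw.vertex_frontier_iff uz u' z' by auto
  qed
  ultimately show ?thesis unfolding X_def by blast
qed

text \<open>The set \<open>F\<close> stands for a face with a boundary point \<open>t\<close>
  interior to the arc through \<open>a\<close>. What the outer curve encloses apart from
  \<open>R\<close> lies in a closed set that misses \<open>t\<close>, so \<open>F\<close> has points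
  near \<open>t\<close> outside that set, and these belong to \<open>R\<close>.\<close>

lemma region_unique:
  assumes "t \<in> A" "t \<noteq> p w" "t \<noteq> p w'" "t \<in> closure F" "open F"
    and "F \<subseteq> A \<union> A' \<union> inside (A \<union> A')" "F \<inter> (A \<union> A' \<union> B \<union> B' \<union> S \<union> S') = {}"
  shows "F \<inter> R \<noteq> {}"
proof -
  interpret sw: ring G p \<gamma> w a' w' a v b' v' b by (rule swap)
  define Z where "Z = closure R' \<union> closure (inside (B \<union> B')) \<union> (S \<union> B' \<union> S') \<union> B"
  have cl: "closed (curve \<gamma> T)" if "finite T" "T \<subseteq> edges G" for T
    using compact_curve[OF that] compact_imp_closed by blast
  have fin: "finite (path_edges vs)" for vs :: "'a list"
    by (induction vs rule: induct_list012) simp_all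
  have "closed B" using cl[OF fin ed(3)] .
  moreover have "closed (S \<union> B' \<union> S')"
    using cl[OF fin sw.chord_edges] unfolding path_curve_chord .
  ultimately have "closed Z" unfolding Z_def by auto
  have tI: "t \<notin> inside (A \<union> A')" using assms(1) no_overlap by blast
  have "distinct (w # w' # a @ a')" using dist by auto
  then have tA': "t \<notin> A'"
    using path_curves_Int[of w w' a a', OF _ ne(1) ed(1,2)] assms(1-3) by blast
  have "S - {p w} \<subseteq> inside (A \<union> A')" "S' - {p w'} \<subseteq> inside (A \<union> A')" using union by blast+
  then have tS: "t \<notin> S" "t \<notin> S'" using tI assms(2,3) by blast+
  have tB: "t \<notin> B" "t \<notin> B'" using tI inner by blast+
  have "t \<notin> closure R'"
    unfolding closure_Un_frontier sw.region(4) using tI tA' tS tB union by blast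
  then have "t \<notin> Z" unfolding Z_def using closure_core tI tS tB by blast
  then have "F \<inter> - Z \<noteq> {}"
    using \<open>closed Z\<close> assms(4) open_Int_closure_eq_empty[of "- Z" F] by auto
  then obtain y where y: "y \<in> F" "y \<notin> Z" by blast
  then have "y \<in> inside (A \<union> A')" using assms(6,7) by blast
  moreover have "y \<notin> R'" "y \<notin> inside (B \<union> B')" using y(2) closure_subset unfolding Z_def by blast+
  ultimately show ?thesis using y assms(7) union by blast
qed

end


section \<open>Annular embeddings\<close>

lemma path_edges_snoc2: "path_edges (xs @ [a, b]) = insert {a, b} (path_edges (xs @ [a]))"
  using path_edges_append[of xs a "[b]"] by auto

lemma is_cycle_at:
  assumes "is_cycle G c" "y \<in> set c"
  obtains zs where "is_cycle G (y # zs)" "set (y # zs) = set c" "cycle_edges (y # zs) = cycle_edges c"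
proof -
  obtain xs ys where "c = xs @ y # ys" using assms(2) by (meson split_list)
  then have "is_cycle G (y # ys @ xs)" "set (y # ys @ xs) = set c" "cycle_edges (y # ys @ xs) = cycle_edges c"
    using assms(1) is_cycle_rotate[of G xs "y # ys"] cycle_edges_rotate[of xs "y # ys"] by auto
  then show ?thesis by (rule that)
qed

lemma is_cycle_at2:
  assumes "is_cycle G c" "y \<in> set c" "z \<in> set c" "y \<noteq> z"
  obtains b b' where "is_cycle G (y # b @ z # b')" "set (y # b @ z # b') = set c"
    "cycle_edges (y # b @ z # b') = cycle_edges c"
proof -
  obtain zs where zs: "is_cycle G (y # zs)" "set (y # zs) = set c" "cycle_edges (y # zs) = cycle_edges c"
    using is_cycle_at[OF assms(1,2)] by blast
  then have "z \<in> set zs" using assms(3,4) by auto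
  then obtain b b' where "zs = b @ z # b'" by (meson split_list)
  then show ?thesis using that[of b b'] zs by simp
qed

lemma card_cycle_edges_at:
  assumes "is_cycle G c" "y \<in> set c"
  shows "card {e \<in> cycle_edges c. y \<in> e} = 2"
proof -
  obtain zs where zs: "is_cycle G (y # zs)" "cycle_edges (y # zs) = cycle_edges c"
    by (rule is_cycle_at[OF assms])
  then have len: "length zs \<ge> 2" and d: "distinct (y # zs)" by (simp_all add: is_cycle_def)
  obtain s zs' where s: "zs = s # zs'" using len by (cases zs) auto
  then obtain t r where zt: "zs = s # t @ [r]" using len by (cases zs' rule: rev_cases) auto
  have "cycle_edges c = insert {y, s} (insert {r, y} (path_edges (s # t @ [r])))"
    using path_edges_snoc2[of "s # t" r y] unfolding zs(2)[symmetric] zt cycle_edges_Cons by simp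
  moreover have "y \<notin> e" if "e \<in> path_edges (s # t @ [r])" for e
    using path_edges_subset[OF that] d zt by auto
  ultimately have "{e \<in> cycle_edges c. y \<in> e} = {{y, s}, {r, y}}" by auto
  moreover have "{y, s} \<noteq> {r, y}" using d zt by (auto simp: doubleton_eq_iff)
  ultimately show ?thesis by simp
qed

section \<open>Spokes of a cubic graph with an annular embedding\<close>

locale annular = plane_graph +
  fixes C :: "nat \<Rightarrow> 'a list" and x :: nat
  assumes embedded: "annular_embedding G p \<gamma> C x"
    and cubic: "\<forall>y\<in>verts G. degree G y = 3"
    and finite_verts: "finite (verts G)"
begin

lemma cyc: "k \<le> x \<Longrightarrow> is_cycle G (C k)"
  and disjoint_cycles: "j \<le> x \<Longrightarrow> k \<le> x \<Longrightarrow> j \<noteq> k \<Longrightarrow> set (C j) \<inter> set (C k) = {}"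
  and nested: "1 \<le> k \<Longrightarrow> k \<le> x \<Longrightarrow>
    curve \<gamma> (cycle_edges (C (k - 1))) \<subseteq> inside (curve \<gamma> (cycle_edges (C k)))"
  and verts_eq: "verts G = (\<Union>k\<in>{0..x}. set (C k))"
  and edge_cases: "e \<in> edges G \<Longrightarrow> (\<exists>k\<le>x. e \<in> cycle_edges (C k)) \<or> (\<exists>k\<in>{1..x}. e \<in> annulus_edges G C k)"
  using embedded unfolding annular_embedding_def by simp_all

lemma level: "j \<le> x \<Longrightarrow> k \<le> x \<Longrightarrow> y \<in> set (C j) \<Longrightarrow> y \<in> set (C k) \<Longrightarrow> j = k"
  using disjoint_cycles by blast

lemma cycle_sub: "k \<le> x \<Longrightarrow> cycle_edges (C k) \<subseteq> edges G"
  and cycle_distinct: "k \<le> x \<Longrightarrow> distinct (C k)"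
  and cycle_length: "k \<le> x \<Longrightarrow> length (C k) \<ge> 3"
  using cyc by (simp_all add: is_cycle_def)

lemma cycle_verts: "k \<le> x \<Longrightarrow> y \<in> set (C k) \<Longrightarrow> y \<in> verts G"
  unfolding verts_eq by auto

lemma finite_edges: "finite (edges G)"
proof (rule finite_subset)
  show "edges G \<subseteq> Pow (verts G)" using edge_subset by blast
qed (simp add: finite_verts)

text \<open>The outer end comes first, so \<open>spoke (Suc j) t y\<close> makes \<open>y\<close> an
  outward vertex of \<open>C j\<close>. The condition \<open>1 \<le> j\<close> guards the truncated
  subtraction: for \<open>j = 0\<close> the edges of \<open>C 0\<close> itself would
  qualify.\<close>

definition spoke :: "nat \<Rightarrow> 'a \<Rightarrow> 'a \<Rightarrow> bool" where
  "spoke j u v \<longleftrightarrow> 1 \<le> j \<and> j \<le> x \<and> u \<in> set (C j) \<and> v \<in> set (C (j - 1)) \<and> {u, v} \<in> edges G"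

lemma annulus_edges_iff:
  assumes "1 \<le> k" "k \<le> x"
  shows "e \<in> annulus_edges G C k \<longleftrightarrow> (\<exists>u v. spoke k u v \<and> e = {u, v})"
proof
  assume "e \<in> annulus_edges G C k"
  then obtain u v where "e \<in> edges G" "u \<in> set (C (k - 1))" "v \<in> set (C k)" "e = {u, v}"
    unfolding annulus_edges_def by blast
  then have "spoke k v u \<and> e = {v, u}" using assms by (auto simp: spoke_def insert_commute)
  then show "\<exists>u v. spoke k u v \<and> e = {u, v}" by blast
next
  assume "\<exists>u v. spoke k u v \<and> e = {u, v}"
  then obtain u v where "spoke k u v" "e = {v, u}" by (auto simp: insert_commute)
  then show "e \<in> annulus_edges G C k" unfolding annulus_edges_def spoke_def by (auto simp: insert_commute)
qed

lemma spoke_not_cycle: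
  assumes "spoke j u v" "k \<le> x"
  shows "{u, v} \<notin> cycle_edges (C k)"
proof
  assume "{u, v} \<in> cycle_edges (C k)"
  then have "u \<in> set (C k)" "v \<in> set (C k)" using cycle_edges_subset by blast+
  then have "j = k" "j - 1 = k" using assms level[of j k u] level[of "j - 1" k v] by (auto simp: spoke_def)
  then show False using assms by (auto simp: spoke_def)
qed

text \<open>Of the three edges at a vertex two belong to its cycle. All uniqueness facts about
  spokes come from the third one being single.\<close>

lemma card_spoke_edges:
  assumes "k \<le> x" "y \<in> set (C k)"
  shows "card ({e \<in> edges G. y \<in> e} - cycle_edges (C k)) = 1"
proof -
  have "card {e \<in> edges G. y \<in> e} = 3" using cubic cycle_verts[OF assms] by (simp add: degree_def)
  moreover have "card {e \<in> cycle_edges (C k). y \<in> e} = 2"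
    by (rule card_cycle_edges_at[OF cyc]) (use assms in auto)
  moreover have "{e \<in> cycle_edges (C k). y \<in> e} \<subseteq> {e \<in> edges G. y \<in> e}"
    using cycle_sub[OF assms(1)] by blast
  moreover have "{e \<in> edges G. y \<in> e} - cycle_edges (C k) = {e \<in> edges G. y \<in> e} - {e \<in> cycle_edges (C k). y \<in> e}"
    by blast
  ultimately show ?thesis
    using card_Diff_subset[of "{e \<in> cycle_edges (C k). y \<in> e}" "{e \<in> edges G. y \<in> e}"]
      finite_subset[OF _ finite_edges, of "{e \<in> cycle_edges (C k). y \<in> e}"] by auto
qed

lemma spoke_edge_unique:
  assumes "spoke i u v" "spoke j u' v'" "y \<in> {u, v}" "y \<in> {u', v'}"
  shows "{u, v} = {u', v'}"
proof -
  obtain k where k: "k \<le> x" "y \<in> set (C k)"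
    using assms(1,3) unfolding spoke_def by (metis diff_le_self insertE le_trans singletonD)
  obtain e where e: "{e \<in> edges G. y \<in> e} - cycle_edges (C k) = {e}"
    using card_spoke_edges[OF k] by (auto simp: card_1_singleton_iff)
  have "{u, v} \<in> {e \<in> edges G. y \<in> e} - cycle_edges (C k)" "{u', v'} \<in> {e \<in> edges G. y \<in> e} - cycle_edges (C k)"
    using assms spoke_not_cycle[OF _ k(1)] unfolding spoke_def by simp_all
  then show ?thesis unfolding e by simp
qed

lemma spoke_level: "spoke j u v \<Longrightarrow> u \<noteq> v"
  using level[of j "j - 1" u] by (fastforce simp: spoke_def)

lemma spoke_right_unique: "spoke j u v \<Longrightarrow> spoke j u v' \<Longrightarrow> v = v'"
  using spoke_edge_unique[of j u v j u v' u] by (auto simp: doubleton_eq_iff)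

lemma spoke_left_unique: "spoke j u v \<Longrightarrow> spoke j u' v \<Longrightarrow> u = u'"
  using spoke_edge_unique[of j u v j u' v v] by (auto simp: doubleton_eq_iff)

lemma not_in_and_out:
  assumes "spoke j u v" "spoke (Suc j) t u"
  shows False
proof -
  have "{u, v} = {t, u}" using spoke_edge_unique[OF assms, of u] by simp
  then have "v = t" using spoke_level[OF assms(1)] by (auto simp: doubleton_eq_iff)
  then have "j - 1 = Suc j" using assms level[of "j - 1" "Suc j" v] by (auto simp: spoke_def)
  then show False by simp
qed

lemma in_or_out:
  assumes "j \<le> x" "y \<in> set (C j)"
  shows "(\<exists>v. spoke j y v) \<or> (\<exists>u. spoke (Suc j) u y)"
proof -
  obtain e where "{e \<in> edges G. y \<in> e} - cycle_edges (C j) = {e}"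
    using card_spoke_edges[OF assms] by (auto simp: card_1_singleton_iff)
  then have e: "e \<in> edges G" "y \<in> e" "e \<notin> cycle_edges (C j)" by blast+
  have "e \<notin> cycle_edges (C k)" if "k \<le> x" for k
  proof
    assume ek: "e \<in> cycle_edges (C k)"
    then have "y \<in> set (C k)" using cycle_edges_subset e(2) by blast
    then show False using level[of j k y] assms that e(3) ek by auto
  qed
  then obtain k where k: "k \<in> {1..x}" "e \<in> annulus_edges G C k" using edge_cases[OF e(1)] by blast
  then obtain u v where uv: "spoke k u v" "e = {u, v}" using annulus_edges_iff[of k e] by auto
  then consider "y = u" | "y = v" using e(2) by auto
  then show ?thesis
  proof cases
    case 1
    then have "j = k" using uv assms level[of j k y] by (simp add: spoke_def)
    then show ?thesis using uv 1 by blast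
  next
    case 2
    then have "j = k - 1" using uv 2 assms level[of j "k - 1" y] k by (auto simp: spoke_def)
    then have "k = Suc j" using k by auto
    then show ?thesis using uv 2 by blast
  qed
qed

text \<open>The lists do not reveal which path of the inner cycle faces \<open>a\<close>;
  \<open>ring_split\<close> decides it, and \<open>b\<close> is chosen to be that path. The list
  \<open>a0\<close> is reversed because both outer paths of a ring run from \<open>w\<close> to
  \<open>w'\<close>.\<close>

lemma ring_exists:
  assumes sp: "spoke j w v" "spoke j w' v'" and "w \<noteq> w'"
    and c: "is_cycle G (w # a @ w' # a0)" "set (w # a @ w' # a0) = set (C j)"
      "cycle_edges (w # a @ w' # a0) = cycle_edges (C j)"
  obtains b b' where "ring G p \<gamma> w a w' (rev a0) v b v' b'" "set (v # b @ v' # b') = set (C (j - 1))"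
    "cycle_edges (C (j - 1)) = path_edges (v # b @ [v']) \<union> path_edges (v # b' @ [v'])"
    "cycle_edges (C j) = path_edges (w # a @ [w']) \<union> path_edges (w # rev a0 @ [w'])"
proof -
  have j: "1 \<le> j" "j \<le> x" and vw: "v \<in> set (C (j - 1))" "v' \<in> set (C (j - 1))"
    and ed: "{w, v} \<in> edges G" "{w', v'} \<in> edges G"
    using sp by (auto simp: spoke_def)
  have jx: "j - 1 \<le> x" using j by simp
  have vv: "v \<noteq> v'" using spoke_left_unique sp assms(3) by blast
  obtain b b0 where b: "is_cycle G (v # b @ v' # b0)" "set (v # b @ v' # b0) = set (C (j - 1))"
    "cycle_edges (v # b @ v' # b0) = cycle_edges (C (j - 1))"
    by (rule is_cycle_at2[OF cyc[OF jx] vw vv])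
  have rv: "path_edges (y # rev r @ [z]) = path_edges (z # r @ [y])" for y z :: 'a and r
    using path_edges_rev[of "z # r @ [y]"] by simp
  have eB: "cycle_edges (C (j - 1)) = path_edges (v # b @ [v']) \<union> path_edges (v # rev b0 @ [v'])"
    unfolding b(3)[symmetric] cycle_edges_Cons_Cons rv ..
  have eA: "cycle_edges (C j) = path_edges (w # a @ [w']) \<union> path_edges (w # rev a0 @ [w'])"
    unfolding c(3)[symmetric] cycle_edges_Cons_Cons rv ..
  have dj: "set (C j) \<inter> set (C (j - 1)) = {}" using level[of j "j - 1"] j by fastforce
  have "distinct (w # a @ w' # a0)" "distinct (v # b @ v' # b0)" "length (w # a @ w' # a0) \<ge> 3"
    "length (v # b @ v' # b0) \<ge> 3"
    using b(1) c(1) by (simp_all add: is_cycle_def)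
  moreover have "set (w # a @ w' # a0) \<inter> set (v # b @ v' # b0) = {}" using dj b(2) c(2) by simp
  ultimately have d: "distinct (w # w' # a @ rev a0 @ v # v' # b @ rev b0)"
    and ne: "a \<noteq> [] \<or> rev a0 \<noteq> []" "b \<noteq> [] \<or> rev b0 \<noteq> []" by auto
  have sA: "path_edges (w # a @ [w']) \<subseteq> edges G" "path_edges (w # rev a0 @ [w']) \<subseteq> edges G"
    using cycle_sub[of j] j unfolding eA by auto
  have sB: "path_edges (v # b @ [v']) \<subseteq> edges G" "path_edges (v # rev b0 @ [v']) \<subseteq> edges G"
    using cycle_sub[of "j - 1"] j unfolding eB by auto
  have cin: "path_curve (v # b @ [v']) \<union> path_curve (v # rev b0 @ [v']) \<subseteq> region (w # a @ [w']) (w # rev a0 @ [w'])"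
    using nested[OF j] unfolding eA eB curve_Un .
  have rp: "ring_paths w a w' (rev a0) v b v' (rev b0)"
    unfolding ring_paths_def using d ne sA sB ed cin by blast
  have st: "set (v # b @ v' # rev b0) = set (C (j - 1))" using b(2) by simp
  show ?thesis
  proof (cases "ring_split w a w' (rev a0) v b v' (rev b0)")
    case True
    then have "ring G p \<gamma> w a w' (rev a0) v b v' (rev b0)" using rp by unfold_locales
    then show ?thesis using that[of b "rev b0"] st eA eB by blast
  next
    case False
    then have "ring_split w a w' (rev a0) v (rev b0) v' b" using ring_split[OF rp] by blast
    then have "ring G p \<gamma> w a w' (rev a0) v (rev b0) v' b"
      using ring_paths_swap_inner[OF rp] by unfold_locales
    moreover have "set (v # rev b0 @ v' # b) = set (C (j - 1))" using b(2) by auto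
    ultimately show ?thesis using that[of "rev b0" b] eA eB by blast
  qed
qed

lemma ring_spoke:
  assumes r: "ring G p \<gamma> w a w' a' v b v' b'"
    and st: "set (w # a @ w' # a') = set (C j)" "set (v # b @ v' # b') = set (C (j - 1))"
    and sp: "spoke j w v" "spoke j w' v'" "spoke j u z" and "u \<noteq> w" "u \<noteq> w'"
  shows "path_image (\<gamma> {u, z}) - p ` {u, z} \<subseteq> inside (curve \<gamma> (path_edges (w # a @ [w'])) \<union>
            (path_image (\<gamma> {w, v}) \<union> path_curve (v # b @ [v']) \<union> path_image (\<gamma> {w', v'}))) \<and> u \<in> set a \<and> z \<in> set b \<or>
         path_image (\<gamma> {u, z}) - p ` {u, z} \<subseteq> inside (curve \<gamma> (path_edges (w # a' @ [w'])) \<union>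
            (path_image (\<gamma> {w, v}) \<union> path_curve (v # b' @ [v']) \<union> path_image (\<gamma> {w', v'}))) \<and> u \<in> set a' \<and> z \<in> set b'"
proof -
  have "z \<noteq> v" "z \<noteq> v'" using spoke_left_unique sp assms(7,8) by blast+
  moreover have "u \<in> set (C j)" "z \<in> set (C (j - 1))" "{u, z} \<in> edges G" using sp(3) by (auto simp: spoke_def)
  ultimately have "u \<in> set a \<union> set a'" "z \<in> set b \<union> set b'" "{u, z} \<in> edges G"
    using assms(7,8) unfolding st[symmetric] by auto
  then show ?thesis using ring.spoke[OF r] by blast
qed

text \<open>Adjacency of \<open>v\<close> and \<open>v'\<close> makes one of the inner paths free of
  interior vertices. A vertex inside the facing outer path would send its spoke to an interior
  vertex of that path, so the outer path is a single edge too. This serves the outermost cycle, all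
  of whose vertices are inward.\<close>

lemma outer_adjacent:
  assumes sp: "spoke j w v" "spoke j w' v'" and "{v, v'} \<in> cycle_edges (C (j - 1))" "v \<noteq> v'"
    and all: "\<And>y. y \<in> set (C j) \<Longrightarrow> \<exists>z. spoke j y z"
  shows "{w, w'} \<in> cycle_edges (C j)"
proof -
  have j: "1 \<le> j" "j \<le> x" "w \<in> set (C j)" "w' \<in> set (C j)" using sp by (auto simp: spoke_def)
  have ne: "w \<noteq> w'" using spoke_right_unique sp assms(4) by blast
  obtain a a0 where c: "is_cycle G (w # a @ w' # a0)" "set (w # a @ w' # a0) = set (C j)"
      "cycle_edges (w # a @ w' # a0) = cycle_edges (C j)"
    using is_cycle_at2[OF cyc j(3,4) ne] j(2) by blast
  obtain b b' where r: "ring G p \<gamma> w a w' (rev a0) v b v' b'" "set (v # b @ v' # b') = set (C (j - 1))"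
    "cycle_edges (C (j - 1)) = path_edges (v # b @ [v']) \<union> path_edges (v # b' @ [v'])"
    "cycle_edges (C j) = path_edges (w # a @ [w']) \<union> path_edges (w # rev a0 @ [w'])"
    using ring_exists[OF sp ne c] by blast
  interpret r: ring G p \<gamma> w a w' "rev a0" v b v' b' by (rule r(1))
  have st: "set (w # a @ w' # rev a0) = set (C j)" using c(2) by simp
  have adj: "b = [] \<or> b' = []"
  proof -
    have one: "d = []" if "{v, v'} \<in> path_edges (v # d @ [v'])" "distinct (v # v' # d)" for d
    proof (rule ccontr)
      assume "d \<noteq> []"
      then obtain s d' where d: "d = s # d'" by (cases d) auto
      then have "{v, v'} \<noteq> {v, s}" using that(2) by (auto simp: doubleton_eq_iff)
      then have "{v, v'} \<in> path_edges (s # d' @ [v'])" using that(1) d by simp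
      then show False using path_edges_subset[of "{v, v'}" "s # d' @ [v']"] that(2) d by auto
    qed
    have "distinct (v # v' # b)" "distinct (v # v' # b')" using r.dist by auto
    then show ?thesis using assms(3) one unfolding r(3) by blast
  qed
  have emp: "u \<notin> set a \<or> b \<noteq> []" "u \<notin> set (rev a0) \<or> b' \<noteq> []" for u
  proof -
    have key: "(\<exists>z. z \<in> set b) \<and> u \<in> set a \<or> (\<exists>z. z \<in> set b') \<and> u \<in> set (rev a0)"
      if "u \<in> set a \<union> set (rev a0)"
    proof -
      have "u \<in> set (C j)" "u \<noteq> w" "u \<noteq> w'" using that c(2) r.dist by auto
      then obtain z where "spoke j u z" using all by blast
      from ring_spoke[OF r(1) st r(2) sp this \<open>u \<noteq> w\<close> \<open>u \<noteq> w'\<close>] show ?thesis by blast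
    qed
    have "set a \<inter> set (rev a0) = {}" using r.dist by auto
    then show "u \<notin> set a \<or> b \<noteq> []" "u \<notin> set (rev a0) \<or> b' \<noteq> []" using key by fastforce+
  qed
  from adj show ?thesis
  proof
    assume "b = []"
    then have "a = []" using emp(1) by (cases a) auto
    then show ?thesis unfolding r(4) by simp
  next
    assume "b' = []"
    then have "rev a0 = []" using emp(2) by (cases "rev a0") auto
    then show ?thesis unfolding r(4) by simp
  qed
qed

end


section \<open>The subgraph inside a cycle and the faces of its outer annulus\<close>

lemma Union_cycle_edges:
  assumes "is_cycle G c"
  shows "\<Union> (cycle_edges c) = set c"
proof -
  obtain a xs where c: "c = a # xs" using assms by (cases c) (auto simp: is_cycle_def)
  have "length (a # xs @ [a]) \<ge> 2" by simp
  then show ?thesis unfolding c cycle_edges_Cons using Union_path_edges[of "a # xs @ [a]"] by auto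
qed

context annular
begin

abbreviation cycle_curve :: "nat \<Rightarrow> complex set" where
  "cycle_curve k \<equiv> curve \<gamma> (cycle_edges (C k))"

abbreviation part :: "nat \<Rightarrow> 'a graph" where
  "part j \<equiv> annular_part G C 0 j"

lemma on_cycle_curve:
  assumes "k \<le> x" "y \<in> set (C k)"
  shows "p y \<in> cycle_curve k"
  unfolding curve_vertex_iff[OF cycle_sub[OF assms(1)] cycle_verts[OF assms]]
    Union_cycle_edges[OF cyc[OF assms(1)]] by (rule assms(2))

lemma part_verts: "verts (part j) = (\<Union>k\<in>{0..j}. set (C k))"
  by (simp add: annular_part_def)

lemma part_edge_iff:
  assumes "j \<le> x"
  shows "e \<in> edges (part j) \<longleftrightarrow>
    (\<exists>k\<le>j. e \<in> cycle_edges (C k)) \<or> (\<exists>k u v. k \<le> j \<and> spoke k u v \<and> e = {u, v})"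
proof -
  have "e \<in> edges (part j) \<longleftrightarrow> (\<exists>k\<le>j. e \<in> cycle_edges (C k)) \<or> (\<exists>k\<in>{0<..j}. e \<in> annulus_edges G C k)"
    by (auto simp: annular_part_def)
  moreover have "(\<exists>k\<in>{0<..j}. e \<in> annulus_edges G C k) \<longleftrightarrow> (\<exists>k u v. k \<le> j \<and> spoke k u v \<and> e = {u, v})"
  proof
    assume "\<exists>k\<in>{0<..j}. e \<in> annulus_edges G C k"
    then obtain k where "k \<in> {0<..j}" "e \<in> annulus_edges G C k" by blast
    then show "\<exists>k u v. k \<le> j \<and> spoke k u v \<and> e = {u, v}"
      using annulus_edges_iff[of k e] assms by auto
  next
    assume "\<exists>k u v. k \<le> j \<and> spoke k u v \<and> e = {u, v}"
    then obtain k u v where k: "k \<le> j" "spoke k u v" "e = {u, v}" by blast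
    then have "1 \<le> k" "k \<le> x" by (simp_all add: spoke_def)
    then have "e \<in> annulus_edges G C k" using annulus_edges_iff[of k e] k by blast
    then show "\<exists>k\<in>{0<..j}. e \<in> annulus_edges G C k" using k \<open>1 \<le> k\<close> by auto
  qed
  ultimately show ?thesis by simp
qed

lemma part_sub:
  assumes "j \<le> x"
  shows "edges (part j) \<subseteq> edges G"
proof
  fix e assume "e \<in> edges (part j)"
  then consider k where "k \<le> j" "e \<in> cycle_edges (C k)" | k u v where "spoke k u v" "e = {u, v}"
    unfolding part_edge_iff[OF assms] by blast
  then show "e \<in> edges G"
  proof cases
    case (1 k)
    then show ?thesis using cycle_sub[of k] assms by auto
  qed (simp add: spoke_def)
qed

text \<open>The edges lost at the border of \<open>part j\<close> are the spokes leading outwards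
  from \<open>C j\<close>, and an inward vertex has none. Hence such vertices, and all vertices of
  the smaller cycles, survive suppression.\<close>

lemma part_edges_at:
  assumes "j \<le> x" "k \<le> j" "y \<in> set (C k)" "k = j \<Longrightarrow> \<exists>v. spoke j y v"
  shows "{e \<in> edges (part j). y \<in> e} = {e \<in> edges G. y \<in> e}"
proof (intro equalityI subsetI)
  fix e assume "e \<in> {e \<in> edges G. y \<in> e}"
  then have e: "e \<in> edges G" "y \<in> e" by auto
  then consider l where "l \<le> x" "e \<in> cycle_edges (C l)" | l u v where "spoke l u v" "e = {u, v}"
    using edge_cases[OF e(1)] annulus_edges_iff by auto
  then have "e \<in> edges (part j)"
  proof cases
    case 1
    then have "y \<in> set (C l)" using cycle_edges_subset e(2) by blast
    then have "l = k" using 1 assms level[of l k y] by simp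
    then show ?thesis using 1 assms part_edge_iff by blast
  next
    case 2
    then consider "y = u" | "y = v" using e(2) by blast
    then have "l \<le> j"
    proof cases
      case 1
      then show ?thesis using 2 assms level[of l k y] by (auto simp: spoke_def)
    next
      case y: 2
      then have "l - 1 = k" using 2 assms level[of "l - 1" k y] by (auto simp: spoke_def)
      then have l: "l = Suc k" using 2 by (auto simp: spoke_def)
      have "k \<noteq> j"
      proof
        assume "k = j"
        then obtain t where "spoke j y t" using assms(4) by blast
        then show False using not_in_and_out[of j y t u] 2 l y \<open>k = j\<close> by simp
      qed
      then show ?thesis using l assms by simp
    qed
    then show ?thesis using 2 part_edge_iff[OF assms(1)] by blast
  qed
  then show "e \<in> {e \<in> edges (part j). y \<in> e}" using e by simp
qed (use part_sub[OF assms(1)] in blast)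

lemma part_degree:
  assumes "j \<le> x" "k \<le> j" "y \<in> set (C k)" "k = j \<Longrightarrow> \<exists>v. spoke j y v"
  shows "degree (part j) y = 3"
proof -
  have "y \<in> verts G" using assms cycle_verts[of k y] by simp
  then show ?thesis using part_edges_at[OF assms] cubic by (simp add: degree_def)
qed

lemma cycle_curve_Jordan:
  assumes "k \<le> x"
  shows "open (inside (cycle_curve k))" "frontier (inside (cycle_curve k)) = cycle_curve k"
    "K \<subseteq> inside (cycle_curve k) \<Longrightarrow> inside K \<subseteq> inside (cycle_curve k)"
proof -
  obtain c where c: "simple_path c" "pathfinish c = pathstart c" "path_image c = cycle_curve k"
    using cycle_Jordan[OF cyc[OF assms]] by blast
  show "open (inside (cycle_curve k))" "frontier (inside (cycle_curve k)) = cycle_curve k"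
    using Jordan_inside_outside[OF c(1,2)] c(3) by simp_all
  show "K \<subseteq> inside (cycle_curve k) \<Longrightarrow> inside K \<subseteq> inside (cycle_curve k)"
    using inside_mono_Jordan[OF c(1,2)] c(3) by simp
qed

lemma cycle_curve_nested:
  assumes "k \<le> m" "m \<le> x"
  shows "cycle_curve k \<union> inside (cycle_curve k) \<subseteq> cycle_curve m \<union> inside (cycle_curve m)"
  using assms
proof (induction m rule: dec_induct)
  case (step m)
  have n: "cycle_curve m \<subseteq> inside (cycle_curve (Suc m))" using nested[of "Suc m"] step by simp
  then have "inside (cycle_curve m) \<subseteq> inside (cycle_curve (Suc m))"
    using cycle_curve_Jordan(3)[of "Suc m"] step by simp
  then show ?case using n step by auto
qed simp

lemma spoke_inside:
  assumes sp: "spoke k u z"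
  shows "path_image (\<gamma> {u, z}) \<subseteq> cycle_curve k \<union> inside (cycle_curve k)"
proof -
  have k: "1 \<le> k" "k \<le> x" and e: "{u, z} \<in> edges G" and uz: "u \<in> set (C k)" "z \<in> set (C (k - 1))"
    using sp by (simp_all add: spoke_def)
  have kx: "k - 1 \<le> x" using k by simp
  define X where "X = path_image (\<gamma> {u, z}) - p ` {u, z}"
  have X: "connected X" "path_image (\<gamma> {u, z}) \<subseteq> closure X" "p z \<in> path_image (\<gamma> {u, z})"
    using edge_interior[OF e] unfolding X_def by auto
  have dj: "X \<inter> cycle_curve k = {}"
    unfolding X_def by (rule edge_interior_disjoint[OF e cycle_sub[OF k(2)] spoke_not_cycle[OF sp k(2)]])
  have pu: "p u \<in> cycle_curve k" by (rule on_cycle_curve[OF k(2) uz(1)])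
  have "p z \<in> cycle_curve (k - 1)" by (rule on_cycle_curve[OF kx uz(2)])
  then have pz: "p z \<in> inside (cycle_curve k)" using nested[OF k] by blast
  then have "X \<inter> inside (cycle_curve k) \<noteq> {}"
    using open_Int_closure_eq_empty[OF cycle_curve_Jordan(1)[OF k(2)], of X] X by blast
  then have "X \<subseteq> inside (cycle_curve k)"
    using connected_Int_frontier[OF X(1), of "inside (cycle_curve k)"] dj cycle_curve_Jordan(2)[OF k(2)] by blast
  then show ?thesis using pu pz unfolding X_def by blast
qed

lemma part_inside:
  assumes "m \<le> x" "e \<in> edges (part m)"
  shows "path_image (\<gamma> e) \<subseteq> cycle_curve m \<union> inside (cycle_curve m)"
proof -
  from assms consider k where "k \<le> m" "e \<in> cycle_edges (C k)" | k u v where "k \<le> m" "spoke k u v" "e = {u, v}"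
    unfolding part_edge_iff[OF assms(1)] by blast
  then show ?thesis
  proof cases
    case 1
    then have "path_image (\<gamma> e) \<subseteq> cycle_curve k" by (auto simp: curve_def)
    then show ?thesis using cycle_curve_nested[OF 1(1) assms(1)] by blast
  next
    case 2
    then show ?thesis using spoke_inside[OF 2(2)] cycle_curve_nested[OF 2(1) assms(1)] by blast
  qed
qed

text \<open>Every vertex lies on an edge of its cycle, so \<open>faces\<close> may be computed from
  the drawn edges alone.\<close>

lemma part_points:
  assumes "j \<le> x"
  shows "p ` verts (part j) \<union> curve \<gamma> (edges (part j)) = curve \<gamma> (edges (part j))"
proof -
  have "p y \<in> curve \<gamma> (edges (part j))" if "y \<in> verts (part j)" for y
  proof -
    from that obtain k where k: "k \<le> j" "y \<in> set (C k)" by (auto simp: part_verts)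
    then have "y \<in> \<Union> (cycle_edges (C k))" using Union_cycle_edges[OF cyc[of k]] assms by simp
    then have "y \<in> \<Union> (edges (part j))" using part_edge_iff[OF assms] k by blast
    moreover have "y \<in> verts G" using k assms cycle_verts[of k y] by simp
    ultimately show ?thesis using curve_vertex_iff[OF part_sub[OF assms]] by blast
  qed
  then show ?thesis by blast
qed

text \<open>The face \<open>F\<close> is the region of the outer annulus of the \<open>j\<close>-annular restriction between two
  consecutive spokes.\<close>

lemma arc_face:
  assumes sp: "spoke j w v" "spoke j w' v'" and "w \<noteq> w'"
    and c: "is_cycle G (w # a @ w' # a0)" "set (w # a @ w' # a0) = set (C j)"
      "cycle_edges (w # a @ w' # a0) = cycle_edges (C j)"
    and no_spoke: "\<And>y z. y \<in> set a \<Longrightarrow> \<not> spoke j y z"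
  shows "\<exists>F\<in>outer_faces G p \<gamma> C j.
    (\<forall>y\<in>set a. \<forall>F'\<in>outer_faces G p \<gamma> C j. p y \<in> frontier F' \<longrightarrow> F' = F) \<and>
    path_image (\<gamma> {w, v}) \<subseteq> frontier F \<and> path_image (\<gamma> {w', v'}) \<subseteq> frontier F \<and>
    (\<forall>y z. spoke j y z \<and> p y \<in> frontier F \<longrightarrow> y = w \<or> y = w') \<and>
    (bounded_by_4_cycle G \<gamma> C j F \<longrightarrow> {v, v'} \<in> cycle_edges (C (j - 1)))"
proof -
  have j: "1 \<le> j" "j \<le> x" "j - 1 \<le> x" using sp by (auto simp: spoke_def)
  obtain b b' where r: "ring G p \<gamma> w a w' (rev a0) v b v' b'" "set (v # b @ v' # b') = set (C (j - 1))"
    "cycle_edges (C (j - 1)) = path_edges (v # b @ [v']) \<union> path_edges (v # b' @ [v'])"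
    "cycle_edges (C j) = path_edges (w # a @ [w']) \<union> path_edges (w # rev a0 @ [w'])"
    using ring_exists[OF sp assms(3) c] by blast
  interpret r: ring G p \<gamma> w a w' "rev a0" v b v' b' by (rule r(1))
  interpret sw: ring G p \<gamma> w "rev a0" w' a v b' v' b by (rule r.swap)
  have st: "set (w # a @ w' # rev a0) = set (C j)" using c(2) by simp
  have O: "cycle_curve j = r.A \<union> r.A'" unfolding r(4) curve_Un ..
  have E: "cycle_curve (j - 1) = r.B \<union> r.B'" unfolding r(3) curve_Un ..
  have Rin: "r.R \<subseteq> inside (r.A \<union> r.A')" using r.union by blast
  have RO: "r.R \<inter> (r.A \<union> r.A') = {}" using Rin r.no_overlap by blast
  have RE: "r.R \<inter> (cycle_curve (j - 1) \<union> inside (cycle_curve (j - 1))) = {}"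
    unfolding E using r.disjoint_regions by blast
  have RS: "r.R \<inter> (r.S \<union> r.S') = {}"
    using inside_no_overlap[of "r.A \<union> (r.S \<union> r.B \<union> r.S')"] by blast
  have R_edge: "r.R \<inter> path_image (\<gamma> e) = {}" if e: "e \<in> edges (part j)" for e
  proof -
    consider "e \<in> cycle_edges (C j)" | "e \<in> edges (part (j - 1))" | u z where "spoke j u z" "e = {u, z}"
    proof -
      from e consider k where "k \<le> j" "e \<in> cycle_edges (C k)" | k u v where "k \<le> j" "spoke k u v" "e = {u, v}"
        unfolding part_edge_iff[OF j(2)] by blast
      then show thesis
      proof cases
        case (1 k)
        show thesis
        proof (cases "k = j")
          case False
          then have "k \<le> j - 1" using 1(1) by simp
          then show thesis using 1(2) that(2) part_edge_iff[OF j(3), of e] by blast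
        qed (use 1 that(1) in blast)
      next
        case (2 k u v)
        show thesis
        proof (cases "k = j")
          case False
          then have "k \<le> j - 1" using 2(1) by simp
          then show thesis using 2(2,3) that(2) part_edge_iff[OF j(3), of e] by blast
        qed (use 2 that(3) in blast)
      qed
    qed
    then show ?thesis
    proof cases
      case 1
      then have "path_image (\<gamma> e) \<subseteq> r.A \<union> r.A'" unfolding O[symmetric] by (auto simp: curve_def)
      then show ?thesis using RO by blast
    next
      case 2
      then show ?thesis using part_inside[OF j(3) 2] RE by blast
    next
      case 3
      show ?thesis
      proof (cases "u = w \<or> u = w'")
        case True
        then have "e = {w, v} \<or> e = {w', v'}" using 3 sp spoke_right_unique by blast
        then show ?thesis using RS by blast
      next
        case False
        \<comment> \<open>No other spoke begins on \<open>a\<close>, so this one runs through the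
          region on the far side, which is \<open>sw.R\<close>.\<close>
        then have X: "path_image (\<gamma> {u, z}) - p ` {u, z} \<subseteq> sw.R"
          using ring_spoke[OF r(1) st r(2) sp 3(1)] no_spoke 3(1) by blast
        have uz: "u \<in> set (C j)" "z \<in> set (C (j - 1))" using 3 by (simp_all add: spoke_def)
        have "p u \<in> cycle_curve j" "p z \<in> cycle_curve (j - 1)"
          using on_cycle_curve[OF j(2) uz(1)] on_cycle_curve[OF j(3) uz(2)] .
        then have "p u \<notin> r.R" "p z \<notin> r.R" using RO RE O by blast+
        then show ?thesis using X r.disjoint_regions(1) unfolding 3(2) by blast
      qed
    qed
  qed
  have Rdis: "r.R \<inter> curve \<gamma> (edges (part j)) = {}" using R_edge by (auto simp: curve_def)
  have eds: "cycle_edges (C j) \<subseteq> edges (part j)" "cycle_edges (C (j - 1)) \<subseteq> edges (part j)"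
    "{w, v} \<in> edges (part j)" "{w', v'} \<in> edges (part j)"
    unfolding subset_iff part_edge_iff[OF j(2)] using sp diff_le_self[of j 1] by blast+
  have Ofr: "r.A \<union> r.A' \<union> r.B \<union> r.B' \<union> r.S \<union> r.S' \<subseteq> curve \<gamma> (edges (part j))"
  proof -
    have "cycle_curve j \<union> cycle_curve (j - 1) \<subseteq> curve \<gamma> (edges (part j))"
      using eds curve_mono by blast
    moreover have "r.S \<subseteq> curve \<gamma> (edges (part j))" "r.S' \<subseteq> curve \<gamma> (edges (part j))"
      using eds(3,4) by (auto simp: curve_def)
    ultimately show ?thesis unfolding O E by blast
  qed
  have face: "r.R \<in> faces p \<gamma> (part j)"
    unfolding faces_def part_points[OF j(2)]
    by (rule component_if_frontier[OF r.region(3,1) Rdis]) (use Ofr in \<open>unfold r.region(4), blast\<close>)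
  have outer: "r.R \<in> outer_faces G p \<gamma> C j"
    unfolding outer_faces_def annulus_def O using face Rin RE by blast
  \<comment> \<open>A face with a boundary point interior to the arc must enter \<open>R\<close>
    near that point; as both are components, they coincide.\<close>
  have uniq: "F = r.R" if y: "y \<in> set a" and F: "F \<in> outer_faces G p \<gamma> C j" "p y \<in> frontier F" for y F
  proof -
    have Fc: "F \<in> components (- curve \<gamma> (edges (part j)))" and Fa: "F \<subseteq> annulus \<gamma> C j"
      using F(1) unfolding outer_faces_def faces_def part_points[OF j(2)] by blast+
    have "closed (curve \<gamma> (edges (part j)))"
      using compact_curve[OF finite_subset[OF part_sub finite_edges] part_sub, OF j(2) j(2)] compact_imp_closed by blast
    then have "open F" using open_components[OF _ Fc] by auto
    have yG: "y \<in> verts G" using y r.vert by auto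
    have "p y \<in> r.A" using vertex_path_curve_iff[OF r.ed(1) _ yG] y by simp
    moreover have "y \<noteq> w" "y \<noteq> w'" using y r.dist by auto
    then have "p y \<noteq> p w" "p y \<noteq> p w'" using inj_onD[OF inj_p, of y] yG r.vert by auto
    moreover have "p y \<in> closure F" using F(2) by (simp add: frontier_def)
    moreover have "F \<subseteq> r.A \<union> r.A' \<union> inside (r.A \<union> r.A')" using Fa unfolding annulus_def O by blast
    moreover have "F \<inter> (r.A \<union> r.A' \<union> r.B \<union> r.B' \<union> r.S \<union> r.S') = {}"
      using in_components_subset[OF Fc] Ofr by blast
    ultimately have "F \<inter> r.R \<noteq> {}" using r.region_unique[of "p y" F] \<open>open F\<close> by blast
    moreover have "r.R \<in> components (- curve \<gamma> (edges (part j)))"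
      using face unfolding faces_def part_points[OF j(2)] .
    ultimately show ?thesis using components_nonoverlap[OF Fc] by blast
  qed
  have fr: "r.S \<subseteq> frontier r.R" "r.S' \<subseteq> frontier r.R" unfolding r.region(4) by blast+
  have ends: "y = w \<or> y = w'" if "spoke j y z" "p y \<in> frontier r.R" for y z
  proof -
    have y: "y \<in> set (C j)" using that by (simp add: spoke_def)
    then have "y \<in> set (w # w' # a @ v # v' # b)"
      using r.vertex_frontier_iff[OF cycle_verts[OF j(2) y]] that by simp
    moreover have "y \<notin> set (v # v' # b)" using y r.dist unfolding st[symmetric] by auto
    ultimately show ?thesis using no_spoke that(1) by auto
  qed
  \<comment> \<open>The vertices \<open>w\<close>, \<open>w'\<close>, \<open>v\<close>,
    \<open>v'\<close> and all of \<open>b\<close> lie on the boundary and survive suppression. The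
    first four already use up the count, so \<open>b\<close> is empty.\<close>
  have four: "{v, v'} \<in> cycle_edges (C (j - 1))" if "bounded_by_4_cycle G \<gamma> C j r.R"
  proof -
    obtain c where c: "is_cycle (part j) c" "frontier r.R = curve \<gamma> (cycle_edges c)"
      "card (set c \<inter> verts (annular_restriction G C j)) = 4"
      using \<open>bounded_by_4_cycle G \<gamma> C j r.R\<close> unfolding bounded_by_4_cycle_def by blast
    have cG: "cycle_edges c \<subseteq> edges G" using c(1) part_sub[OF j(2)] by (auto simp: is_cycle_def)
    have "y \<in> set c" if y: "y \<in> set (w # w' # a @ v # v' # b)" for y
    proof -
      have yG: "y \<in> verts G" using y r.vert by auto
      have "p y \<in> frontier r.R" using r.vertex_frontier_iff[OF yG] y by simp
      then show ?thesis using curve_vertex_iff[OF cG yG] Union_cycle_edges[OF c(1)] c(2) by simp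
    qed
    moreover have "y \<in> verts (annular_restriction G C j)" if y: "y \<in> set (w # w' # v # v' # b)" for y
    proof -
      consider "y = w \<or> y = w'" | "y \<in> set (C (j - 1))" using y unfolding r(2)[symmetric] by auto
      then obtain k where "k \<le> j" "y \<in> set (C k)" "k = j \<Longrightarrow> \<exists>v. spoke j y v"
      proof cases
        case 1
        then show thesis using that[of j] sp by (auto simp: spoke_def)
      next
        case 2
        then show thesis using that[of "j - 1"] j by auto
      qed
      then show ?thesis
        using part_degree[OF j(2), of k y] unfolding annular_restriction_def suppress_def
        by (auto simp: part_verts)
    qed
    ultimately have "set (w # w' # v # v' # b) \<subseteq> set c \<inter> verts (annular_restriction G C j)" by auto
    then have "card (set (w # w' # v # v' # b)) \<le> 4"
      using card_mono[OF finite_Int[OF disjI1[OF List.finite_set]]] c(3) by metis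
    moreover have "distinct (w # w' # v # v' # b)" using r.dist by auto
    then have "card (set (w # w' # v # v' # b)) = length (w # w' # v # v' # b)" by (rule distinct_card)
    ultimately have "b = []" by simp
    then show ?thesis unfolding r(3) by simp
  qed
  show ?thesis
    using outer uniq fr ends four by (intro bexI[of _ r.R]) blast+
qed

end

text \<open>Each edge from a smaller cycle to \<open>C j\<close> ends in an inward vertex. If there
  were at most two of these, deleting them would leave a connected graph containing
  \<open>C 0\<close> and some vertex of \<open>C j\<close>, yet a walk starting on
  \<open>C 0\<close> could never reach \<open>C j\<close>.\<close>

lemma (in annular) three_spokes:
  assumes "vertex_connected 3 G" "1 \<le> j" "j \<le> x"
  shows "card {y \<in> set (C j). \<exists>z. spoke j y z} \<ge> 3"
proof (rule ccontr)
  define T where "T = {y \<in> set (C j). \<exists>z. spoke j y z}"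
  assume "\<not> ?thesis"
  then have "card T < 3" "T \<subseteq> verts G" using cycle_verts[OF assms(3)] unfolding T_def by auto
  then have con: "graph_connected (delete_verts G T)" using assms(1) unfolding vertex_connected_def by blast
  have cd: "card (set (C j)) \<ge> 3" "card (set (C 0)) \<ge> 3"
    using cycle_length[of j] cycle_length[of 0] cycle_distinct[of j] cycle_distinct[of 0] assms distinct_card
    by fastforce+
  have "\<not> set (C j) \<subseteq> T" using cd(1) \<open>card T < 3\<close> card_mono[of T "set (C j)"] unfolding T_def by auto
  then obtain t where t: "t \<in> set (C j)" "t \<notin> T" by blast
  obtain s where s: "s \<in> set (C 0)" using cd(2) by fastforce
  have sT: "s \<notin> T" using s level[of 0 j s] assms unfolding T_def by auto
  have "s \<in> verts G" "t \<in> verts G" using s t cycle_verts assms by blast+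
  then have "(\<lambda>a b. {a, b} \<in> edges (delete_verts G T))\<^sup>*\<^sup>* s t"
    using con s t sT unfolding graph_connected_def by (auto simp: delete_verts_def)
  then have "\<exists>k<j. t \<in> set (C k)"
  proof (induction rule: rtranclp_induct)
    case base
    then show ?case using s assms by (intro exI[of _ 0]) auto
  next
    case (step y z)
    then obtain k where k: "k < j" "y \<in> set (C k)" by blast
    have e: "{y, z} \<in> edges G" "z \<notin> T" using step by (auto simp: delete_verts_def)
    consider l where "l \<le> x" "{y, z} \<in> cycle_edges (C l)" | l u v where "spoke l u v" "{y, z} = {u, v}"
      using edge_cases[OF e(1)] annulus_edges_iff by auto
    then show ?case
    proof cases
      case 1
      then have "y \<in> set (C l)" "z \<in> set (C l)" using cycle_edges_subset by blast+
      then have "l = k" using level[of l k y] k 1 assms by simp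
      then show ?thesis using \<open>z \<in> set (C l)\<close> k by blast
    next
      case 2
      then consider "y = u" "z = v" | "y = v" "z = u" by (auto simp: doubleton_eq_iff)
      then show ?thesis
      proof cases
        case 1
        then have "l = k" "z \<in> set (C (l - 1))" using 2 level[of l k y] k assms by (auto simp: spoke_def)
        then show ?thesis using k by (intro exI[of _ "l - 1"]) auto
      next
        case yz: 2
        have "l - 1 \<le> x" "y \<in> set (C (l - 1))" "z \<in> set (C l)" "1 \<le> l" using 2 yz by (auto simp: spoke_def)
        then have "l - 1 = k" using level[of "l - 1" k y] k assms by simp
        moreover have "l \<noteq> j"
          using 2 yz e(2) \<open>z \<in> set (C l)\<close> unfolding T_def by blast
        ultimately show ?thesis using \<open>z \<in> set (C l)\<close> \<open>1 \<le> l\<close> k by (intro exI[of _ l]) auto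
      qed
    qed
  qed
  then show False using t level[of j _ t] assms by (metis less_irrefl less_le_trans nat_less_le le_trans)
qed


section \<open>Cyclic arrangements\<close>

text \<open>The injectivity of \<open>f\<close> makes the replaced edges distinct, so the detours do not interfere.\<close>

lemma cycle_insert_paths:
  assumes "is_cycle G H" "distinct (concat Ss)" "set (concat Ss) \<inter> set H = {}"
    and "inj_on f (\<Union>S\<in>set Ss. {hd S, last S})"
    and "\<And>S. S \<in> set Ss \<Longrightarrow> length S \<ge> 2 \<and> path_edges S \<subseteq> edges G \<and> {f (hd S), hd S} \<in> edges G \<and>
           {last S, f (last S)} \<in> edges G \<and> {f (hd S), f (last S)} \<in> cycle_edges H"
  shows "\<exists>H'. is_cycle G H' \<and> set H' = set H \<union> set (concat Ss) \<and>
           cycle_edges H - (\<lambda>S. {f (hd S), f (last S)}) ` set Ss \<union> (\<Union>S\<in>set Ss. path_edges S)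
             \<subseteq> cycle_edges H'"
  using assms
proof (induction Ss arbitrary: H)
  case (Cons S Ss)
  have S: "length S \<ge> 2" "path_edges S \<subseteq> edges G" "{f (hd S), hd S} \<in> edges G"
    "{last S, f (last S)} \<in> edges G" "{f (hd S), f (last S)} \<in> cycle_edges H"
    using Cons.prems(5)[of S] by simp_all
  have dS: "distinct S" using Cons.prems(2) by auto
  have hl: "hd S \<noteq> last S" "hd S \<in> set S" "last S \<in> set S"
  proof -
    obtain a b t where "S = a # b # t" using S(1) by (cases S; cases "tl S") auto
    then show "hd S \<noteq> last S" "hd S \<in> set S" "last S \<in> set S" using dS by auto
  qed
  have fne: "f (hd S) \<noteq> f (last S)"
    using inj_onD[OF Cons.prems(4), of "hd S" "last S"] hl by auto
  have "S \<noteq> []" using S(1) by auto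
  moreover have SH: "set S \<inter> set H = {}" using Cons.prems(3) by auto
  ultimately obtain H1 where H1: "is_cycle G H1" "set H1 = set H \<union> set S"
    "cycle_edges H - {{f (hd S), f (last S)}} \<union> path_edges S \<subseteq> cycle_edges H1"
    using cycle_detour[OF Cons.prems(1) S(5) fne _ dS _ S(2,3,4)] by blast
  \<comment> \<open>Later detours replace other edges than this one: by injectivity of
    \<open>f\<close>, equal edges would give two disjoint paths a common end.\<close>
  have ne: "{f (hd T), f (last T)} \<noteq> {f (hd S), f (last S)}" if T: "T \<in> set Ss" for T
  proof
    assume "{f (hd T), f (last T)} = {f (hd S), f (last S)}"
    then have eq: "f (hd T) = f (hd S) \<or> f (hd T) = f (last S)" by (auto simp: doubleton_eq_iff)
    have hT: "hd T \<in> set T" using Cons.prems(5)[of T] T by (cases T) simp_all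
    have "set T \<inter> set S = {}" using Cons.prems(2) T by auto
    moreover have "hd T \<in> (\<Union>S\<in>set (S # Ss). {hd S, last S})" "hd S \<in> (\<Union>S\<in>set (S # Ss). {hd S, last S})"
      "last S \<in> (\<Union>S\<in>set (S # Ss). {hd S, last S})"
      using T by auto
    then have "hd T = hd S \<or> hd T = last S"
      using eq inj_onD[OF Cons.prems(4), of "hd T" "hd S"] inj_onD[OF Cons.prems(4), of "hd T" "last S"]
      by metis
    ultimately show False using hT hl by (metis disjoint_iff)
  qed
  have fH: "f (hd T) \<in> set H" "f (last T) \<in> set H" if "T \<in> set (S # Ss)" for T
    using Cons.prems(5)[OF that] cycle_edges_subset[of "{f (hd T), f (last T)}" H] by simp_all
  have "\<exists>H'. is_cycle G H' \<and> set H' = set H1 \<union> set (concat Ss) \<and>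
           cycle_edges H1 - (\<lambda>S. {f (hd S), f (last S)}) ` set Ss \<union> (\<Union>S\<in>set Ss. path_edges S)
             \<subseteq> cycle_edges H'"
  proof (rule Cons.IH[OF H1(1)])
    show "distinct (concat Ss)" using Cons.prems(2) by auto
    show "set (concat Ss) \<inter> set H1 = {}" using Cons.prems(2,3) H1(2) by auto
    show "inj_on f (\<Union>S\<in>set Ss. {hd S, last S})" by (rule inj_on_subset[OF Cons.prems(4)]) auto
    show "length T \<ge> 2 \<and> path_edges T \<subseteq> edges G \<and> {f (hd T), hd T} \<in> edges G \<and>
           {last T, f (last T)} \<in> edges G \<and> {f (hd T), f (last T)} \<in> cycle_edges H1"
      if "T \<in> set Ss" for T
    proof -
      have "{f (hd T), f (last T)} \<in> cycle_edges H1"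
        using Cons.prems(5)[of T] ne[OF that] that H1(3) by auto
      then show ?thesis using Cons.prems(5)[of T] that by simp
    qed
  qed
  then obtain H' where H': "is_cycle G H'" "set H' = set H1 \<union> set (concat Ss)"
     "cycle_edges H1 - (\<lambda>S. {f (hd S), f (last S)}) ` set Ss \<union> (\<Union>S\<in>set Ss. path_edges S)
             \<subseteq> cycle_edges H'" by blast
  \<comment> \<open>The edges of \<open>S\<close> are not removed again, since every removed edge
    has its ends on the old cycle \<open>H\<close>, which \<open>S\<close> avoids.\<close>
  have disj: "path_edges S \<inter> (\<lambda>S. {f (hd S), f (last S)}) ` set Ss = {}" (is ?D)
  proof (rule ccontr)
    assume "\<not> ?D"
    then obtain T where "T \<in> set Ss" "{f (hd T), f (last T)} \<in> path_edges S" by blast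
    then have "f (hd T) \<in> set S" "f (hd T) \<in> set H"
      using path_edges_subset[of "{f (hd T), f (last T)}" S] fH(1)[of T] by simp_all
    then show False using SH by blast
  qed
  have "cycle_edges H - (\<lambda>S. {f (hd S), f (last S)}) ` set (S # Ss) \<union> (\<Union>S\<in>set (S # Ss). path_edges S)
             \<subseteq> cycle_edges H'"
    using H'(3) H1(3) disj unfolding list.set image_insert by blast
  then show ?case using H'(1,2) H1(2) by (intro exI[of _ H']) auto
next
  case Nil
  then show ?case by (intro exI[of _ H]) simp
qed


section \<open>Arcs between consecutive marked vertices of a cyclic list\<close>

text \<open>Normalising a cyclic list by its first entry makes the arc leaving \<open>w\<close>
  depend on \<open>w\<close> and the cyclic order alone. A list without \<open>w\<close> is left as
  it is.\<close>

definition rot_to :: "'a \<Rightarrow> 'a list \<Rightarrow> 'a list" where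
  "rot_to w L = dropWhile (\<lambda>y. y \<noteq> w) L @ takeWhile (\<lambda>y. y \<noteq> w) L"

lemma rot_to_append: "w \<notin> set us \<Longrightarrow> rot_to w (us @ w # vs) = w # vs @ us"
proof -
  assume "w \<notin> set us"
  then have "\<And>y. y \<in> set us \<Longrightarrow> y \<noteq> w" by blast
  then show ?thesis by (simp add: rot_to_def dropWhile_append2 takeWhile_append2)
qed

lemma rot_to_swap:
  assumes "distinct (xs @ ys)" "w \<in> set (xs @ ys)"
  shows "rot_to w (xs @ ys) = rot_to w (ys @ xs)"
proof (cases "w \<in> set xs")
  case True
  then obtain x1 x2 where x: "xs = x1 @ w # x2" by (meson split_list)
  then have "w \<notin> set x1" "w \<notin> set (ys @ x1)" using assms(1) by auto
  then show ?thesis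
    using rot_to_append[of w x1 "x2 @ ys"] rot_to_append[of w "ys @ x1" x2] x by simp
next
  case False
  then obtain y1 y2 where y: "ys = y1 @ w # y2" using assms(2) by (metis Un_iff set_append split_list)
  then have "w \<notin> set y1" "w \<notin> set (xs @ y1)" using assms(1) False by auto
  then show ?thesis
    using rot_to_append[of w y1 "y2 @ xs"] rot_to_append[of w "xs @ y1" y2] y by simp
qed

lemma rot_to_is_rotation:
  obtains xs ys where "L = xs @ ys" "rot_to w L = ys @ xs"
  using that[of "takeWhile (\<lambda>y. y \<noteq> w) L" "dropWhile (\<lambda>y. y \<noteq> w) L"] by (simp add: rot_to_def)

lemma rot_to_hd: "w \<in> set L \<Longrightarrow> \<exists>r. rot_to w L = w # r"
  using rot_to_append by (metis split_list_first)

lemma rot_to_facts: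
  "distinct (rot_to w L) = distinct L" "set (rot_to w L) = set L" "is_cycle G (rot_to w L) = is_cycle G L"
  "cycle_edges (rot_to w L) = cycle_edges L" "length (rot_to w L) = length L"
proof -
  obtain xs ys where "L = xs @ ys" "rot_to w L = ys @ xs" by (rule rot_to_is_rotation)
  then show "distinct (rot_to w L) = distinct L" "set (rot_to w L) = set L"
    "is_cycle G (rot_to w L) = is_cycle G L" "cycle_edges (rot_to w L) = cycle_edges L"
    "length (rot_to w L) = length L"
    using is_cycle_rotate[of G xs ys] cycle_edges_rotate[of xs ys] by auto
qed

lemma rot_to_rot_to:
  assumes "distinct L" "rot_to w L = us @ u # vs"
  shows "rot_to u L = u # vs @ us"
proof -
  obtain xs ys where L: "L = xs @ ys" "rot_to w L = ys @ xs" by (rule rot_to_is_rotation)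
  have "distinct (us @ u # vs)" "set (us @ u # vs) = set L"
    using assms(1) rot_to_facts(1,2)[of w L] unfolding assms(2) by auto
  then have "u \<in> set L" "u \<notin> set us" by auto
  then show ?thesis
    using rot_to_swap[of xs ys u] L assms rot_to_append[of u us vs] by auto
qed

text \<open>The arc leaves \<open>w\<close> in the direction of \<open>L\<close> and stops at the
  next marked vertex. As \<open>w'\<close> comes later in the same rotation, it differs from
  \<open>w\<close> when \<open>L\<close> is distinct; a single marked vertex has no arc.\<close>

definition arc_from :: "('a \<Rightarrow> bool) \<Rightarrow> 'a list \<Rightarrow> 'a \<Rightarrow> 'a list \<Rightarrow> 'a \<Rightarrow> bool" where
  "arc_from P L w a w' \<longleftrightarrow> w \<in> set L \<and> P w \<and> P w' \<and> (\<forall>y\<in>set a. \<not> P y) \<and> (\<exists>r. rot_to w L = w # a @ w' # r)"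

lemma first_split_unique:
  assumes "a @ w # r = b @ u # s" "P w" "P u" "\<forall>y\<in>set a. \<not> P y" "\<forall>y\<in>set b. \<not> P y"
  shows "a = b \<and> w = u \<and> r = s"
proof -
  have "a = takeWhile (\<lambda>y. \<not> P y) (a @ w # r)" "b = takeWhile (\<lambda>y. \<not> P y) (b @ u # s)"
    using assms(2-5) by (simp_all add: takeWhile_append2)
  then have "a = b" using assms(1) by simp
  then show ?thesis using assms(1) by simp
qed

lemma arc_from_unique:
  assumes "arc_from P L w a w'" "arc_from P L w b u"
  shows "a = b \<and> w' = u"
proof -
  obtain r s where "rot_to w L = w # a @ w' # r" "rot_to w L = w # b @ u # s"
    using assms unfolding arc_from_def by blast
  then have "a @ w' # r = b @ u # s" by simp
  moreover have "P w'" "P u" "\<forall>y\<in>set a. \<not> P y" "\<forall>y\<in>set b. \<not> P y"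
    using assms unfolding arc_from_def by blast+
  ultimately show ?thesis using first_split_unique[of a w' r b u s P] by blast
qed

lemma arc_from_exists:
  assumes "distinct L" "w \<in> set L" "P w" "card {y \<in> set L. P y} \<ge> 2"
  obtains a w' where "arc_from P L w a w'"
proof -
  obtain r where r: "rot_to w L = w # r" using rot_to_hd[OF assms(2)] by blast
  have "\<exists>y\<in>set r. P y"
  proof (rule ccontr)
    assume "\<not> ?thesis"
    then have "{y \<in> set L. P y} \<subseteq> {w}" using rot_to_facts(2)[of w L] r by auto
    then show False using card_mono[of "{w}" "{y \<in> set L. P y}"] assms(4) by simp
  qed
  then obtain a w' s where "r = a @ w' # s" "P w'" "\<forall>y\<in>set a. \<not> P y"
    using split_list_first_prop[of r P] by blast
  then show ?thesis using that[of a w'] assms r unfolding arc_from_def by auto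
qed

text \<open>With three marked vertices the arc after \<open>w'\<close> ends before returning to
  \<open>w\<close>. The new end \<open>w''\<close> will distinguish the face over this arc from the
  one over the arc before.\<close>

lemma arc_from_next:
  assumes "distinct L" "card {y \<in> set L. P y} \<ge> 3" "arc_from P L w a w'"
  obtains b w'' where "arc_from P L w' b w''" "w'' \<noteq> w" "w'' \<noteq> w'" "w \<noteq> w'"
proof -
  obtain r where r: "rot_to w L = w # a @ w' # r" using assms(3) unfolding arc_from_def by blast
  have P: "P w" "P w'" "\<forall>y\<in>set a. \<not> P y" using assms(3) unfolding arc_from_def by auto
  have d: "distinct (w # a @ w' # r)" and st: "set (w # a @ w' # r) = set L"
    using rot_to_facts(1,2)[of w L] assms(1) unfolding r by auto
  have "\<exists>y\<in>set r. P y"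
  proof (rule ccontr)
    assume "\<not> ?thesis"
    then have "{y \<in> set L. P y} \<subseteq> {w, w'}" using st P(3) by auto
    then have "card {y \<in> set L. P y} \<le> card {w, w'}" by (intro card_mono) auto
    also have "\<dots> \<le> 2" by (simp add: card_insert_if)
    finally show False using assms(2) by simp
  qed
  then obtain b w'' s where b: "r = b @ w'' # s" "P w''" "\<forall>y\<in>set b. \<not> P y"
    using split_list_first_prop[of r P] by blast
  have "rot_to w' L = w' # r @ (w # a)"
    using rot_to_rot_to[OF assms(1), of w "w # a" w' r] r by simp
  then have "arc_from P L w' b w''" using b P st unfolding arc_from_def by auto
  then show ?thesis using that d b(1) by auto
qed

text \<open>Block arguments work on the linear list obtained by cutting the cycle at
  \<open>z\<close> and repeating \<open>z\<close> at the end; this leads back to cyclic arcs. An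
  empty \<open>post\<close> is the wrap-around, where \<open>w'\<close> is the repeated
  \<open>z\<close>.\<close>

lemma arc_from_split:
  assumes "distinct L" "rot_to z L @ [z] = pre @ w # a @ w' # post" "w \<noteq> w'"
    "P w" "P w'" "\<forall>y\<in>set a. \<not> P y" "z \<in> set L"
  shows "arc_from P L w a w'"
proof (cases post rule: rev_cases)
  case Nil
  have "(pre @ w # a) @ [w'] = pre @ w # a @ w' # post" using Nil by simp
  then have "(pre @ w # a) @ [w'] = rot_to z L @ [z]" unfolding assms(2) .
  then have L: "rot_to z L = pre @ w # a" and z: "z = w'"
    unfolding append1_eq_conv by metis+
  obtain r where "rot_to z L = z # r" using rot_to_hd[OF assms(7)] by blast
  then obtain pre' where "pre = w' # pre'" using L z assms(3) by (cases pre) auto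
  then have "rot_to w L = w # a @ w' # pre'" "w \<in> set L"
    using rot_to_rot_to[OF assms(1) L] L rot_to_facts(2)[of z L] by auto
  then show ?thesis using assms unfolding arc_from_def by blast
next
  case (snoc post' u)
  have "(pre @ w # a @ w' # post') @ [u] = pre @ w # a @ w' # post" using snoc by simp
  then have "(pre @ w # a @ w' # post') @ [u] = rot_to z L @ [z]" unfolding assms(2) .
  then have L: "rot_to z L = pre @ w # a @ w' # post'" unfolding append1_eq_conv by metis
  then have "rot_to w L = w # a @ w' # post' @ pre" "w \<in> set L"
    using rot_to_rot_to[OF assms(1) L] L rot_to_facts(2)[of z L] by auto
  then show ?thesis using assms unfolding arc_from_def by blast
qed

section \<open>Cutting a cyclic list into blocks\<close>

text \<open>The predicate \<open>q\<close> marks the vertices at which an arc in the 4-cycle class begins. An unmarked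
  block is a single vertex and closes the path opened by the marked block before it.\<close>

lemma alternating_blocks:
  assumes "L \<noteq> [] \<Longrightarrow> P (hd L) \<and> q (hd L)" "P z" "q z"
    and "\<And>pre w a w' post. L @ [z] = pre @ w # a @ w' # post \<Longrightarrow> P w \<Longrightarrow> P w' \<Longrightarrow>
      \<forall>y\<in>set a. \<not> P y \<Longrightarrow> (q w \<longleftrightarrow> \<not> q w') \<and> (\<not> q w \<longrightarrow> a = []) \<and> (q w \<longrightarrow> N w w')"
  shows "\<exists>Ss. concat Ss = L \<and>
    (\<forall>S\<in>set Ss. \<exists>w a w'. S = w # a @ [w'] \<and> P w \<and> P w' \<and> N w w')"
  using assms
proof (induction L rule: measure_induct_rule[of length])
  case (less L)
  show ?case
  proof (cases L)
    case Nil
    then show ?thesis by (intro exI[of _ "[]"]) simp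
  next
    case (Cons w rest)
    have Pw: "P w" "q w" using less.prems(1) Cons by auto
    have "\<exists>y\<in>set (rest @ [z]). P y" using less.prems(2) by auto
    then obtain a w' post where a: "rest @ [z] = a @ w' # post" "P w'" "\<forall>y\<in>set a. \<not> P y"
      using split_list_first_prop[of "rest @ [z]" P] by blast
    have s1: "(q w \<longleftrightarrow> \<not> q w')" "q w \<longrightarrow> N w w'"
      using less.prems(4)[of "[]" w a w' post] a Cons Pw by auto
    then have "\<not> q w'" "N w w'" using Pw by auto
    \<comment> \<open>Otherwise \<open>w'\<close> would be the final \<open>z\<close>, which
      satisfies \<open>q\<close>.\<close>
    then have "post \<noteq> []" using a(1) less.prems(3) by (metis append1_eq_conv)
    then obtain post' where p': "post = post' @ [z]" "rest = a @ w' # post'"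
      using a(1) by (cases post rule: rev_cases) auto
    have "\<exists>y\<in>set post. P y" using less.prems(2) p' by auto
    then obtain b u s where b: "post = b @ u # s" "P u" "\<forall>y\<in>set b. \<not> P y"
      using split_list_first_prop[of post P] by blast
    have "(q w' \<longleftrightarrow> \<not> q u) \<and> (\<not> q w' \<longrightarrow> b = [])"
      using less.prems(4)[of "w # a" w' b u s] a b Cons by auto
    \<comment> \<open>The unmarked block at \<open>w'\<close> adds nothing, so the remaining list
      begins with \<open>u\<close>, again a marked start, or is empty when \<open>u\<close> is the
      final \<open>z\<close>.\<close>
    then have "q u" "b = []" using \<open>\<not> q w'\<close> by auto
    then have hd: "P (hd post') \<and> q (hd post')" if "post' \<noteq> []"
      using that b p' by (cases post') auto
    have "\<exists>Ss. concat Ss = post' \<and>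
      (\<forall>S\<in>set Ss. \<exists>w a w'. S = w # a @ [w'] \<and> P w \<and> P w' \<and> N w w')"
    proof (rule less.IH)
      show "length post' < length L" using Cons p' by simp
      show "P (hd post') \<and> q (hd post')" if "post' \<noteq> []" using hd that by blast
      show "P z" "q z" using less.prems by auto
      fix pre v c v' r assume h: "post' @ [z] = pre @ v # c @ v' # r" "P v" "P v'" "\<forall>y\<in>set c. \<not> P y"
      have "L @ [z] = (w # a @ w' # pre) @ v # c @ v' # r" using Cons p' h(1) by simp
      then show "(q v \<longleftrightarrow> \<not> q v') \<and> (\<not> q v \<longrightarrow> c = []) \<and> (q v \<longrightarrow> N v v')"
        using less.prems(4) h(2-4) by blast
    qed
    then obtain Ss where "concat Ss = post'"
      "\<forall>S\<in>set Ss. \<exists>w a w'. S = w # a @ [w'] \<and> P w \<and> P w' \<and> N w w'" by blast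
    then show ?thesis
      using Cons p' Pw a(2) \<open>N w w'\<close> by (intro exI[of _ "(w # a @ [w']) # Ss"]) auto
  qed
qed

text \<open>An edge running from one block to the next contains the last vertex of a block, which
  satisfies \<open>P\<close>. So an edge between two vertices violating \<open>P\<close> is never
  cut.\<close>

lemma concat_path_edges:
  assumes "\<forall>S\<in>set Ss. \<exists>w a w'. S = w # a @ [w'] \<and> P w'" "e \<in> path_edges (concat Ss @ [z])"
    "\<forall>y\<in>e. \<not> P y" "P z"
  shows "\<exists>S\<in>set Ss. e \<in> path_edges S"
  using assms
proof (induction Ss)
  case (Cons S Ss)
  obtain w a w' where S: "S = w # a @ [w']" "P w'" using Cons.prems(1) by auto
  obtain t T where T: "concat Ss @ [z] = t # T" by (cases "concat Ss @ [z]") auto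
  have "path_edges (concat (S # Ss) @ [z]) = path_edges S \<union> insert {w', t} (path_edges (t # T))"
    using path_edges_append[of "w # a" w' "t # T"] S T by simp
  then consider "e \<in> path_edges S" | "e = {w', t}" | "e \<in> path_edges (concat Ss @ [z])"
    using Cons.prems(2) T by auto
  then show ?case
  proof cases
    case 3
    then show ?thesis using Cons by auto
  qed (use Cons.prems S in auto)
qed simp

lemma even_path_pairs:
  assumes "even (length a)"
  shows "\<exists>ps. concat (map (\<lambda>(y, z). [y, z]) ps) = a \<and> (\<forall>(y, z)\<in>set ps. {y, z} \<in> path_edges a)"
  using assms
proof (induction a rule: induct_list012)
  case (3 y z r)
  then obtain ps where ps: "concat (map (\<lambda>(y, z). [y, z]) ps) = r" "\<forall>(y, z)\<in>set ps. {y, z} \<in> path_edges r"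
    by auto
  have "path_edges r \<subseteq> path_edges (y # z # r)" by (cases r) auto
  then show ?case using ps by (intro exI[of _ "(y, z) # ps"]) auto
qed (auto intro: exI[of _ "[]"])

lemma path_edges_infix: "path_edges a \<subseteq> path_edges (xs @ a @ ys)"
proof -
  have "path_edges a \<subseteq> path_edges (a @ ys)" for a ys :: "'a list"
    by (induction a rule: induct_list012) auto
  moreover have "path_edges b \<subseteq> path_edges (xs @ b)" for b
    using \<open>\<And>ys a. path_edges a \<subseteq> path_edges (a @ ys)\<close>[of "rev b" "rev xs"] path_edges_rev[of "xs @ b"]
      path_edges_rev[of b] by simp
  ultimately show ?thesis by blast
qed

text \<open>Each run of vertices violating \<open>P\<close> has even length and is paired off along
  its own edges, so no pair reaches across a vertex satisfying \<open>P\<close>.\<close>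

lemma even_blocks:
  assumes "L \<noteq> [] \<Longrightarrow> P (hd L)" "P z"
    and "\<And>pre w a w' post. L @ [z] = pre @ w # a @ w' # post \<Longrightarrow> P w \<Longrightarrow> P w' \<Longrightarrow>
      \<forall>y\<in>set a. \<not> P y \<Longrightarrow> even (length a)"
  shows "\<exists>ps. concat (map (\<lambda>(y, z). [y, z]) ps) = filter (\<lambda>y. \<not> P y) L \<and>
    (\<forall>(u, v)\<in>set ps. {u, v} \<in> path_edges (L @ [z]))"
  using assms
proof (induction L rule: measure_induct_rule[of length])
  case (less L)
  show ?case
  proof (cases L)
    case Nil
    then show ?thesis by (intro exI[of _ "[]"]) simp
  next
    case (Cons w rest)
    have Pw: "P w" using less.prems(1) Cons by auto
    have "\<exists>y\<in>set (rest @ [z]). P y" using less.prems(2) by auto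
    then obtain a w' post where a: "rest @ [z] = a @ w' # post" "P w'" "\<forall>y\<in>set a. \<not> P y"
      using split_list_first_prop[of "rest @ [z]" P] by blast
    have "even (length a)" using less.prems(3)[of "[]" w a w' post] a Cons Pw by auto
    then obtain ps where ps: "concat (map (\<lambda>(y, z). [y, z]) ps) = a" "\<forall>(y, z)\<in>set ps. {y, z} \<in> path_edges a"
      using even_path_pairs by blast
    obtain L' where L': "L' @ [z] = w' # post" "rest = a @ L'"
    proof (cases post rule: rev_cases)
      case Nil
      then show thesis using that[of "[]"] a(1) by simp
    next
      case (snoc post' u)
      then show thesis using that[of "w' # post'"] a(1) by simp
    qed
    have "\<exists>ps. concat (map (\<lambda>(y, z). [y, z]) ps) = filter (\<lambda>y. \<not> P y) L' \<and>
      (\<forall>(u, v)\<in>set ps. {u, v} \<in> path_edges (L' @ [z]))"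
    proof (rule less.IH)
      show "length L' < length L" using Cons L' by simp
      show "P (hd L')" if "L' \<noteq> []" using that L'(1) a(2) by (cases L') auto
      show "P z" by (rule less.prems)
      fix pre v c v' r assume h: "L' @ [z] = pre @ v # c @ v' # r" "P v" "P v'" "\<forall>y\<in>set c. \<not> P y"
      have "L @ [z] = (w # a @ pre) @ v # c @ v' # r" using Cons L' h(1) by simp
      then show "even (length c)" using less.prems(3) h(2-4) by blast
    qed
    then obtain qs where qs: "concat (map (\<lambda>(y, z). [y, z]) qs) = filter (\<lambda>y. \<not> P y) L'"
      "\<forall>(u, v)\<in>set qs. {u, v} \<in> path_edges (L' @ [z])" by blast
    have e: "L @ [z] = [w] @ a @ (L' @ [z])" "L @ [z] = (w # a) @ (L' @ [z]) @ []" using Cons L' by auto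
    have "path_edges a \<subseteq> path_edges (L @ [z])" "path_edges (L' @ [z]) \<subseteq> path_edges (L @ [z])"
      using path_edges_infix[of a "[w]" "L' @ [z]"] path_edges_infix[of "L' @ [z]" "w # a" "[]"] e by simp_all
    moreover have "filter (\<lambda>y. \<not> P y) L = a @ filter (\<lambda>y. \<not> P y) L'"
      using Cons L' Pw a(3) by (simp add: filter_id_conv)
    ultimately show ?thesis
      using ps qs by (intro exI[of _ "ps @ qs"]) (simp, blast)
  qed
qed


text \<open>Only \<open>z\<close> occurs twice in the list, as its first and last entry. Equal ends
  would therefore make \<open>a\<close> the whole list except \<open>z\<close>, leaving no second
  vertex satisfying \<open>P\<close>.\<close>

lemma arc_from_split_ne:
  assumes "distinct L" "z \<in> set L" "rot_to z L @ [z] = pre @ w # a @ w' # post"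
    "card {y \<in> set L. P y} \<ge> 2" "\<forall>y\<in>set a. \<not> P y"
  shows "w \<noteq> w'"
proof
  assume ww: "w = w'"
  obtain r where r: "rot_to z L = z # r" using rot_to_hd[OF assms(2)] by blast
  have d: "distinct (z # r)" and st: "set (z # r) = set L"
    using rot_to_facts(1,2)[of z L] assms(1) unfolding r by auto
  have eq: "z # r @ [z] = pre @ w # a @ w # post" using assms(3) r ww by simp
  have cnt: "count_list (z # r @ [z]) w \<ge> 2" unfolding eq by (simp add: count_list_append)
  have "w = z"
  proof (rule ccontr)
    assume "w \<noteq> z"
    then have "count_list r w \<ge> 2" using cnt by (simp add: count_list_append)
    moreover have "distinct r" using d by simp
    then have "count_list r w \<le> 1" by (induction r) (auto simp: count_notin)
    ultimately show False by simp
  qed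
  have "z \<notin> set r" using d by simp
  have "pre = []"
  proof (rule ccontr)
    assume "pre \<noteq> []"
    then obtain pre' where "r @ [z] = pre' @ z # a @ z # post" using eq \<open>w = z\<close> by (cases pre) auto
    then have "count_list (r @ [z]) z \<ge> 2" by (simp add: count_list_append)
    then show False using \<open>z \<notin> set r\<close> by (simp add: count_list_append)
  qed
  then have "r @ [z] = a @ z # post" using eq \<open>w = z\<close> by simp
  moreover have "z \<notin> set a"
  proof (cases post rule: rev_cases)
    case Nil
    then show ?thesis using calculation \<open>z \<notin> set r\<close> by simp
  next
    case (snoc post' u)
    then have "r = a @ z # post'" using calculation by simp
    then show ?thesis using \<open>z \<notin> set r\<close> by simp
  qed
  ultimately have "r = a"
    using \<open>z \<notin> set r\<close> first_split_unique[of r z "[]" a z post "\<lambda>y. y = z"] by blast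
  then have "{y \<in> set L. P y} \<subseteq> {z}" using st assms(5) by auto
  then show False using card_mono[of "{z}" "{y \<in> set L. P y}"] assms(4) by simp
qed

section \<open>Colourings along paths and cycles, and edges kept by suppression\<close>

lemma path_parity:
  assumes "\<And>y z. {y, z} \<in> path_edges vs \<Longrightarrow> c y \<noteq> (c z :: bool)" "vs \<noteq> []"
  shows "c (hd vs) = c (last vs) \<longleftrightarrow> odd (length vs)"
  using assms
proof (induction vs rule: induct_list012)
  case (3 y z r)
  have "c z = c (last (z # r)) \<longleftrightarrow> odd (length (z # r))"
    using "3.IH"(2) "3.prems"(1) by simp
  moreover have "c y \<noteq> c z" using "3.prems"(1)[of y z] by simp
  ultimately show ?case by auto
qed auto

lemma path_constant:
  assumes "\<And>y z. {y, z} \<in> path_edges vs \<Longrightarrow> f y = f z" "y \<in> set vs"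
  shows "f y = f (hd vs)"
  using assms
proof (induction vs rule: induct_list012)
  case (3 u z r)
  then have "f u = f z" by simp
  moreover have "f y = f z" if "y \<in> set (z # r)" using "3.IH"(2) "3.prems" that by simp
  ultimately show ?case using "3.prems"(2) by auto
qed auto

lemma cycle_constant:
  assumes "\<And>y z. {y, z} \<in> cycle_edges c \<Longrightarrow> f y = f z" "y \<in> set c" "z \<in> set c"
  shows "f y = f z"
proof -
  obtain a xs where c: "c = a # xs" using assms(2) by (cases c) auto
  have "f y = f a" if "y \<in> set c" for y
    using path_constant[of "a # xs @ [a]" f y] assms(1) that unfolding c cycle_edges_Cons by auto
  then show ?thesis using assms(2,3) by simp
qed

lemma edge_in_suppress:
  assumes "{y, z} \<in> edges H" "y \<noteq> z" "y \<in> verts H" "z \<in> verts H" "degree H y \<noteq> 2" "degree H z \<noteq> 2"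
  shows "{y, z} \<in> edges (suppress H)"
proof -
  have "suppressible_path H [y, z]" using assms by (simp add: suppressible_path_def)
  then show ?thesis unfolding suppress_def by force
qed

lemma bipartite_colouring:
  assumes "bipartite H"
  obtains c :: "'a \<Rightarrow> bool" where "\<And>y z. {y, z} \<in> edges H \<Longrightarrow> c y \<noteq> c z"
proof -
  obtain A B where AB: "A \<inter> B = {}" "\<forall>e\<in>edges H. \<exists>a\<in>A. \<exists>b\<in>B. e = {a, b}"
    using assms unfolding bipartite_def by blast
  have "(y \<in> A) \<noteq> (z \<in> A)" if e: "{y, z} \<in> edges H" for y z
  proof -
    obtain a b where "a \<in> A" "b \<in> B" "{y, z} = {a, b}" using AB(2) e by blast
    then have "y = a \<and> z = b \<or> y = b \<and> z = a" by (simp add: doubleton_eq_iff)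
    then show ?thesis using AB(1) \<open>a \<in> A\<close> \<open>b \<in> B\<close> by blast
  qed
  then show ?thesis by (rule that)
qed

section \<open>Detours through the annuli\<close>

locale barnette_annular = annular +
  assumes barnette: "barnette G"
begin

abbreviation inward :: "nat \<Rightarrow> 'a \<Rightarrow> bool" where
  "inward j y \<equiv> \<exists>v. spoke j y v"

text \<open>The second condition allows this cycle to be extended along the next annulus: all edges of
  \<open>C j\<close> between two outward vertices are available for detours.\<close>

definition spanned :: "nat \<Rightarrow> bool" where
  "spanned j \<longleftrightarrow> (\<exists>H. is_cycle G H \<and> set H = (\<Union>k\<in>{0..j}. set (C k)) \<and>
     (\<forall>e\<in>cycle_edges (C j). (\<forall>y\<in>e. \<exists>u. spoke (Suc j) u y) \<longrightarrow> e \<in> cycle_edges H))"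

text \<open>The edge between the inner neighbours \<open>v\<close> and \<open>v'\<close> is the one
  that a detour through a path from \<open>w\<close> to \<open>w'\<close> replaces.\<close>

definition neighbours :: "nat \<Rightarrow> 'a \<Rightarrow> 'a \<Rightarrow> bool" where
  "neighbours j w w' \<longleftrightarrow> (\<exists>v v'. spoke j w v \<and> spoke j w' v' \<and> {v, v'} \<in> cycle_edges (C (j - 1)))"

text \<open>The paths need not be listed in cyclic order. The last clause is what restores
  \<open>spanned\<close> for the next annulus: edges of \<open>C j\<close> between two outward
  vertices remain inside the paths.\<close>

definition segmented :: "nat \<Rightarrow> 'a list list \<Rightarrow> bool" where
  "segmented j Ss \<longleftrightarrow> distinct (concat Ss) \<and> set (concat Ss) = set (C j) \<and>
     (\<forall>S\<in>set Ss. length S \<ge> 2 \<and> path_edges S \<subseteq> edges G \<and> neighbours j (hd S) (last S)) \<and>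
     (\<forall>e\<in>cycle_edges (C j). (\<forall>y\<in>e. \<not> inward j y) \<longrightarrow> (\<exists>S\<in>set Ss. e \<in> path_edges S))"

lemma spanned_0: "spanned 0"
  unfolding spanned_def using cyc[of 0] by (intro exI[of _ "C 0"]) auto

text \<open>The inner neighbours of the two ends of a path are outward vertices of
  \<open>C (j - 1)\<close> joined by an edge of that cycle, so \<open>spanned (j - 1)\<close> puts
  this edge on the current cycle, where it can be replaced.\<close>

lemma spanned_step:
  assumes j: "1 \<le> j" "j \<le> x" and "spanned (j - 1)" "segmented j Ss"
  shows "spanned j"
proof -
  obtain H where H: "is_cycle G H" "set H = (\<Union>k\<in>{0..j - 1}. set (C k))"
    "\<And>e. e \<in> cycle_edges (C (j - 1)) \<Longrightarrow> \<forall>y\<in>e. \<exists>u. spoke (Suc (j - 1)) u y \<Longrightarrow> e \<in> cycle_edges H"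
    using assms(3) unfolding spanned_def by blast
  have seg: "distinct (concat Ss)" "set (concat Ss) = set (C j)"
    "\<And>S. S \<in> set Ss \<Longrightarrow> length S \<ge> 2 \<and> path_edges S \<subseteq> edges G \<and> neighbours j (hd S) (last S)"
    "\<And>e. e \<in> cycle_edges (C j) \<Longrightarrow> \<forall>y\<in>e. \<not> inward j y \<Longrightarrow> \<exists>S\<in>set Ss. e \<in> path_edges S"
    using assms(4) unfolding segmented_def by blast+
  \<comment> \<open>On inward vertices of \<open>C j\<close> this is the unique inner neighbour; it
    is injective there because spokes do not share inner ends.\<close>
  define f where "f u = (SOME v. spoke j u v)" for u
  have f: "f u = v" if "spoke j u v" for u v
    using someI[of "spoke j u" v] spoke_right_unique that unfolding f_def by blast
  have Sj: "Suc (j - 1) = j" using j by simp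
  have nb: "spoke j (hd S) (f (hd S))" "spoke j (last S) (f (last S))"
    "{f (hd S), f (last S)} \<in> cycle_edges H" if S: "S \<in> set Ss" for S
  proof -
    obtain v v' where v: "spoke j (hd S) v" "spoke j (last S) v'" "{v, v'} \<in> cycle_edges (C (j - 1))"
      using seg(3)[OF S] unfolding neighbours_def by blast
    then have "{v, v'} \<in> cycle_edges H" using H(3)[of "{v, v'}"] unfolding Sj by blast
    then show "spoke j (hd S) (f (hd S))" "spoke j (last S) (f (last S))"
      "{f (hd S), f (last S)} \<in> cycle_edges H" using v f by auto
  qed
  have "\<exists>H'. is_cycle G H' \<and> set H' = set H \<union> set (concat Ss) \<and>
           cycle_edges H - (\<lambda>S. {f (hd S), f (last S)}) ` set Ss \<union> (\<Union>S\<in>set Ss. path_edges S)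
             \<subseteq> cycle_edges H'"
  proof (rule cycle_insert_paths[OF H(1) seg(1)])
    have "set (C j) \<inter> set (C k) = {}" if "k \<le> j - 1" for k
      using disjoint_cycles[of j k] that j by auto
    then show "set (concat Ss) \<inter> set H = {}" unfolding seg(2) H(2) by fastforce
    show "inj_on f (\<Union>S\<in>set Ss. {hd S, last S})"
    proof (rule inj_onI)
      fix y z assume yz: "y \<in> (\<Union>S\<in>set Ss. {hd S, last S})" "z \<in> (\<Union>S\<in>set Ss. {hd S, last S})" "f y = f z"
      have "spoke j y (f y)" using yz(1) nb(1,2) by auto
      moreover have "spoke j z (f z)" using yz(2) nb(1,2) by auto
      ultimately show "y = z" using spoke_left_unique yz(3) by metis
    qed
    show "length S \<ge> 2 \<and> path_edges S \<subseteq> edges G \<and> {f (hd S), hd S} \<in> edges G \<and>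
           {last S, f (last S)} \<in> edges G \<and> {f (hd S), f (last S)} \<in> cycle_edges H" if "S \<in> set Ss" for S
      using seg(3)[OF that] nb[OF that] by (simp add: spoke_def insert_commute)
  qed
  then obtain H' where H': "is_cycle G H'" "set H' = set H \<union> set (C j)"
    "(\<Union>S\<in>set Ss. path_edges S) \<subseteq> cycle_edges H'"
    unfolding seg(2) by blast
  have "{0..j} = insert j {0..j - 1}" using j by auto
  then have "set H' = (\<Union>k\<in>{0..j}. set (C k))" using H'(2) H(2) by auto
  moreover have "e \<in> cycle_edges H'" if "e \<in> cycle_edges (C j)" "\<forall>y\<in>e. \<exists>u. spoke (Suc j) u y" for e
  proof -
    have "\<forall>y\<in>e. \<not> inward j y" using that(2) not_in_and_out by blast
    then obtain S where "S \<in> set Ss" "e \<in> path_edges S" using seg(4)[OF \<open>e \<in> cycle_edges (C j)\<close>] by blast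
    then show ?thesis using H'(3) by blast
  qed
  ultimately show ?thesis unfolding spanned_def using H'(1) by blast
qed

lemma spanned_hamiltonian: "spanned x \<Longrightarrow> hamiltonian G"
  unfolding spanned_def hamiltonian_def verts_eq by blast

lemma card_inward: "1 \<le> j \<Longrightarrow> j \<le> x \<Longrightarrow> card {y \<in> set (C j). inward j y} \<ge> 3"
  using three_spokes barnette unfolding barnette_def by blast

section \<open>The face over the arc between consecutive inward vertices\<close>

text \<open>Collects what the combinatorial argument needs from \<open>arc_face\<close>. Uniqueness
  at the interior vertices of the arc identifies the face to which an outward spoke is attached; the
  spokes on the frontier give adjacency of consecutive faces; the clause on inward vertices of the
  frontier tells these faces apart.\<close>

definition arc_bounds :: "nat \<Rightarrow> 'a \<Rightarrow> 'a list \<Rightarrow> 'a \<Rightarrow> complex set \<Rightarrow> bool" where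
  "arc_bounds j w a w' F \<longleftrightarrow> F \<in> outer_faces G p \<gamma> C j \<and>
    (\<forall>y\<in>set a. \<forall>F'\<in>outer_faces G p \<gamma> C j. p y \<in> frontier F' \<longrightarrow> F' = F) \<and>
    (\<forall>v. spoke j w v \<longrightarrow> path_image (\<gamma> {w, v}) \<subseteq> frontier F) \<and>
    (\<forall>v. spoke j w' v \<longrightarrow> path_image (\<gamma> {w', v}) \<subseteq> frontier F) \<and>
    (\<forall>y z. spoke j y z \<and> p y \<in> frontier F \<longrightarrow> y = w \<or> y = w') \<and>
    (bounded_by_4_cycle G \<gamma> C j F \<longrightarrow> neighbours j w w')"

lemma arc_boundsD:
  assumes "arc_bounds j w a w' F"
  shows "F \<in> outer_faces G p \<gamma> C j"
    "y \<in> set a \<Longrightarrow> F' \<in> outer_faces G p \<gamma> C j \<Longrightarrow> p y \<in> frontier F' \<Longrightarrow> F' = F"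
    "spoke j w v \<Longrightarrow> path_image (\<gamma> {w, v}) \<subseteq> frontier F"
    "spoke j w' v \<Longrightarrow> path_image (\<gamma> {w', v}) \<subseteq> frontier F"
    "spoke j y z \<Longrightarrow> p y \<in> frontier F \<Longrightarrow> y = w \<or> y = w'"
    "bounded_by_4_cycle G \<gamma> C j F \<Longrightarrow> neighbours j w w'"
  using assms unfolding arc_bounds_def by ((simp; fail) | blast)+

lemma arc_bounds_exists:
  assumes j: "1 \<le> j" "j \<le> x" and arc: "arc_from (inward j) (C j) w a w'"
  shows "\<exists>F. arc_bounds j w a w' F"
proof -
  obtain v v' where sp: "spoke j w v" "spoke j w' v'" using arc unfolding arc_from_def by blast
  obtain r where r: "rot_to w (C j) = w # a @ w' # r" using arc unfolding arc_from_def by blast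
  have ne: "w \<noteq> w'"
    using arc_from_next[OF cycle_distinct[OF j(2)] card_inward[OF j] arc] by metis
  have no: "\<not> spoke j y z" if "y \<in> set a" for y z
    using arc that unfolding arc_from_def by blast
  have c: "is_cycle G (w # a @ w' # r)" "set (w # a @ w' # r) = set (C j)"
    "cycle_edges (w # a @ w' # r) = cycle_edges (C j)"
    using rot_to_facts(2,4)[of w "C j"] rot_to_facts(3)[of G w "C j"] cyc[OF j(2)] unfolding r by simp_all
  obtain F where F: "F \<in> outer_faces G p \<gamma> C j"
    "\<forall>y\<in>set a. \<forall>F'\<in>outer_faces G p \<gamma> C j. p y \<in> frontier F' \<longrightarrow> F' = F"
    "path_image (\<gamma> {w, v}) \<subseteq> frontier F" "path_image (\<gamma> {w', v'}) \<subseteq> frontier F"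
    "\<forall>y z. spoke j y z \<and> p y \<in> frontier F \<longrightarrow> y = w \<or> y = w'"
    "bounded_by_4_cycle G \<gamma> C j F \<longrightarrow> {v, v'} \<in> cycle_edges (C (j - 1))"
    using arc_face[OF sp ne c no] by blast
  have "arc_bounds j w a w' F"
    unfolding arc_bounds_def
  proof (intro conjI allI impI)
    show "path_image (\<gamma> {w, u}) \<subseteq> frontier F" if "spoke j w u" for u
      using F(3) spoke_right_unique[OF that sp(1)] by simp
    show "path_image (\<gamma> {w', u}) \<subseteq> frontier F" if "spoke j w' u" for u
      using F(4) spoke_right_unique[OF that sp(2)] by simp
    show "neighbours j w w'" if "bounded_by_4_cycle G \<gamma> C j F"
      unfolding neighbours_def using F(6) that sp by blast
    show "y = w \<or> y = w'" if "spoke j y z \<and> p y \<in> frontier F" for y z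
      using F(5) that by blast
  qed (use F(1,2) in simp_all)
  then show ?thesis by blast
qed

text \<open>The faces before and after \<open>w'\<close> share its spoke. They differ because the
  end \<open>u\<close> of the next arc is on the frontier of \<open>F'\<close>, whereas the frontier
  of \<open>F\<close> has no inward vertices of \<open>C j\<close> besides \<open>w\<close> and
  \<open>w'\<close>. So they are adjacent, and adjacent faces lie in different classes.\<close>

lemma arc_bounds_alternate:
  assumes j: "1 \<le> j" "j \<le> x" and Q: "alternating_class G p \<gamma> C j Q"
    and arc: "arc_from (inward j) (C j) w a w'" and F: "arc_bounds j w a w' F"
    and F': "\<And>b u. arc_from (inward j) (C j) w' b u \<Longrightarrow> arc_bounds j w' b u F'"
  shows "F \<in> Q \<longleftrightarrow> F' \<notin> Q"
proof -
  obtain b u where b: "arc_from (inward j) (C j) w' b u" "u \<noteq> w" "u \<noteq> w'"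
    using arc_from_next[OF cycle_distinct[OF j(2)] card_inward[OF j] arc] by metis
  obtain v v'' where sp: "spoke j w' v" "spoke j u v''" using b(1) unfolding arc_from_def by blast
  have S: "path_image (\<gamma> {w', v}) \<subseteq> frontier F" "path_image (\<gamma> {w', v}) \<subseteq> frontier F'"
    using arc_boundsD(4)[OF F sp(1)] arc_boundsD(3)[OF F'[OF b(1)] sp(1)] .
  have "path_image (\<gamma> {u, v''}) \<subseteq> frontier F'" using arc_boundsD(4)[OF F'[OF b(1)] sp(2)] .
  moreover have "p u \<in> path_image (\<gamma> {u, v''})"
    using edge_interior(4)[of "{u, v''}"] sp(2) by (simp add: spoke_def)
  ultimately have "p u \<in> frontier F'" by blast
  then have "F \<noteq> F'" using arc_boundsD(5)[OF F sp(2)] b(2,3) by blast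
  moreover have "{w', v} \<in> annulus_edges G C j" using annulus_edges_iff[OF j] sp(1) by blast
  ultimately have "adjacent_outer_faces G \<gamma> C j F F'"
    unfolding adjacent_outer_faces_def using S by blast
  moreover have "F \<in> outer_faces G p \<gamma> C j" "F' \<in> outer_faces G p \<gamma> C j"
    using arc_boundsD(1)[OF F] arc_boundsD(1)[OF F'[OF b(1)]] .
  moreover have "\<forall>F\<in>Q. \<forall>F'\<in>Q. \<not> adjacent_outer_faces G \<gamma> C j F F'"
    "\<forall>F\<in>outer_faces G p \<gamma> C j - Q. \<forall>F'\<in>outer_faces G p \<gamma> C j - Q. \<not> adjacent_outer_faces G \<gamma> C j F F'"
    using Q unfolding alternating_class_def by simp_all
  ultimately show ?thesis by blast
qed

text \<open>The endpoint in the definition of \<open>attached\<close> is on \<open>C j\<close>, so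
  it is \<open>y\<close>, and it lies on a path drawn within the frontier of
  \<open>F\<close>.\<close>

lemma attached_frontier:
  assumes sp: "spoke (Suc j) t y" and at: "attached G p \<gamma> C (Suc j) {t, y} F"
  shows "F \<in> outer_faces G p \<gamma> C j" "p y \<in> frontier F"
proof -
  have jx: "Suc j \<le> x" "t \<in> set (C (Suc j))" "y \<in> set (C j)" using sp by (simp_all add: spoke_def)
  obtain u vs where u: "u \<in> {t, y} \<inter> set (C j)" "suppressible_path (part j) vs"
    "path_edges vs \<subseteq> cycle_edges (C j)" "u \<in> set vs" "path_curve vs \<subseteq> frontier F"
    and F: "F \<in> outer_faces G p \<gamma> C j"
    using at unfolding attached_def by auto
  show "F \<in> outer_faces G p \<gamma> C j" by (rule F)
  have "t \<notin> set (C j)" using level[of j "Suc j" t] jx by auto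
  then have uy: "u = y" using u(1) by blast
  have "path_edges vs \<subseteq> edges G" using u(3) cycle_sub[of j] jx by auto
  moreover have "length vs \<ge> 2" using u(2) by (simp add: suppressible_path_def)
  ultimately have "p y \<in> path_curve vs"
    using vertex_path_curve_iff[of vs y] u(4) uy cycle_verts[of j y] jx by simp
  then show "p y \<in> frontier F" using u(5) by blast
qed

text \<open>The arc leaving \<open>w\<close> is unique, so its face can be chosen as a function of
  \<open>w\<close> alone; class membership then becomes a predicate on the starting vertices of
  arcs.\<close>

lemma arc_bounds_function:
  assumes j: "1 \<le> j" "j \<le> x"
  obtains Fc where "\<And>w a w'. arc_from (inward j) (C j) w a w' \<Longrightarrow> arc_bounds j w a w' (Fc w)"
proof -
  have "\<exists>F. \<forall>a w'. arc_from (inward j) (C j) w a w' \<longrightarrow> arc_bounds j w a w' F" for w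
  proof (cases "\<exists>a w'. arc_from (inward j) (C j) w a w'")
    case True
    then obtain a w' where a: "arc_from (inward j) (C j) w a w'" by blast
    then obtain F where "arc_bounds j w a w' F" using arc_bounds_exists[OF j] by blast
    then show ?thesis using arc_from_unique[OF a] by blast
  qed blast
  then show ?thesis using that by metis
qed

lemma arc_in_class:
  assumes j: "1 \<le> j" "j < x" and Q: "alternating_class G p \<gamma> C j Q"
    and Fc: "\<And>w a w'. arc_from (inward j) (C j) w a w' \<Longrightarrow> arc_bounds j w a w' (Fc w)"
  obtains w a w' where "arc_from (inward j) (C j) w a w'" "Fc w \<in> Q"
proof -
  have jx: "j \<le> x" using j by simp
  have d: "distinct (C j)" and cd: "card {y \<in> set (C j). inward j y} \<ge> 3"
    using cycle_distinct card_inward j by auto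
  have "{y \<in> set (C j). inward j y} \<noteq> {}" using cd by (metis card.empty not_numeral_le_zero)
  then obtain w where w: "w \<in> set (C j)" "inward j w" by blast
  obtain a w' where a: "arc_from (inward j) (C j) w a w'"
    using arc_from_exists[of "C j" w "inward j"] d w cd by auto
  obtain b w'' where b: "arc_from (inward j) (C j) w' b w''"
    using arc_from_next[OF d cd a] by metis
  show ?thesis
    using arc_bounds_alternate[OF j(1) jx Q a Fc[OF a] Fc] that a b by blast
qed

lemma arc_interior_outward:
  assumes j: "1 \<le> j" "j < x" and arc: "arc_from (inward j) (C j) w a w'" and y: "y \<in> set a"
  obtains t where "spoke (Suc j) t y" "{t, y} \<in> annulus_edges G C (Suc j)"
proof -
  have "set a \<subseteq> set (C j)" using arc rot_to_facts(2)[of w "C j"] unfolding arc_from_def by auto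
  then have "y \<in> set (C j)" using y by blast
  moreover have "\<not> inward j y" using arc y unfolding arc_from_def by blast
  ultimately obtain t where "spoke (Suc j) t y" using in_or_out[of j y] j by auto
  then show ?thesis using that annulus_edges_iff[of "Suc j" "{t, y}"] j by auto
qed

section \<open>Paths on the cycles below the outermost one\<close>

text \<open>Arcs over faces outside \<open>Q\<close> have no interior vertices. Removing these
  single edges from \<open>C j\<close> leaves the arcs over faces in \<open>Q\<close> as disjoint
  paths covering all vertices, and the 4-cycle property makes the ends of each of them
  \<open>neighbours\<close>.\<close>

lemma segmented_in_class:
  assumes j: "1 \<le> j" "j < x" and Q: "four_cycle_class G p \<gamma> C j Q"
    and att: "\<forall>e\<in>annulus_edges G C (Suc j). \<exists>F\<in>Q. attached G p \<gamma> C (Suc j) e F"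
  shows "\<exists>Ss. segmented j Ss"
proof -
  have jx: "j \<le> x" using j by simp
  have d: "distinct (C j)" and cd: "card {y \<in> set (C j). inward j y} \<ge> 3"
    using cycle_distinct card_inward j by auto
  have al: "alternating_class G p \<gamma> C j Q" and four: "\<And>F. F \<in> Q \<Longrightarrow> bounded_by_4_cycle G \<gamma> C j F"
    using Q unfolding four_cycle_class_def by blast+
  obtain Fc where Fc: "\<And>w a w'. arc_from (inward j) (C j) w a w' \<Longrightarrow> arc_bounds j w a w' (Fc w)"
    using arc_bounds_function[OF j(1) jx] by metis
  obtain w0 a0 u0 where w0: "arc_from (inward j) (C j) w0 a0 u0" "Fc w0 \<in> Q"
    using arc_in_class[OF j al Fc] by metis
  then have w0C: "w0 \<in> set (C j)" "inward j w0" unfolding arc_from_def by blast+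
  define L where "L = rot_to w0 (C j)"
  obtain r where r: "L = w0 # r" using rot_to_hd[OF w0C(1)] unfolding L_def by blast
  have "\<exists>Ss. concat Ss = L \<and>
    (\<forall>S\<in>set Ss. \<exists>w a w'. S = w # a @ [w'] \<and> inward j w \<and> inward j w' \<and> neighbours j w w')"
  proof (rule alternating_blocks[where q = "\<lambda>w. Fc w \<in> Q" and z = w0])
    show "inward j (hd L) \<and> Fc (hd L) \<in> Q" using r w0 w0C by simp
    show "inward j w0" "Fc w0 \<in> Q" using w0 w0C by auto
    fix pre w a w' post assume h: "L @ [w0] = pre @ w # a @ w' # post" "inward j w" "inward j w'"
      "\<forall>y\<in>set a. \<not> inward j y"
    have "w \<noteq> w'"
      using arc_from_split_ne[OF d w0C(1) h(1)[unfolded L_def] _ h(4)] cd by simp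
    then have arc: "arc_from (inward j) (C j) w a w'"
      using arc_from_split[OF d h(1)[unfolded L_def] _ h(2-4) w0C(1)] by blast
    have "(Fc w \<in> Q) \<longleftrightarrow> (Fc w' \<notin> Q)"
      using arc_bounds_alternate[OF j(1) jx al arc Fc[OF arc] Fc] by blast
    \<comment> \<open>An interior vertex would be outward with its spoke attached to a face in
      \<open>Q\<close>, but the only candidate for that face is \<open>Fc w\<close>.\<close>
    moreover have "a = []" if "Fc w \<notin> Q"
    proof (rule ccontr)
      assume "a \<noteq> []"
      then obtain y where y: "y \<in> set a" by (cases a) auto
      obtain t where t: "spoke (Suc j) t y" "{t, y} \<in> annulus_edges G C (Suc j)"
        using arc_interior_outward[OF j arc y] by blast
      then obtain F where F: "F \<in> Q" "attached G p \<gamma> C (Suc j) {t, y} F" using att by blast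
      then have "F = Fc w"
        using arc_boundsD(2)[OF Fc[OF arc] y attached_frontier[OF t(1) F(2)]] by simp
      then show False using F that by blast
    qed
    moreover have "neighbours j w w'" if "Fc w \<in> Q"
      using arc_boundsD(6)[OF Fc[OF arc] four[OF that]] .
    ultimately show "(Fc w \<in> Q \<longleftrightarrow> \<not> Fc w' \<in> Q) \<and> (\<not> Fc w \<in> Q \<longrightarrow> a = []) \<and> (Fc w \<in> Q \<longrightarrow> neighbours j w w')"
      by blast
  qed
  then obtain Ss where Ss: "concat Ss = L"
    "\<And>S. S \<in> set Ss \<Longrightarrow> \<exists>w a w'. S = w # a @ [w'] \<and> inward j w \<and> inward j w' \<and> neighbours j w w'"
    by blast
  have L: "distinct L" "set L = set (C j)" "cycle_edges L = cycle_edges (C j)"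
    using rot_to_facts(1,2,4)[of w0 "C j"] d unfolding L_def by simp_all
  have cL: "cycle_edges L = path_edges (L @ [w0])" unfolding r cycle_edges_Cons by simp
  have "segmented j Ss"
    unfolding segmented_def Ss(1)
  proof (intro conjI ballI impI)
    show "distinct L" "set L = set (C j)" by (rule L)+
    fix S assume S: "S \<in> set Ss"
    obtain w a w' where w: "S = w # a @ [w']" "neighbours j w w'" using Ss(2)[OF S] by blast
    show "length S \<ge> 2" "neighbours j (hd S) (last S)" using w by simp_all
    obtain us vs where "Ss = us @ S # vs" using S by (meson split_list)
    then have "L @ [w0] = concat us @ S @ (concat vs @ [w0])" using Ss(1) by auto
    then have "path_edges S \<subseteq> path_edges (L @ [w0])" using path_edges_infix by metis
    then show "path_edges S \<subseteq> edges G" using cL L(3) cycle_sub[OF jx] by simp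
  next
    fix e assume "e \<in> cycle_edges (C j)" "\<forall>y\<in>e. \<not> inward j y"
    then show "\<exists>S\<in>set Ss. e \<in> path_edges S"
      using concat_path_edges[of Ss "inward j" e w0] Ss w0C(2) cL L(3) by metis
  qed
  then show ?thesis by blast
qed

text \<open>Here the arcs over faces in \<open>Q\<close> are single edges. Removing one of them,
  \<open>{w, w'}\<close>, turns the whole of \<open>C j\<close> into one path from \<open>w'\<close>
  to \<open>w\<close>, whose ends are \<open>neighbours\<close>; the removed edge joins inward
  vertices, so no edge needed later is lost.\<close>

lemma segmented_off_class:
  assumes j: "1 \<le> j" "j < x" and Q: "four_cycle_class G p \<gamma> C j Q"
    and att: "\<forall>e\<in>annulus_edges G C (Suc j). \<exists>F\<in>outer_faces G p \<gamma> C j - Q. attached G p \<gamma> C (Suc j) e F"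
  shows "\<exists>Ss. segmented j Ss"
proof -
  have jx: "j \<le> x" using j by simp
  have d: "distinct (C j)" using cycle_distinct j by auto
  have al: "alternating_class G p \<gamma> C j Q" and four: "\<And>F. F \<in> Q \<Longrightarrow> bounded_by_4_cycle G \<gamma> C j F"
    using Q unfolding four_cycle_class_def by blast+
  obtain Fc where Fc: "\<And>w a w'. arc_from (inward j) (C j) w a w' \<Longrightarrow> arc_bounds j w a w' (Fc w)"
    using arc_bounds_function[OF j(1) jx] by metis
  obtain w a w' where arc: "arc_from (inward j) (C j) w a w'" "Fc w \<in> Q"
    using arc_in_class[OF j al Fc] by metis
  have "a = []"
  proof (rule ccontr)
    assume "a \<noteq> []"
    then obtain y where y: "y \<in> set a" by (cases a) auto
    obtain t where t: "spoke (Suc j) t y" "{t, y} \<in> annulus_edges G C (Suc j)"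
      using arc_interior_outward[OF j arc(1) y] by blast
    then obtain F where F: "F \<notin> Q" "attached G p \<gamma> C (Suc j) {t, y} F" using att by blast
    then have "F = Fc w"
      using arc_boundsD(2)[OF Fc[OF arc(1)] y attached_frontier[OF t(1) F(2)]] by simp
    then show False using F arc(2) by blast
  qed
  then obtain r where r: "rot_to w (C j) = w # w' # r" using arc(1) unfolding arc_from_def by auto
  have L: "distinct (w # w' # r)" "set (w # w' # r) = set (C j)" "cycle_edges (w # w' # r) = cycle_edges (C j)"
    using rot_to_facts(1,2,4)[of w "C j"] d unfolding r by simp_all
  have e: "cycle_edges (C j) = insert {w, w'} (path_edges (w' # r @ [w]))"
    unfolding L(3)[symmetric] cycle_edges_Cons by simp
  have "neighbours j w w'" using arc_boundsD(6)[OF Fc[OF arc(1)] four[OF arc(2)]] .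
  then have nb: "neighbours j w' w" unfolding neighbours_def by (metis insert_commute)
  have "inward j w" using arc(1) unfolding arc_from_def by blast
  then have "segmented j [w' # r @ [w]]"
    unfolding segmented_def using L(1,2) nb cycle_sub[OF jx] e by auto
  then show ?thesis by blast
qed

section \<open>The outermost cycle\<close>

text \<open>On the vertices of degree 3 the two-colourings of \<open>G\<close> and of \<open>suppress (part j)\<close> agree up to
  exchanging the colours, so suppression replaces only paths of odd length.\<close>

lemma arc_even:
  assumes j: "1 \<le> j" "j \<le> x" and bar: "barnette (suppress (part j))"
    and arc: "arc_from (inward j) (C j) w a w'"
  shows "even (length a)"
proof -
  have jx: "j - 1 \<le> x" using j by simp
  obtain c :: "'a \<Rightarrow> bool" where c: "\<And>y z. {y, z} \<in> edges G \<Longrightarrow> c y \<noteq> c z"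
    using bipartite_colouring[of G] barnette unfolding barnette_def by blast
  obtain c' :: "'a \<Rightarrow> bool" where c': "\<And>y z. {y, z} \<in> edges (suppress (part j)) \<Longrightarrow> c' y \<noteq> c' z"
    using bipartite_colouring[of "suppress (part j)"] bar unfolding barnette_def by blast
  define s where "s y \<longleftrightarrow> c y = c' y" for y
  have deg: "y \<in> verts (part j) \<and> degree (part j) y = 3"
    if "y \<in> set (C (j - 1)) \<or> y \<in> set (C j) \<and> inward j y" for y
    using part_degree[OF j(2), of "j - 1" y] part_degree[OF j(2), of j y] that j by (auto simp: part_verts)
  have step: "s y = s z" if "{y, z} \<in> edges (part j)" "y \<in> set (C (j - 1)) \<or> y \<in> set (C j) \<and> inward j y"
    "z \<in> set (C (j - 1)) \<or> z \<in> set (C j) \<and> inward j z" for y z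
  proof -
    have eG: "{y, z} \<in> edges G" using part_sub[OF j(2)] that(1) by blast
    then have "y \<noteq> z" using c by blast
    then have "{y, z} \<in> edges (suppress (part j))"
      using edge_in_suppress[OF that(1)] deg[OF that(2)] deg[OF that(3)] by simp
    then show ?thesis using c[OF eG] c' unfolding s_def by blast
  qed
  \<comment> \<open>Edges between degree-3 vertices survive suppression and switch both colours, so
    agreement of the colourings spreads around \<open>C (j - 1)\<close> and then along the spokes to
    \<open>w\<close> and \<open>w'\<close>.\<close>
  have const: "s y = s z" if "y \<in> set (C (j - 1))" "z \<in> set (C (j - 1))" for y z
  proof (rule cycle_constant[OF _ that])
    fix u v assume uv: "{u, v} \<in> cycle_edges (C (j - 1))"
    then have "{u, v} \<in> edges (part j)" using part_edge_iff[OF j(2)] by (meson diff_le_self)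
    then show "s u = s v" using step[of u v] cycle_edges_subset[OF uv] by blast
  qed
  obtain v v' where sp: "spoke j w v" "spoke j w' v'" using arc unfolding arc_from_def by blast
  have "{w, v} \<in> edges (part j)" "{w', v'} \<in> edges (part j)" using part_edge_iff[OF j(2)] sp by blast+
  then have "s w = s v" "s w' = s v'" using step sp unfolding spoke_def by blast+
  then have sww: "s w = s w'" using const[of v v'] sp by (simp add: spoke_def)
  obtain r where r: "rot_to w (C j) = w # a @ w' # r" using arc unfolding arc_from_def by blast
  have d: "distinct (w # a @ w' # r)" and st: "set (w # a @ w' # r) = set (C j)"
    and ce: "cycle_edges (w # a @ w' # r) = cycle_edges (C j)"
    using rot_to_facts(1,2,4)[of w "C j"] cycle_distinct[OF j(2)] unfolding r by simp_all
  have pe: "path_edges (w # a @ [w']) \<subseteq> cycle_edges (C j)"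
    unfolding ce[symmetric] cycle_edges_Cons_Cons by blast
  have deg2: "degree (part j) y = 2" if y: "y \<in> set a" for y
  proof -
    have yC: "y \<in> set (C j)" using y st by auto
    have ny: "\<not> inward j y" using arc y unfolding arc_from_def by blast
    have "{e \<in> edges (part j). y \<in> e} = {e \<in> cycle_edges (C j). y \<in> e}"
    proof (intro equalityI subsetI)
      fix e assume "e \<in> {e \<in> edges (part j). y \<in> e}"
      then have e: "e \<in> edges (part j)" "y \<in> e" by auto
      then consider k where "k \<le> j" "e \<in> cycle_edges (C k)" | k u v where "k \<le> j" "spoke k u v" "e = {u, v}"
        unfolding part_edge_iff[OF j(2)] by blast
      then show "e \<in> {e \<in> cycle_edges (C j). y \<in> e}"
      proof cases
        case (1 k)
        then have "y \<in> set (C k)" using cycle_edges_subset e(2) by blast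
        then have "k = j" using level[of k j y] 1 j yC by simp
        then show ?thesis using 1 e by simp
      next
        case (2 k u v)
        then consider "y = u" | "y = v" using e(2) by blast
        then show ?thesis
        proof cases
          case 1
          then have "k = j" using level[of k j y] 2 j yC by (simp add: spoke_def)
          then show ?thesis using ny 2 1 by blast
        next
          case y: 2
          then have "k - 1 \<le> x" "y \<in> set (C (k - 1))" "1 \<le> k" using 2 j by (auto simp: spoke_def)
          then have "k - 1 = j" using level[of "k - 1" j y] j yC by simp
          then show ?thesis using 2(1) \<open>1 \<le> k\<close> by simp
        qed
      qed
    next
      fix e assume "e \<in> {e \<in> cycle_edges (C j). y \<in> e}"
      then show "e \<in> {e \<in> edges (part j). y \<in> e}" using part_edge_iff[OF j(2)] by blast
    qed
    then show ?thesis using card_cycle_edges_at[OF cyc[OF j(2)] yC] by (simp add: degree_def)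
  qed
  have wC: "w \<in> set (C j)" "w' \<in> set (C j)" using st by auto
  then have "degree (part j) w = 3" "degree (part j) w' = 3"
    using deg[of w] deg[of w'] sp by blast+
  then have ends: "degree (part j) w \<noteq> 2" "degree (part j) w' \<noteq> 2" by simp_all
  have "suppressible_path (part j) (w # a @ [w'])"
    unfolding suppressible_path_def
  proof (intro conjI ballI)
    show "distinct (w # a @ [w'])" using d by auto
    show "set (w # a @ [w']) \<subseteq> verts (part j)" using st by (auto simp: part_verts)
    show "path_edges (w # a @ [w']) \<subseteq> edges (part j)" using pe part_edge_iff[OF j(2)] by blast
    show "degree (part j) (hd (w # a @ [w'])) \<noteq> 2" "degree (part j) (last (w # a @ [w'])) \<noteq> 2"
      using ends by simp_all
    show "degree (part j) y = 2" if "y \<in> set (butlast (tl (w # a @ [w'])))" for y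
      using that deg2 by simp
  qed simp
  \<comment> \<open>The arc is suppressed to one edge, so \<open>w\<close> and \<open>w'\<close>
    differ under \<open>c'\<close>. As the colourings agree at both or at neither, they differ under
    \<open>c\<close> too, and the arc has an even number of vertices.\<close>
  then have "{hd (w # a @ [w']), last (w # a @ [w'])} \<in> edges (suppress (part j))"
    unfolding suppress_def graph.simps by blast
  then have "c' w \<noteq> c' w'" using c'[of w w'] by simp
  then have "c w \<noteq> c w'" using sww unfolding s_def by blast
  moreover have "c (hd (w # a @ [w'])) = c (last (w # a @ [w'])) \<longleftrightarrow> odd (length (w # a @ [w']))"
    by (rule path_parity) (use pe cycle_sub[OF j(2)] c in blast, simp)
  ultimately show ?thesis by simp
qed

text \<open>All vertices of \<open>C x\<close> are inward, and their spokes match them with the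
  outward vertices of \<open>C (x - 1)\<close>. Those come in adjacent pairs by
  \<open>arc_even\<close>; the outer ends of the two spokes of a pair are adjacent by
  \<open>outer_adjacent\<close>, so \<open>C x\<close> is covered by two-vertex paths.\<close>

lemma segmented_last:
  assumes x: "x \<ge> 2" and bar: "barnette (suppress (part (x - 1)))"
  shows "\<exists>Ss. segmented x Ss"
proof -
  define j where "j = x - 1"
  have j: "1 \<le> j" "j \<le> x" "Suc j = x" "j = x - 1" using x by (auto simp: j_def)
  have d: "distinct (C j)" and cd: "card {y \<in> set (C j). inward j y} \<ge> 3"
    using cycle_distinct card_inward j by auto
  have "{y \<in> set (C j). inward j y} \<noteq> {}" using cd by (metis card.empty not_numeral_le_zero)
  then obtain w0 where w0: "w0 \<in> set (C j)" "inward j w0" by blast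
  define L where "L = rot_to w0 (C j)"
  obtain r where r: "L = w0 # r" using rot_to_hd[OF w0(1)] unfolding L_def by blast
  have L: "distinct L" "set L = set (C j)" "cycle_edges L = cycle_edges (C j)"
    using rot_to_facts(1,2,4)[of w0 "C j"] d unfolding L_def by simp_all
  have cL: "cycle_edges (C j) = path_edges (L @ [w0])" unfolding L(3)[symmetric] r cycle_edges_Cons by simp
  have "\<exists>ps. concat (map (\<lambda>(y, z). [y, z]) ps) = filter (\<lambda>y. \<not> inward j y) L \<and>
    (\<forall>(u, v)\<in>set ps. {u, v} \<in> path_edges (L @ [w0]))"
  proof (rule even_blocks)
    show "inward j (hd L)" "inward j w0" using r w0 by simp_all
    fix pre w a w' post assume h: "L @ [w0] = pre @ w # a @ w' # post" "inward j w" "inward j w'"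
      "\<forall>y\<in>set a. \<not> inward j y"
    have "w \<noteq> w'"
      using arc_from_split_ne[OF d w0(1) h(1)[unfolded L_def] _ h(4)] cd by simp
    then have "arc_from (inward j) (C j) w a w'"
      using arc_from_split[OF d h(1)[unfolded L_def] _ h(2-4) w0(1)] by blast
    then show "even (length a)" using arc_even[OF j(1,2)] bar unfolding j_def by blast
  qed
  then obtain ps where ps: "concat (map (\<lambda>(y, z). [y, z]) ps) = filter (\<lambda>y. \<not> inward j y) L"
    "\<And>u v. (u, v) \<in> set ps \<Longrightarrow> {u, v} \<in> cycle_edges (C j)"
    unfolding cL by blast
  define outs where "outs = filter (\<lambda>y. \<not> inward j y) L"
  define g where "g y = (SOME u. spoke x u y)" for y
  have g: "spoke x (g y) y" if "y \<in> set outs" for y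
  proof -
    have "y \<in> set (C j)" "\<not> inward j y" using that L(2) unfolding outs_def by auto
    then have "\<exists>u. spoke x u y" using in_or_out[of j y] j by auto
    then show ?thesis unfolding g_def by (rule someI_ex)
  qed
  have all: "\<exists>z. spoke x u z" if "u \<in> set (C x)" for u
    using in_or_out[OF _ that] by (auto simp: spoke_def)
  define Ss where "Ss = map (\<lambda>(y, z). [g y, g z]) ps"
  have "concat Ss = map g (concat (map (\<lambda>(y, z). [y, z]) ps))"
    unfolding Ss_def by (induction ps) auto
  then have cc: "concat Ss = map g outs" unfolding ps(1) outs_def .
  have "segmented x Ss"
    unfolding segmented_def cc
  proof (intro conjI ballI impI)
    have "inj_on g (set outs)"
    proof (rule inj_onI)
      fix y z assume "y \<in> set outs" "z \<in> set outs" "g y = g z"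
      then show "y = z" using spoke_right_unique[of x "g y" y z] g by metis
    qed
    then show "distinct (map g outs)" using L(1) by (simp add: distinct_map outs_def)
    show "set (map g outs) = set (C x)"
    proof (intro equalityI subsetI)
      fix u assume "u \<in> set (map g outs)"
      then show "u \<in> set (C x)" using g by (auto simp: spoke_def)
    next
      fix u assume "u \<in> set (C x)"
      then obtain y where y: "spoke x u y" using all by blast
      then have "y \<in> set (C j)" using j by (simp add: spoke_def)
      moreover have "\<not> inward j y" using not_in_and_out[of j y _ u] y j by auto
      ultimately have "y \<in> set outs" using L(2) by (simp add: outs_def)
      moreover have "g y = u" using g[OF \<open>y \<in> set outs\<close>] y spoke_left_unique by blast
      ultimately show "u \<in> set (map g outs)" by auto
    qed
    fix S assume "S \<in> set Ss"
    then obtain y z where yz: "(y, z) \<in> set ps" "S = [g y, g z]" unfolding Ss_def by auto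
    have "{y, z} \<subseteq> set (concat (map (\<lambda>(y, z). [y, z]) ps))" using yz(1) by force
    then have o: "y \<in> set outs" "z \<in> set outs" unfolding ps(1) outs_def by blast+
    have e: "{y, z} \<in> cycle_edges (C (x - 1))" using ps(2)[OF yz(1)] j by simp
    have "y \<noteq> z" using edge_card[of "{y, z}"] e cycle_sub[of j] j by auto
    then have "{g y, g z} \<in> cycle_edges (C x)" using outer_adjacent[OF g[OF o(1)] g[OF o(2)] e] all by blast
    then show "path_edges S \<subseteq> edges G" using yz cycle_sub[of x] by auto
    show "length S \<ge> 2" using yz by simp
    show "neighbours x (hd S) (last S)" unfolding neighbours_def using yz(2) g o e by auto
  next
    fix e assume e: "e \<in> cycle_edges (C x)" "\<forall>y\<in>e. \<not> inward x y"
    then have "card e = 2" using edge_card cycle_sub[of x] by blast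
    then obtain y where "y \<in> e" by fastforce
    \<comment> \<open>This condition is vacuous, since no vertex of \<open>C x\<close> fails to be
      inward.\<close>
    then show "\<exists>S\<in>set Ss. e \<in> path_edges S" using e all cycle_edges_subset by blast
  qed
  then show ?thesis by blast
qed

section \<open>Assembling the Hamiltonian cycle\<close>

lemma hamiltonian_if_segmented:
  assumes x: "x \<ge> 3" and bar: "barnette (suppress (part (x - 1)))"
    and seg: "\<And>j. 1 \<le> j \<Longrightarrow> j < x \<Longrightarrow> \<exists>Ss. segmented j Ss"
  shows "hamiltonian G"
proof -
  have "spanned j" if "j \<le> x" for j
    using that
  proof (induction j)
    case (Suc j)
    obtain Ss where "segmented (Suc j) Ss"
    proof (cases "Suc j = x")
      case True
      then show thesis using segmented_last bar x that by auto
    next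
      case False
      then show thesis using seg[of "Suc j"] Suc.prems that by auto
    qed
    then show ?case using spanned_step[of "Suc j" Ss] Suc by simp
  qed (rule spanned_0)
  then show ?thesis using spanned_hamiltonian by blast
qed

text \<open>A vertex of \<open>C 0\<close> keeps its outward spoke and hence degree 3, whereas a
  closed curve has only vertices of degree 2.\<close>

lemma part_not_closed_curve:
  assumes "1 \<le> j" "j \<le> x"
  shows "\<not> closed_curve (part j)"
proof
  assume "closed_curve (part j)"
  then obtain c where c: "is_cycle (part j) c" "verts (part j) = set c" "edges (part j) = cycle_edges c"
    unfolding closed_curve_def by blast
  obtain y where y: "y \<in> set (C 0)" using cycle_length[of 0] by (cases "C 0") auto
  then have "y \<in> set c" using c(2) by (auto simp: part_verts)
  then have "degree (part j) y = 2" using card_cycle_edges_at[OF c(1)] c(3) by (simp add: degree_def)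
  then show False using part_degree[OF assms(2), of 0 y] y assms(1) by simp
qed

end

theorem theorem3p2:
  fixes G :: "'a graph"
    and p :: "'a \<Rightarrow> complex"
    and \<gamma> :: "'a set \<Rightarrow> real \<Rightarrow> complex"
    and C :: "nat \<Rightarrow> 'a list"
    and x :: nat
  assumes "adb_ac G p \<gamma> C x"
    and "x \<ge> 3"
  shows "((\<forall>k\<in>{2..x}. \<exists>Q. four_cycle_class G p \<gamma> C (k - 1) Q \<and>
             (\<forall>e\<in>annulus_edges G C k. \<exists>F\<in>Q. attached G p \<gamma> C k e F))
          \<longrightarrow> hamiltonian G) \<and>
         ((\<forall>k\<in>{2..x}. \<exists>Q. four_cycle_class G p \<gamma> C (k - 1) Q \<and>
             (\<forall>e\<in>annulus_edges G C k.
                \<exists>F\<in>outer_faces G p \<gamma> C (k - 1) - Q. attached G p \<gamma> C k e F))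
          \<longrightarrow> hamiltonian G)"
proof -
  have bG: "barnette G" and emb: "annular_embedding G p \<gamma> C x"
    using assms(1) unfolding adb_ac_def by blast+
  interpret barnette_annular G p \<gamma> C x
    using bG emb by unfold_locales (simp_all add: barnette_def annular_embedding_def)
  \<comment> \<open>Annular connectedness is taken at \<open>k = x\<close>: it makes the inner part
    \<open>part (x - 1)\<close> a Barnette graph after suppression, or else a closed curve.\<close>
  have "x \<in> {1..x}" using assms(2) by simp
  then have "barnette (suppress (part (x - 1))) \<or> closed_curve (part (x - 1))"
    using assms(1) unfolding adb_ac_def Let_def by blast
  moreover have "\<not> closed_curve (part (x - 1))" using part_not_closed_curve assms(2) by simp
  ultimately have bar: "barnette (suppress (part (x - 1)))" by blast
  show ?thesis
  proof (intro conjI impI)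
    assume h: "\<forall>k\<in>{2..x}. \<exists>Q. four_cycle_class G p \<gamma> C (k - 1) Q \<and>
             (\<forall>e\<in>annulus_edges G C k. \<exists>F\<in>Q. attached G p \<gamma> C k e F)"
    show "hamiltonian G"
    proof (rule hamiltonian_if_segmented[OF assms(2) bar])
      fix j assume j: "1 \<le> j" "j < x"
      then obtain Q where "four_cycle_class G p \<gamma> C j Q"
        "\<forall>e\<in>annulus_edges G C (Suc j). \<exists>F\<in>Q. attached G p \<gamma> C (Suc j) e F"
        using h[rule_format, of "Suc j"] by auto
      then show "\<exists>Ss. segmented j Ss" by (rule segmented_in_class[OF j])
    qed
  next
    assume h: "\<forall>k\<in>{2..x}. \<exists>Q. four_cycle_class G p \<gamma> C (k - 1) Q \<and>
             (\<forall>e\<in>annulus_edges G C k.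
                \<exists>F\<in>outer_faces G p \<gamma> C (k - 1) - Q. attached G p \<gamma> C k e F)"
    show "hamiltonian G"
    proof (rule hamiltonian_if_segmented[OF assms(2) bar])
      fix j assume j: "1 \<le> j" "j < x"
      then obtain Q where "four_cycle_class G p \<gamma> C j Q"
        "\<forall>e\<in>annulus_edges G C (Suc j). \<exists>F\<in>outer_faces G p \<gamma> C j - Q. attached G p \<gamma> C (Suc j) e F"
        using h[rule_format, of "Suc j"] by auto
      then show "\<exists>Ss. segmented j Ss" by (rule segmented_off_class[OF j])
    qed
  qed
qed


end
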